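(* Let $k\ge1$ be an integer, and consider blocking RSA on $T_k$. Set $\beta(t):=P[X_t^{T_k^*}(v_0)=0]$ (for blocking RSA on $T_k^*$). Then for $0\le t\le1$ and for integer $m\ge1$, $$\mathrm{Cov}(m,t,T_k)=-\frac{\beta(t)^2}{2}\sum_{n=0}^\infty\frac{(2\log\beta(t))^{m+1+2n}}{(m+1+2n)!},$$ where $\mathrm{Cov}(m,t,T_k):=\mathrm{Cov}(X_t^{T_k}(v),X_t^{T_k}(w))$ for any vertices $v,w$ of $T_k$ at graph distance $m$ from each other.
   Context: $T_k$ is the infinite $(k+1)$-regular tree (connected, acyclic, every vertex of degree $k+1$). $T_k^*$ is the infinite tree in which one vertex, the root $v_0$, has degree $k$ and all other vertices have degree $k+1$. The covariance of $X_t^{T_k}(v)$ and $X_t^{T_k}(w)$ depends on $v,w$ only through their graph distance. Blocking RSA on a finite graph $V$: $\tau_v$, $v\in V$, are i.i.d. uniform on $(0,1)$. All sites are initially vacant (state $0$); at time $\tau_v$ site $v$ becomes occupied (state $1$) if and only if none of its neighbours is already occupied; otherwise nothing changes at that time. Occupied sites stay occupied forever. $X_t^V(v)\in\{0,1\}$ is the state of $v$ at time $t$. For countably infinite $V$ of bounded degree, $X_t^V(v):=\lim_n X_t^{V_n}(v)$, where $(V_n)$ is any sequence of finite subsets of $V$ with $\bigcup_n\bigcap_{m\ge n}V_m=V$ and the process on the induced subgraph $V_n$ uses the same $(\tau_v)$; almost surely this limit exists for all $v,t$ and does not depend on the sequence. *)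

theory Defs
  imports "HOL-Probability.Probability"
begin

text \<open>
  A graph is given by a vertex set \<open>V\<close> and an adjacency relation \<open>E\<close>; the pairs in
  \<open>E ^^ n\<close> are those joined by a walk of length \<open>n\<close>.
\<close>

definition simple_graph :: "'a set \<Rightarrow> 'a rel \<Rightarrow> bool" where
  "simple_graph V E \<longleftrightarrow> E \<subseteq> V \<times> V \<and> sym E \<and> irrefl E"

definition connected_graph :: "'a set \<Rightarrow> 'a rel \<Rightarrow> bool" where
  "connected_graph V E \<longleftrightarrow> V \<noteq> {} \<and> (\<forall>v\<in>V. \<forall>w\<in>V. (v, w) \<in> E\<^sup>*)"

definition graph_cycle :: "'a rel \<Rightarrow> 'a list \<Rightarrow> bool" where
  "graph_cycle E xs \<longleftrightarrow> length xs \<ge> 3 \<and> distinct xs \<and>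
     (\<forall>i<length xs. (xs ! i, xs ! (Suc i mod length xs)) \<in> E)"

definition is_tree :: "'a set \<Rightarrow> 'a rel \<Rightarrow> bool" where
  "is_tree V E \<longleftrightarrow> simple_graph V E \<and> connected_graph V E \<and> (\<nexists>xs. graph_cycle E xs)"

definition graph_degree :: "'a rel \<Rightarrow> 'a \<Rightarrow> nat" where
  "graph_degree E v = card (E `` {v})"

definition graph_dist :: "'a rel \<Rightarrow> 'a \<Rightarrow> 'a \<Rightarrow> nat" where
  "graph_dist E v w = (LEAST n. (v, w) \<in> E ^^ n)"

definition regular_tree :: "nat \<Rightarrow> 'a set \<Rightarrow> 'a rel \<Rightarrow> bool" where
  "regular_tree k V E \<longleftrightarrow> is_tree V E \<and> infinite V \<and> (\<forall>v\<in>V. graph_degree E v = k + 1)"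

definition rooted_regular_tree :: "nat \<Rightarrow> 'a set \<Rightarrow> 'a rel \<Rightarrow> 'a \<Rightarrow> bool" where
  "rooted_regular_tree k V E v0 \<longleftrightarrow> is_tree V E \<and> infinite V \<and> v0 \<in> V \<and>
     graph_degree E v0 = k \<and> (\<forall>v\<in>V - {v0}. graph_degree E v = k + 1)"

text \<open>
  Blocking RSA on the subgraph induced by a finite set \<open>W\<close>, for fixed arrival times \<open>\<tau>\<close>:
  \<open>occupied E W \<tau> t v\<close> says that \<open>v\<close> is occupied at time \<open>t\<close>. The neighbours that can
  already be occupied at time \<open>\<tau> v\<close> are those with a smaller arrival time (ties have
  probability zero). The conjunct \<open>finite W\<close> makes the recursion well-founded.
\<close>

declare conj_cong [fundef_cong]

function occupied :: "'a rel \<Rightarrow> 'a set \<Rightarrow> ('a \<Rightarrow> real) \<Rightarrow> real \<Rightarrow> 'a \<Rightarrow> bool" where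
  "occupied E W \<tau> t v \<longleftrightarrow> finite W \<and> v \<in> W \<and> \<tau> v \<le> t \<and>
     (\<forall>w. w \<in> W \<and> (v, w) \<in> E \<and> \<tau> w < \<tau> v \<longrightarrow> \<not> occupied E W \<tau> (\<tau> v) w)"
  by pat_completeness auto
termination
proof (relation "Wellfounded.measure (\<lambda>(E, W, \<tau>, t, v). card {u \<in> W. \<tau> u < \<tau> v})", goal_cases)
  case 1
  show ?case by simp
next
  case (2 E W \<tau> t v w)
  then have "{u \<in> W. \<tau> u < \<tau> w} \<subset> {u \<in> W. \<tau> u < \<tau> v}" by auto
  with 2 show ?case by (auto intro!: psubset_card_mono)
qed

declare occupied.simps [simp del]

definition rsa_finite :: "'a rel \<Rightarrow> 'a set \<Rightarrow> ('a \<Rightarrow> real) \<Rightarrow> real \<Rightarrow> 'a \<Rightarrow> real" where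
  "rsa_finite E W \<tau> t v = of_bool (occupied E W \<tau> t v)"

definition exhausting :: "'a set \<Rightarrow> (nat \<Rightarrow> 'a set) \<Rightarrow> bool" where
  "exhausting V W \<longleftrightarrow> (\<forall>n. finite (W n) \<and> W n \<subseteq> V) \<and> (\<Union>n. \<Inter>m\<in>{n..}. W m) = V"

text \<open>
  The state on a countable graph is the common limit along all exhausting sequences of
  finite subsets. The limit exists, and does not depend on the sequence, for almost every
  choice of arrival times; for the exceptional ones the value below is unspecified.
\<close>

definition rsa :: "'a set \<Rightarrow> 'a rel \<Rightarrow> ('a \<Rightarrow> real) \<Rightarrow> real \<Rightarrow> 'a \<Rightarrow> real" where
  "rsa V E \<tau> t v =
     (THE x. \<forall>W. exhausting V W \<longrightarrow> (\<lambda>n. rsa_finite E (W n) \<tau> t v) \<longlonglongrightarrow> x)"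

definition iid_uniform :: "'w measure \<Rightarrow> 'a set \<Rightarrow> ('a \<Rightarrow> 'w \<Rightarrow> real) \<Rightarrow> bool" where
  "iid_uniform M V \<tau> \<longleftrightarrow> prob_space M \<and> prob_space.indep_vars M (\<lambda>_. borel) \<tau> V \<and>
     (\<forall>v\<in>V. distr M borel (\<tau> v) = uniform_measure lborel {0<..<1})"

definition covariance :: "'w measure \<Rightarrow> ('w \<Rightarrow> real) \<Rightarrow> ('w \<Rightarrow> real) \<Rightarrow> real" where
  "covariance M X Y =
     (\<integral>\<omega>. (X \<omega> - (\<integral>\<omega>'. X \<omega>' \<partial>M)) * (Y \<omega> - (\<integral>\<omega>'. Y \<omega>' \<partial>M)) \<partial>M)"

end

theory Submission
  imports Defs
begin

text \<open>
  Write \<open>b\<close> for the solution of \<open>b' = - b ^ k\<close>, \<open>b 0 = 1\<close>. In \<open>T\<^sub>k\<^sup>*\<close> the root becomes occupied at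
  its arrival time \<open>s\<close> exactly when its \<open>k\<close> children are still vacant then, and before time \<open>s\<close>
  the subtrees at the children evolve independently as copies of \<open>T\<^sub>k\<^sup>*\<close>. Hence
  \<open>\<beta> t = 1 - (\<integral>s\<le>t. \<beta> s ^ k)\<close>, so \<open>\<beta> = b\<close>, and in the same way a site of \<open>T\<^sub>k\<close> is occupied at
  time \<open>t\<close> with probability \<open>\<integral>s\<le>t. b s ^ (k + 1)\<close>, which is \<open>(1 - (b t)\<^sup>2) / 2\<close>.

  For the covariance, let \<open>u 0 = v, \<dots>, u m = w\<close> be the path between the two sites. Removing its
  edges leaves \<open>m + 1\<close> disjoint pieces of the tree. Let the free time of \<open>u l\<close> be its arrival time
  if no neighbour outside the path blocks it, and \<open>2\<close> (never) otherwise. The free times are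
  independent; on \<open>(0, 1)\<close> they have density \<open>b ^ k\<close> at the two ends and \<open>b ^ (k - 1)\<close> in the
  interior (\<open>free_time_rate\<close>, \<open>indep_free_times\<close>), and the states of \<open>v\<close> and \<open>w\<close> are those of blocking
  RSA on the path with the free times as arrival times. Unfolding the blocking rule from \<open>v\<close>
  towards \<open>w\<close> gives the inclusion-exclusion formula (\<open>alternating_chain_expansion\<close>)
  that the indicator of \<open>v\<close> being occupied is the alternating sum, over \<open>a = 0, \<dots>, m\<close>, of the
  indicators that the free times decrease along \<open>u 0, \<dots>, u a\<close> starting below \<open>t\<close>; the same holds
  for \<open>w\<close> from the other end.

  Multiply the two expansions (\<open>expectation_path_product\<close>). Two chains that overlap in an edge would
  order its two free times in both ways, so they contribute nothing; disjoint chains are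
  independent; and chains from the two ends with exactly one common site contribute the integral, over the
  free time of that site, of the product of two independent probabilities. In the time scale
  \<open>- ln (b s)\<close> interior free times have density one, and these probabilities are
  given by truncated exponential series (\<open>chain_prob\<close>). The resulting expression is summed in
  closed form by looking at its increment from \<open>m\<close> to \<open>m + 1\<close>: an integration by parts
  together with a convolution identity collapses it to a tail of the exponential series
  (\<open>chain_pair_overlap\<close>), and the increments of the series in the theorem are, up to sign, the same tails.

  Behind this stands the construction of the infinite process. Cutting the blocking rule off
  at depth \<open>n\<close>, with everything deeper vacant, bounds the state of a site in every large finite
  volume from below for even \<open>n\<close> and from above for odd \<open>n\<close> (\<open>occupied_sandwich\<close>). The
  vacancy probabilities at depth \<open>n\<close> and time \<open>s\<close> differ from \<open>b s\<close> by at most \<open>(k s) ^ n / n!\<close> (\<open>occ_time_vacancy_bound\<close>), so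
  both bounds have the same limit in probability and, being nested, agree from some depth on almost surely.
\<close>

section \<open>Rates and the closed form of the chain sums\<close>

text \<open>
  The density \<open>b ^ (k - 1)\<close> of a free time in the interior of a path, where \<open>b\<close> is the vacancy
  probability below: at time \<open>s\<close> a site with \<open>k - 1\<close> neighbours outside the path is free of
  blocking from outside with this probability.
\<close>

definition arrival_rate :: "nat \<Rightarrow> real \<Rightarrow> real" where
  "arrival_rate k s = 1 / (1 + (real k - 1) * s)"

text \<open>
  The primitive of \<open>arrival_rate\<close>. Measured by this clock, free times in the interior of
  a path arrive at unit rate.
\<close>

definition clock :: "nat \<Rightarrow> real \<Rightarrow> real" where
  "clock k s = (if k = 1 then s else ln (1 + (real k - 1) * s) / (real k - 1))"

text \<open>
  The solution of \<open>b' = - b ^ k\<close> with \<open>b 0 = 1\<close>. Writing it as an exponential of the clock treats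
  \<open>k = 1\<close> and \<open>k > 1\<close> alike.
\<close>

definition vacancy :: "nat \<Rightarrow> real \<Rightarrow> real" where
  "vacancy k s = exp (- clock k s)"

text \<open>
  For \<open>i > 0\<close> this is the probability that \<open>i\<close> successive free times, the first one at an end of
  the path, decrease from below \<open>t\<close> to above \<open>s\<close>. The value \<open>b s\<close> at \<open>i = 0\<close> is a
  convention: it is the factor that turns the interior density \<open>b ^ (k - 1)\<close> into the
  density \<open>b ^ k\<close> of an end, so that chains meeting at an end need no separate formula.
\<close>

definition chain_prob :: "nat \<Rightarrow> real \<Rightarrow> nat \<Rightarrow> real \<Rightarrow> real" where
  "chain_prob k t i s =
     vacancy k s - vacancy k t * (\<Sum>j<i. (clock k t - clock k s) ^ j / fact j)"

lemma arrival_rate_denominator_pos: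
  assumes "k \<ge> 1" "0 \<le> s"
  shows "1 + (real k - 1) * s > 0"
  using assms by (simp add: add_pos_nonneg)

lemma clock_0 [simp]: "clock k 0 = 0"
  by (simp add: clock_def)

lemma vacancy_0 [simp]: "vacancy k 0 = 1"
  by (simp add: vacancy_def)

lemma vacancy_pos [simp]: "vacancy k s > 0"
  by (simp add: vacancy_def)

lemma vacancy_nonzero [simp]: "vacancy k s \<noteq> 0"
  by (simp add: vacancy_def)

lemma DERIV_clock:
  assumes "k \<ge> 1" "0 \<le> s"
  shows "(clock k has_real_derivative arrival_rate k s) (at s)"
proof (cases "k = 1")
  case True
  then show ?thesis
    by (simp add: clock_def[abs_def] arrival_rate_def)
next
  case False
  then have "real k - 1 \<noteq> 0" using assms by simp
  then show ?thesis
    using False arrival_rate_denominator_pos[OF assms]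
    by (auto simp: clock_def[abs_def] arrival_rate_def intro!: derivative_eq_intros)
qed

lemmas DERIV_clock_chain [derivative_intros] = DERIV_clock[THEN DERIV_chain2]

lemma DERIV_vacancy:
  assumes "k \<ge> 1" "0 \<le> s"
  shows "(vacancy k has_real_derivative - (arrival_rate k s * vacancy k s)) (at s)"
  unfolding vacancy_def[abs_def] using assms
  by (auto intro!: derivative_eq_intros)

lemmas DERIV_vacancy_chain [derivative_intros] = DERIV_vacancy[THEN DERIV_chain2]

lemma isCont_arrival_rate:
  assumes "k \<ge> 1" "0 \<le> s"
  shows "isCont (arrival_rate k) s"
  unfolding arrival_rate_def[abs_def] using arrival_rate_denominator_pos[OF assms]
  by (auto intro!: continuous_intros)

lemma isCont_clock: "k \<ge> 1 \<Longrightarrow> 0 \<le> s \<Longrightarrow> isCont (clock k) s"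
  by (rule DERIV_isCont[OF DERIV_clock])

lemma isCont_vacancy: "k \<ge> 1 \<Longrightarrow> 0 \<le> s \<Longrightarrow> isCont (vacancy k) s"
  by (rule DERIV_isCont[OF DERIV_vacancy])

lemma vacancy_power:
  assumes "k \<ge> 1" "0 \<le> s"
  shows "vacancy k s ^ (k - 1) = arrival_rate k s"
proof (cases "k = 1")
  case True
  then show ?thesis by (simp add: arrival_rate_def)
next
  case False
  have pos: "1 + (real k - 1) * s > 0" by (rule arrival_rate_denominator_pos[OF assms])
  have "vacancy k s ^ (k - 1) = exp (real (k - 1) * (- clock k s))"
    by (simp add: vacancy_def flip: exp_of_nat_mult)
  also have "real (k - 1) * (- clock k s) = - ln (1 + (real k - 1) * s)"
    using False assms(1) by (simp add: clock_def of_nat_diff)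
  finally show ?thesis
    using pos by (simp add: exp_minus arrival_rate_def inverse_eq_divide)
qed

lemma vacancy_power_Suc:
  assumes "k \<ge> 1" "0 \<le> s"
  shows "vacancy k s ^ k = arrival_rate k s * vacancy k s"
proof -
  have "vacancy k s ^ k = vacancy k s ^ (k - 1) * vacancy k s"
    using assms(1) by (cases k) simp_all
  then show ?thesis by (simp only: vacancy_power[OF assms])
qed

lemma clock_mono:
  assumes "k \<ge> 1" "0 \<le> s" "s \<le> t"
  shows "clock k s \<le> clock k t"
proof (rule DERIV_nonneg_imp_nondecreasing[OF assms(3)])
  fix x assume "s \<le> x" "x \<le> t"
  then have "0 \<le> x" using assms(2) by simp
  then show "\<exists>y. DERIV (clock k) x :> y \<and> 0 \<le> y"
    using DERIV_clock[OF assms(1) \<open>0 \<le> x\<close>] arrival_rate_denominator_pos[OF assms(1) \<open>0 \<le> x\<close>]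
    by (intro exI[of _ "arrival_rate k x"]) (simp add: arrival_rate_def)
qed

lemma vacancy_le_1: "k \<ge> 1 \<Longrightarrow> 0 \<le> s \<Longrightarrow> vacancy k s \<le> 1"
  using clock_mono[of k 0 s] by (simp add: vacancy_def)

lemma integral_vacancy_power:
  assumes "k \<ge> 1" "0 \<le> s"
  shows "(\<integral>r. vacancy k r ^ k * indicator {0..s} r \<partial>lborel) = 1 - vacancy k s"
proof -
  have "(\<integral>r. vacancy k r ^ k * indicator {0..s} r \<partial>lborel) = - vacancy k s - (- vacancy k 0)"
    using assms
    by (intro integral_FTC_Icc_real)
       (auto intro!: derivative_eq_intros isCont_power isCont_vacancy simp: vacancy_power_Suc)
  then show ?thesis by simp
qed

lemma integral_vacancy_power_Suc:
  assumes "k \<ge> 1" "0 \<le> s"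
  shows "(\<integral>r. vacancy k r ^ (k + 1) * indicator {0..s} r \<partial>lborel) = (1 - (vacancy k s)\<^sup>2) / 2"
proof -
  have "(\<integral>r. vacancy k r ^ (k + 1) * indicator {0..s} r \<partial>lborel)
      = - ((vacancy k s)\<^sup>2 / 2) - (- ((vacancy k 0)\<^sup>2 / 2))"
    using assms
    by (intro integral_FTC_Icc_real)
       (auto intro!: derivative_eq_intros isCont_mult isCont_power isCont_vacancy
             simp: vacancy_power_Suc power2_eq_square)
  then show ?thesis by (simp add: diff_divide_distrib)
qed

lemma chain_prob_0: "chain_prob k t 0 s = vacancy k s"
  by (simp add: chain_prob_def)

lemma chain_prob_Suc:
  "chain_prob k t (Suc i) s =
     chain_prob k t i s - vacancy k t * ((clock k t - clock k s) ^ i / fact i)"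
  by (simp add: chain_prob_def algebra_simps)

lemma chain_prob_end: "chain_prob k t (Suc i) t = 0"
proof -
  have "(\<Sum>j<Suc i. (clock k t - clock k t) ^ j / fact j) = (1::real)"
    by (induction i) auto
  then show ?thesis unfolding chain_prob_def by simp
qed

lemma DERIV_power_over_fact:
  fixes f :: "real \<Rightarrow> real"
  assumes "(f has_real_derivative f') (at s)"
  shows "((\<lambda>s. f s ^ Suc n / fact (Suc n)) has_real_derivative f' * (f s ^ n / fact n)) (at s)"
proof -
  have "((\<lambda>s. f s ^ Suc n / fact (Suc n)) has_real_derivative
      (1 + of_nat n) * (f' * f s ^ n) / fact (Suc n)) (at s)"
    by (intro DERIV_cdivide DERIV_power_Suc assms)
  also have "(1 + of_nat n) * (f' * f s ^ n) / fact (Suc n) = f' * (f s ^ n / fact n)"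
    by (simp add: fact_Suc)
  finally show ?thesis .
qed

text \<open>
  Differentiating in \<open>s\<close> fixes the last free time of the chain at \<open>s\<close> and leaves a chain with one
  member less.
\<close>

lemma DERIV_chain_prob_Suc:
  assumes "k \<ge> 1" "0 \<le> s"
  shows "(chain_prob k t (Suc i) has_real_derivative - (arrival_rate k s * chain_prob k t i s)) (at s)"
proof (induction i)
  case 0
  then show ?case
    using assms by (auto simp: chain_prob_def[abs_def] intro!: derivative_eq_intros)
next
  case (Suc i)
  have "((\<lambda>s. vacancy k t * ((clock k t - clock k s) ^ Suc i / fact (Suc i)))
      has_real_derivative vacancy k t * (- arrival_rate k s * ((clock k t - clock k s) ^ i / fact i))) (at s)"
    using assms by (intro DERIV_cmult DERIV_power_over_fact) (auto intro!: derivative_eq_intros)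
  from DERIV_diff[OF Suc this] show ?case
    by (simp add: chain_prob_Suc[of k t "Suc i", abs_def] chain_prob_Suc[of k t i] algebra_simps)
qed

lemma isCont_chain_prob:
  assumes "k \<ge> 1" "0 \<le> s"
  shows "isCont (chain_prob k t i) s"
  unfolding chain_prob_def[abs_def] using assms
  by (intro continuous_intros isCont_vacancy isCont_clock) auto

lemma integral_chain_prob:
  assumes "k \<ge> 1" "0 \<le> r" "r \<le> t"
  shows "(\<integral>s. (arrival_rate k s * chain_prob k t i s) * indicator {r..t} s \<partial>lborel)
    = chain_prob k t (Suc i) r"
proof -
  have "(\<integral>s. (arrival_rate k s * chain_prob k t i s) * indicator {r..t} s \<partial>lborel)
     = - chain_prob k t (Suc i) t - (- chain_prob k t (Suc i) r)"
    using assms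
    by (intro integral_FTC_Icc_real)
       (auto intro!: derivative_eq_intros DERIV_chain_prob_Suc isCont_mult isCont_arrival_rate
          isCont_chain_prob)
  then show ?thesis by (simp add: chain_prob_end)
qed

text \<open>
  The integrand for two chains, from the two ends of a path with \<open>n\<close> edges, that end at a common site
  at time \<open>s\<close>, up to the rate of that site.
\<close>

definition chain_convolution :: "nat \<Rightarrow> real \<Rightarrow> nat \<Rightarrow> real \<Rightarrow> real" where
  "chain_convolution k t n s = (\<Sum>i\<le>n. chain_prob k t i s * chain_prob k t (n - i) s)"

lemma binomial_exp_sum:
  fixes r :: real
  shows "(\<Sum>i\<le>n. (r ^ i / fact i) * (r ^ (n - i) / fact (n - i))) = (2 * r) ^ n / fact n"
proof -
  have "(2 * r) ^ n / fact n = (\<Sum>i\<le>n. of_nat (n choose i) * r ^ i * r ^ (n - i)) / fact n"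
    by (simp only: mult_2 binomial_ring)
  also have "\<dots> = (\<Sum>i\<le>n. (r ^ i / fact i) * (r ^ (n - i) / fact (n - i)))"
    unfolding sum_divide_distrib
    by (intro sum.cong) (auto simp: binomial_fact)
  finally show ?thesis by simp
qed

text \<open>
  Let \<open>G\<close> be the generating function \<open>\<Sum>i. chain_prob k t i s * x ^ i\<close> and \<open>r\<close> the clock time
  between \<open>s\<close> and \<open>t\<close>. Then \<open>(1 - x) * G = b s - b t * x * exp (r * x)\<close>, and therefore
  \<open>(1 - x) * G\<^sup>2 - 2 * b s * G = ((b t)\<^sup>2 * x\<^sup>2 * exp (2 * r * x) - (b s)\<^sup>2) / (1 - x)\<close>,
  because the mixed terms cancel. The lemma compares coefficients.
\<close>

lemma chain_convolution_diff:
  "chain_convolution k t (Suc m) s - chain_convolution k t m s - 2 * vacancy k s * chain_prob k t (Suc m) s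
    = (vacancy k t)\<^sup>2 * (\<Sum>j<m. (2 * (clock k t - clock k s)) ^ j / fact j) - (vacancy k s)\<^sup>2"
proof -
  let ?g = "\<lambda>i. chain_prob k t i s" and ?b = "vacancy k t" and ?B = "vacancy k s"
  define r where "r = clock k t - clock k s"
  define e where "e i = r ^ i / fact i" for i
  have g0: "?g 0 = ?B" by (rule chain_prob_0)
  have gS: "?g (Suc i) = ?g i - ?b * e i" for i
    by (simp add: chain_prob_Suc e_def r_def)
  define Q where "Q n = (\<Sum>i\<le>n. e i * ?g (n - i))" for n
  \<comment> \<open>Multiplication by \<open>1 - x\<close>, applied to one factor of the square and, in the next fact, to the other.\<close>
  have conv: "chain_convolution k t (Suc n) s = ?B * ?g (Suc n) + chain_convolution k t n s - ?b * Q n" for n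
  proof -
    have "chain_convolution k t (Suc n) s = ?g 0 * ?g (Suc n) + (\<Sum>i\<le>n. ?g (Suc i) * ?g (n - i))"
      unfolding chain_convolution_def by (subst sum.atMost_Suc_shift) simp
    also have "(\<Sum>i\<le>n. ?g (Suc i) * ?g (n - i)) = chain_convolution k t n s - ?b * Q n"
      unfolding chain_convolution_def Q_def gS
      by (simp add: algebra_simps sum_subtractf sum_distrib_left)
    finally show ?thesis by (simp add: g0)
  qed
  have Q: "Q (Suc n) = e (Suc n) * ?B + Q n - ?b * ((2 * r) ^ n / fact n)" for n
  proof -
    have "Q (Suc n) = (\<Sum>i\<le>n. e i * ?g (Suc (n - i))) + e (Suc n) * ?g 0"
      unfolding Q_def by (simp add: Suc_diff_le)
    also have "(\<Sum>i\<le>n. e i * ?g (Suc (n - i))) = Q n - ?b * (\<Sum>i\<le>n. e i * e (n - i))"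
      unfolding Q_def gS by (simp add: algebra_simps sum_subtractf sum_distrib_left)
    also have "(\<Sum>i\<le>n. e i * e (n - i)) = (2 * r) ^ n / fact n"
      unfolding e_def by (rule binomial_exp_sum)
    finally show ?thesis by (simp add: g0)
  qed
  have "- ?B * ?g (Suc m) - ?b * Q m = ?b\<^sup>2 * (\<Sum>j<m. (2 * r) ^ j / fact j) - ?B\<^sup>2"
  proof (induction m)
    case 0
    show ?case by (simp add: gS g0 Q_def e_def power2_eq_square algebra_simps)
  next
    case (Suc m)
    have "- ?B * ?g (Suc (Suc m)) - ?b * Q (Suc m)
       = - ?B * ?g (Suc m) - ?b * Q m + ?b\<^sup>2 * ((2 * r) ^ m / fact m)"
      unfolding Q gS[of "Suc m"] by (simp add: algebra_simps power2_eq_square)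
    with Suc show ?case by (simp add: algebra_simps)
  qed
  then show ?thesis unfolding conv r_def by (simp add: algebra_simps)
qed

lemma isCont_chain_convolution:
  assumes "k \<ge> 1" "0 \<le> s"
  shows "isCont (chain_convolution k t i) s"
  unfolding chain_convolution_def[abs_def] using assms
  by (intro continuous_intros isCont_chain_prob) auto

text \<open>
  Total weight of pairs of chains from the two ends of a path with \<open>n\<close> edges that share exactly
  their last site.
\<close>

definition chain_overlap :: "nat \<Rightarrow> real \<Rightarrow> nat \<Rightarrow> real" where
  "chain_overlap k t n = (\<integral>s. (arrival_rate k s * chain_convolution k t n s) * indicator {0..t} s \<partial>lborel)"

text \<open>
  Total weight of pairs of disjoint chains that have \<open>n + 2\<close> sites together.
\<close>

definition chain_pair :: "nat \<Rightarrow> real \<Rightarrow> nat \<Rightarrow> real" where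
  "chain_pair k t n = (\<Sum>i\<le>n. chain_prob k t (Suc i) 0 * chain_prob k t (Suc (n - i)) 0)"

text \<open>
  Integration by parts for products of two chains: it expresses \<open>chain_pair\<close> as an integral
  that can be compared with \<open>chain_overlap\<close>.
\<close>

lemma DERIV_chain_convolution_shift:
  assumes "k \<ge> 1" "0 \<le> s"
  shows "((\<lambda>s. \<Sum>i\<le>n. chain_prob k t (Suc i) s * chain_prob k t (Suc (n - i)) s) has_real_derivative
     - (arrival_rate k s * (2 * chain_convolution k t (Suc n) s - 2 * vacancy k s * chain_prob k t (Suc n) s))) (at s)"
proof -
  let ?g = "\<lambda>i. chain_prob k t i s" and ?\<gamma> = "arrival_rate k s"
  have "((\<lambda>s. \<Sum>i\<le>n. chain_prob k t (Suc i) s * chain_prob k t (Suc (n - i)) s) has_real_derivative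
      (\<Sum>i\<le>n. - (?\<gamma> * ?g i) * ?g (Suc (n - i)) + - (?\<gamma> * ?g (n - i)) * ?g (Suc i))) (at s)"
    using assms by (intro DERIV_sum DERIV_mult DERIV_chain_prob_Suc) auto
  also have "(\<Sum>i\<le>n. - (?\<gamma> * ?g i) * ?g (Suc (n - i)) + - (?\<gamma> * ?g (n - i)) * ?g (Suc i))
     = - (?\<gamma> * ((\<Sum>i\<le>n. ?g i * ?g (Suc (n - i))) + (\<Sum>i\<le>n. ?g (Suc i) * ?g (n - i))))"
    by (simp add: sum_distrib_left sum.distrib sum_negf algebra_simps sum_subtractf)
  also have "(\<Sum>i\<le>n. ?g i * ?g (Suc (n - i))) = chain_convolution k t (Suc n) s - ?g (Suc n) * vacancy k s"
    unfolding chain_convolution_def by (simp add: chain_prob_0 Suc_diff_le)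
  also have "(\<Sum>i\<le>n. ?g (Suc i) * ?g (n - i)) = chain_convolution k t (Suc n) s - vacancy k s * ?g (Suc n)"
    unfolding chain_convolution_def by (subst sum.atMost_Suc_shift) (simp add: chain_prob_0)
  finally show ?thesis by (simp add: algebra_simps)
qed

text \<open>
  The left side is, up to sign, the increment of the expected product of the two end states when
  the path grows by one edge. Under the integral all three terms combine, by
  \<open>chain_convolution_diff\<close>, to \<open>b\<^sup>2\<close> minus a multiple of a truncated exponential series in the
  clock time, which has an elementary primitive.
\<close>

lemma chain_pair_overlap:
  assumes "k \<ge> 1" "0 \<le> t"
  shows "chain_overlap k t (Suc n) + chain_overlap k t n - chain_pair k t n =
    (exp (2 * clock k t) * (vacancy k t)\<^sup>2 - (vacancy k t)\<^sup>2 * (\<Sum>j\<le>n. (2 * clock k t) ^ j / fact j)) / 2"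
proof -
  let ?F = "\<lambda>s. \<Sum>i\<le>n. chain_prob k t (Suc i) s * chain_prob k t (Suc (n - i)) s"
  let ?h = "\<lambda>s. (vacancy k s)\<^sup>2 - (vacancy k t)\<^sup>2 * (\<Sum>j\<le>n. (2 * (clock k t - clock k s)) ^ j / fact j)"
  have pair: "has_bochner_integral lborel (\<lambda>s. (arrival_rate k s * (2 * chain_convolution k t (Suc n) s
        - 2 * vacancy k s * chain_prob k t (Suc n) s)) * indicator {0..t} s) (chain_pair k t n)"
  proof -
    have "has_bochner_integral lborel (\<lambda>s. (arrival_rate k s * (2 * chain_convolution k t (Suc n) s
        - 2 * vacancy k s * chain_prob k t (Suc n) s)) * indicator {0..t} s) (- ?F t - (- ?F 0))"
      using assms DERIV_minus[OF DERIV_chain_convolution_shift[of k _ t n]]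
      by (intro has_bochner_integral_FTC_Icc_real)
         (auto intro!: continuous_intros isCont_arrival_rate isCont_chain_convolution isCont_vacancy isCont_chain_prob)
    then show ?thesis by (simp add: chain_prob_end chain_pair_def)
  qed
  have overlap: "has_bochner_integral lborel (\<lambda>s. (arrival_rate k s * chain_convolution k t i s) * indicator {0..t} s)
      (chain_overlap k t i)" for i
  proof -
    have "integrable lborel (\<lambda>s. (arrival_rate k s * chain_convolution k t i s) * indicator {0..t} s)"
      using assms by (intro borel_integrable_atLeastAtMost)
        (auto intro!: isCont_mult isCont_arrival_rate isCont_chain_convolution)
    then show ?thesis unfolding chain_overlap_def by (rule has_bochner_integral_integrable)
  qed
  have int: "has_bochner_integral lborel (\<lambda>s. (arrival_rate k s * ((vacancy k s)\<^sup>2 -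
       (vacancy k t)\<^sup>2 * (\<Sum>j<n. (2 * (clock k t - clock k s)) ^ j / fact j))) * indicator {0..t} s)
     (- ?h t / 2 - (- ?h 0 / 2))"
  proof (rule has_bochner_integral_FTC_Icc_real[OF assms(2)])
    fix s :: real assume s: "0 \<le> s" "s \<le> t"
    have D: "((\<lambda>s. \<Sum>j\<le>n. (2 * (clock k t - clock k s)) ^ j / fact j) has_real_derivative
       - 2 * arrival_rate k s * (\<Sum>j<n. (2 * (clock k t - clock k s)) ^ j / fact j)) (at s)"
    proof (induction n)
      case (Suc n)
      have "((\<lambda>s. (2 * (clock k t - clock k s)) ^ Suc n / fact (Suc n)) has_real_derivative
        - 2 * arrival_rate k s * ((2 * (clock k t - clock k s)) ^ n / fact n)) (at s)"
        using assms s by (intro DERIV_power_over_fact) (auto intro!: derivative_eq_intros)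
      from DERIV_add[OF Suc this] show ?case
        by (simp add: algebra_simps)
    qed simp
    show "((\<lambda>s. - ?h s / 2) has_real_derivative arrival_rate k s * ((vacancy k s)\<^sup>2 -
       (vacancy k t)\<^sup>2 * (\<Sum>j<n. (2 * (clock k t - clock k s)) ^ j / fact j))) (at s)"
    proof -
      have "((\<lambda>s. (vacancy k s)\<^sup>2) has_real_derivative - 2 * (arrival_rate k s * (vacancy k s)\<^sup>2)) (at s)"
        using assms s by (auto intro!: derivative_eq_intros simp: power2_eq_square)
      from DERIV_cdivide[OF DERIV_minus[OF DERIV_diff[OF this DERIV_cmult[OF D, of "(vacancy k t)\<^sup>2"]]], of 2]
      show ?thesis by (rule DERIV_cong) (simp add: algebra_simps add_divide_distrib diff_divide_distrib)
    qed
    show "isCont (\<lambda>s. arrival_rate k s * ((vacancy k s)\<^sup>2 -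
       (vacancy k t)\<^sup>2 * (\<Sum>j<n. (2 * (clock k t - clock k s)) ^ j / fact j))) s"
      using assms s by (intro continuous_intros isCont_arrival_rate isCont_vacancy isCont_clock) auto
  qed
  have "has_bochner_integral lborel (\<lambda>s. (arrival_rate k s * ((vacancy k s)\<^sup>2 -
       (vacancy k t)\<^sup>2 * (\<Sum>j<n. (2 * (clock k t - clock k s)) ^ j / fact j))) * indicator {0..t} s)
     (chain_overlap k t (Suc n) + chain_overlap k t n - chain_pair k t n)"
  proof (rule has_bochner_integral_cong[THEN iffD1, OF refl _ refl,
        OF _ has_bochner_integral_diff[OF has_bochner_integral_add[OF overlap overlap] pair]])
    fix s
    have "chain_convolution k t (Suc n) s + chain_convolution k t n s -
        (2 * chain_convolution k t (Suc n) s - 2 * vacancy k s * chain_prob k t (Suc n) s)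
      = (vacancy k s)\<^sup>2 - (vacancy k t)\<^sup>2 * (\<Sum>j<n. (2 * (clock k t - clock k s)) ^ j / fact j)"
      using chain_convolution_diff[of k t n s] by simp
    from arg_cong[OF this, of "\<lambda>x. (arrival_rate k s * x) * indicator {0..t} s"]
    show "arrival_rate k s * chain_convolution k t (Suc n) s * indicator {0..t} s +
        arrival_rate k s * chain_convolution k t n s * indicator {0..t} s -
        arrival_rate k s * (2 * chain_convolution k t (Suc n) s - 2 * vacancy k s * chain_prob k t (Suc n) s) *
        indicator {0..t} s =
        arrival_rate k s * ((vacancy k s)\<^sup>2 -
         (vacancy k t)\<^sup>2 * (\<Sum>j<n. (2 * (clock k t - clock k s)) ^ j / fact j)) * indicator {0..t} s"
      by (simp add: algebra_simps)
  qed
  from has_bochner_integral_eq[OF this int]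
  have "chain_overlap k t (Suc n) + chain_overlap k t n - chain_pair k t n = ?h 0 / 2 - ?h t / 2"
    by linarith
  moreover have "?h t = 0"
  proof -
    have "(\<Sum>j\<le>n. (2 * (clock k t - clock k t)) ^ j / fact j) = (1::real)"
      by (induction n) auto
    then show ?thesis by simp
  qed
  moreover have "exp (2 * clock k t) * (vacancy k t)\<^sup>2 = 1"
    by (simp add: vacancy_def power2_eq_square flip: exp_add)
  moreover have "?h 0 = 1 - (vacancy k t)\<^sup>2 * (\<Sum>j\<le>n. (2 * clock k t) ^ j / fact j)"
    by simp
  ultimately show ?thesis by (simp only: diff_zero div_0)
qed

lemma exp_tail:
  fixes x :: real
  shows "(\<lambda>n. x ^ (m + n) / fact (m + n)) sums (exp x - (\<Sum>j<m. x ^ j / fact j))"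
  using sums_split_initial_segment[OF exp_converges[of x], of m]
  by (simp add: divide_inverse mult.commute add.commute)

lemma parity_tail_summable:
  fixes x :: real
  shows "summable (\<lambda>n. x ^ (m + 2 * n) / fact (m + 2 * n))"
proof -
  have abs: "summable (\<lambda>n. norm (x ^ (m + n) / fact (m + n)))"
    using sums_summable[OF exp_tail[of "\<bar>x\<bar>" m]] by (simp add: power_abs)
  have "summable ((\<lambda>n. norm (x ^ (m + n) / fact (m + n))) \<circ> (\<lambda>n. 2 * n))"
    by (rule summable_reindex[OF abs]) (auto simp: inj_on_def)
  then show ?thesis
    by (intro summable_norm_cancel[of "\<lambda>n. x ^ (m + 2 * n) / fact (m + 2 * n)"]) (simp only: o_def)
qed

text \<open>
  The series of the theorem: every second term of the exponential series, starting at \<open>m\<close>.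
\<close>

definition parity_tail :: "real \<Rightarrow> nat \<Rightarrow> real" where
  "parity_tail x m = (\<Sum>n. x ^ (m + 2 * n) / fact (m + 2 * n))"

text \<open>
  Interleaving two neighbouring tails restores the full tail of the exponential series.
\<close>

lemma parity_tail_add:
  "parity_tail x m + parity_tail x (Suc m) = exp x - (\<Sum>j<m. x ^ j / fact j)"
proof -
  let ?f = "\<lambda>n. x ^ (m + n) / fact (m + n)"
  have "(\<lambda>n. \<Sum>i\<in>{n * 2..<n * 2 + 2}. ?f i) sums (exp x - (\<Sum>j<m. x ^ j / fact j))"
    by (rule sums_group[OF exp_tail]) simp
  moreover have "(\<Sum>i\<in>{n * 2..<n * 2 + 2}. ?f i) =
      x ^ (m + 2 * n) / fact (m + 2 * n) + x ^ (Suc m + 2 * n) / fact (Suc m + 2 * n)" for n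
  proof -
    have "{n * 2..<n * 2 + 2} = {2 * n, Suc (2 * n)}" by auto
    then show ?thesis by simp
  qed
  ultimately have "(\<lambda>n. x ^ (m + 2 * n) / fact (m + 2 * n) + x ^ (Suc m + 2 * n) / fact (Suc m + 2 * n))
       sums (exp x - (\<Sum>j<m. x ^ j / fact j))"
    by (simp only:)
  moreover have "(\<lambda>n. x ^ (m + 2 * n) / fact (m + 2 * n) + x ^ (Suc m + 2 * n) / fact (Suc m + 2 * n))
       sums (parity_tail x m + parity_tail x (Suc m))"
    unfolding parity_tail_def by (intro sums_add summable_sums parity_tail_summable)
  ultimately show ?thesis
    by (rule sums_unique2[symmetric])
qed

lemma parity_tail_minus: "parity_tail (- x) m = (-1) ^ m * parity_tail x m"
proof -
  have "(- x) ^ (m + 2 * n) / fact (m + 2 * n) = (-1) ^ m * (x ^ (m + 2 * n) / fact (m + 2 * n))" for n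
    by (simp add: power_add power_mult power_minus[of x m])
  then show ?thesis
    unfolding parity_tail_def by (simp only: suminf_mult[OF parity_tail_summable])
qed

lemma parity_tail_1: "parity_tail x 1 = (exp x - exp (- x)) / 2"
proof -
  have 1: "parity_tail x 0 + parity_tail x 1 = exp x"
    using parity_tail_add[of x 0] by simp
  with parity_tail_add[of "- x" 0] have "parity_tail x 0 - parity_tail x 1 = exp (- x)"
    by (simp add: parity_tail_minus)
  with 1 show ?thesis by simp
qed

text \<open>
  Both sides have the same increments in \<open>m\<close>, and at \<open>m = 0\<close> both are the variance \<open>p - p\<^sup>2\<close> of a
  single site, \<open>p = (1 - (b t)\<^sup>2) / 2\<close>.
\<close>

lemma chain_sum_closed_form:
  assumes "k \<ge> 1" "0 \<le> t"
  shows "(\<Sum>n<m. (-1) ^ n * chain_pair k t n) + (-1) ^ m * chain_overlap k t m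
      - ((1 - (vacancy k t)\<^sup>2) / 2)\<^sup>2
    = - ((vacancy k t)\<^sup>2 / 2) * parity_tail (2 * ln (vacancy k t)) (m + 1)"
proof (induction m)
  case 0
  have "chain_convolution k t 0 s = (vacancy k s)\<^sup>2" for s
    by (simp add: chain_convolution_def chain_prob_0 power2_eq_square)
  then have "chain_overlap k t 0 = (\<integral>r. vacancy k r ^ (k + 1) * indicator {0..t} r \<partial>lborel)"
    unfolding chain_overlap_def using assms
    by (intro Bochner_Integration.integral_cong)
       (auto simp: vacancy_power_Suc power2_eq_square indicator_def)
  also have "\<dots> = (1 - (vacancy k t)\<^sup>2) / 2"
    by (rule integral_vacancy_power_Suc[OF assms])
  finally have 1: "chain_overlap k t 0 = (1 - (vacancy k t)\<^sup>2) / 2" .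
  have "exp (2 * ln (vacancy k t)) = (vacancy k t)\<^sup>2"
    by (simp add: exp_double)
  then have "parity_tail (2 * ln (vacancy k t)) 1 = ((vacancy k t)\<^sup>2 - 1 / (vacancy k t)\<^sup>2) / 2"
    unfolding parity_tail_1 exp_minus by (simp add: inverse_eq_divide)
  moreover have "(1 - b) / 2 - ((1 - b) / 2)\<^sup>2 = - (b / 2) * ((b - 1 / b) / 2)" if "b > 0" for b :: real
  proof -
    have "b / 2 * ((b - 1 / b) / 2) = (b * b - 1) / 4" using that by (simp add: right_diff_distrib)
    then show ?thesis by (simp add: power2_eq_square algebra_simps add_divide_distrib diff_divide_distrib)
  qed
  from this[of "(vacancy k t)\<^sup>2"]
  have "(1 - (vacancy k t)\<^sup>2) / 2 - ((1 - (vacancy k t)\<^sup>2) / 2)\<^sup>2 =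
      - ((vacancy k t)\<^sup>2 / 2) * (((vacancy k t)\<^sup>2 - 1 / (vacancy k t)\<^sup>2) / 2)"
    by simp
  ultimately show ?case by (simp add: 1)
next
  case (Suc m)
  let ?x = "2 * ln (vacancy k t)" and ?b = "(vacancy k t)\<^sup>2"
  have x: "?x = - (2 * clock k t)" by (simp add: vacancy_def)
  have "parity_tail (2 * clock k t) (Suc m) + parity_tail (2 * clock k t) (Suc (Suc m))
      = exp (2 * clock k t) - (\<Sum>j\<le>m. (2 * clock k t) ^ j / fact j)"
    using parity_tail_add[of "2 * clock k t" "Suc m"] by (simp only: lessThan_Suc_atMost)
  then have "chain_overlap k t (Suc m) + chain_overlap k t m - chain_pair k t m =
     ?b / 2 * (parity_tail (2 * clock k t) (Suc m) + parity_tail (2 * clock k t) (Suc (Suc m)))"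
    unfolding chain_pair_overlap[OF assms] by (simp only:) (simp add: algebra_simps diff_divide_distrib)
  then have "(-1) ^ Suc m * (chain_overlap k t (Suc m) + chain_overlap k t m - chain_pair k t m) =
     ?b / 2 * (parity_tail ?x (Suc m) - parity_tail ?x (Suc (Suc m)))"
    unfolding x parity_tail_minus by (simp add: algebra_simps)
  with Suc show ?case by (simp add: algebra_simps)
qed

section \<open>Branches of a tree\<close>

text \<open>
  The part of the tree that is seen from \<open>v\<close> when walking away from \<open>u\<close>. For \<open>u = v\<close> the walks never return
  to \<open>v\<close>, and the branch is the whole component of \<open>v\<close>; this lets a root be treated like a vertex with
  a parent.
\<close>

definition branch :: "'a rel \<Rightarrow> 'a \<Rightarrow> 'a \<Rightarrow> 'a set" where
  "branch E u v = {x. (v, x) \<in> {(a, b) \<in> E. b \<noteq> u}\<^sup>*}"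

lemma branch_self: "v \<in> branch E u v"
  by (simp add: branch_def)

lemma branch_step: "x \<in> branch E u v \<Longrightarrow> (x, y) \<in> E \<Longrightarrow> y \<noteq> u \<Longrightarrow> y \<in> branch E u v"
  by (auto simp: branch_def intro: rtrancl_into_rtrancl)

lemma branch_induct [consumes 1, case_names self step]:
  assumes "x \<in> branch E u v" and "P v"
    and "\<And>x y. x \<in> branch E u v \<Longrightarrow> P x \<Longrightarrow> (x, y) \<in> E \<Longrightarrow> y \<noteq> u \<Longrightarrow> P y"
  shows "P x"
  using assms(1) unfolding branch_def mem_Collect_eq
  by (induction rule: rtrancl_induct) (use assms(2,3) in \<open>auto simp: branch_def\<close>)

lemma branch_avoids:
  assumes "u \<noteq> v"
  shows "u \<notin> branch E u v"
proof -
  have "x \<noteq> u" if "x \<in> branch E u v" for x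
    using that by (induction rule: branch_induct) (use assms in auto)
  then show ?thesis by blast
qed

lemma branch_subset_vertices:
  assumes "E \<subseteq> V \<times> V" "v \<in> V"
  shows "branch E u v \<subseteq> V"
proof
  fix x assume "x \<in> branch E u v"
  then show "x \<in> V" by (induction rule: branch_induct) (use assms in auto)
qed

lemma rtrancl_distinct_path:
  assumes "(a, b) \<in> R\<^sup>*"
  shows "\<exists>xs. xs \<noteq> [] \<and> hd xs = a \<and> last xs = b \<and> distinct xs \<and> successively (\<lambda>x y. (x, y) \<in> R) xs"
  using assms
proof (induction rule: converse_rtrancl_induct)
  case base
  show ?case by (rule exI[of _ "[b]"]) simp
next
  case (step a a')
  then obtain xs where xs: "xs \<noteq> []" "hd xs = a'" "last xs = b" "distinct xs"
    "successively (\<lambda>x y. (x, y) \<in> R) xs"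
    by blast
  show ?case
  proof (cases "a \<in> set xs")
    case False
    then show ?thesis
      using xs step(1) by (intro exI[of _ "a # xs"]) (auto simp: successively_Cons)
  next
    case True
    then obtain ys zs where "xs = ys @ a # zs" by (auto simp: in_set_conv_decomp)
    then show ?thesis
      using xs by (intro exI[of _ "a # zs"]) (auto simp: successively_append_iff)
  qed
qed

text \<open>
  A common vertex would give a walk from \<open>w\<close> to \<open>w'\<close> avoiding \<open>v\<close>; a simple path with the same
  ends closes up through \<open>v\<close> to a cycle.
\<close>

lemma branch_disjoint:
  assumes "simple_graph V E" "\<nexists>xs. graph_cycle E xs"
    and "(v, w) \<in> E" "(v, w') \<in> E" "w \<noteq> w'"
  shows "branch E v w \<inter> branch E v w' = {}"
proof (rule ccontr)
  \<comment> \<open>Unlike the steps inside a branch, these are symmetric, so walks may be reversed.\<close>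
  let ?R = "{(a, b) \<in> E. a \<noteq> v \<and> b \<noteq> v}"
  have sym: "sym E" and irr: "irrefl E" using assms(1) by (auto simp: simple_graph_def)
  then have neq: "w \<noteq> v" "w' \<noteq> v" using assms by (auto simp: irrefl_def)
  have reach: "(a, x) \<in> ?R\<^sup>*" if "x \<in> branch E v a" "a \<noteq> v" for a x
    using that(1)
  proof (induction rule: branch_induct)
    case (step x y)
    then have "x \<noteq> v" using branch_avoids[of v a E] that(2) by auto
    with step show ?case by (auto intro: rtrancl_into_rtrancl)
  qed simp
  assume "branch E v w \<inter> branch E v w' \<noteq> {}"
  then obtain x where x: "(w, x) \<in> ?R\<^sup>*" "(w', x) \<in> ?R\<^sup>*"
    using reach neq by blast
  have "sym ?R" using sym by (auto simp: sym_def)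
  then have "(x, w') \<in> ?R\<^sup>*" using x(2) by (meson sym_rtrancl symD)
  with x(1) have "(w, w') \<in> ?R\<^sup>*" by (rule rtrancl_trans)
  from rtrancl_distinct_path[OF this] obtain xs where xs: "xs \<noteq> []" "hd xs = w" "last xs = w'"
    "distinct xs" "successively (\<lambda>x y. (x, y) \<in> ?R) xs"
    by blast
  have v: "v \<notin> set xs"
  proof
    assume "v \<in> set xs"
    then obtain ys zs where d: "xs = ys @ v # zs" by (auto simp: in_set_conv_decomp)
    show False
    proof (cases zs)
      case Nil
      then show False using d xs neq by simp
    next
      case (Cons z zs')
      then show False using d xs(5) by (simp add: successively_append_iff)
    qed
  qed
  have len: "length xs \<ge> 2"
  proof -
    have "length xs \<noteq> 1"
      using xs(1-3) assms(5) by (cases xs) auto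
    then show ?thesis using xs(1) by (cases xs) (auto simp: neq_Nil_conv Suc_le_eq)
  qed
  have "graph_cycle E (v # xs)"
    unfolding graph_cycle_def
  proof (intro conjI allI impI)
    fix i assume i: "i < length (v # xs)"
    consider "i = 0" | j where "i = Suc j" "Suc j < length xs" | "i = length xs"
      using i by (cases i) (auto simp: less_Suc_eq)
    then show "((v # xs) ! i, (v # xs) ! (Suc i mod length (v # xs))) \<in> E"
    proof cases
      case 1
      then show ?thesis using xs(1,2) assms(3) by (simp add: hd_conv_nth)
    next
      case 2
      then show ?thesis using xs(5) by (auto simp: successively_conv_nth)
    next
      case 3
      then have "(v # xs) ! i = w'" using xs(1,3) by (simp add: last_conv_nth nth_Cons')
      then show ?thesis using 3 assms(4) sym by (auto dest: symD)
    qed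
  qed (use len v xs in auto)
  with assms(2) show False by blast
qed

text \<open>
  A walk inside the branch of \<open>w\<close> could only leave the branch of \<open>v\<close> through \<open>u\<close>, but \<open>u\<close> lies in a
  different branch at \<open>v\<close>.
\<close>

lemma branch_child_subset:
  assumes "simple_graph V E" "\<nexists>xs. graph_cycle E xs"
    and "(v, w) \<in> E" "w \<noteq> u" "u = v \<or> (v, u) \<in> E"
  shows "branch E v w \<subseteq> branch E u v"
proof
  have "v \<noteq> w" using assms(1,3) by (auto simp: simple_graph_def irrefl_def)
  have u: "u \<notin> branch E v w"
  proof (cases "u = v")
    case True
    then show ?thesis using branch_avoids[OF \<open>v \<noteq> w\<close>] by simp
  next
    case False
    then have "branch E v w \<inter> branch E v u = {}"
      using assms by (intro branch_disjoint) auto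
    then show ?thesis using branch_self[of u E v] by blast
  qed
  fix x assume "x \<in> branch E v w"
  then have "x \<in> branch E u v \<and> x \<in> branch E v w"
  proof (induction rule: branch_induct)
    case self
    show ?case using branch_step[OF branch_self assms(3,4)] by (simp add: branch_self)
  next
    case (step x y)
    then have "y \<in> branch E v w" by (auto intro: branch_step)
    with u have "y \<noteq> u" by auto
    with step \<open>y \<in> branch E v w\<close> show ?case by (auto intro: branch_step)
  qed
  then show "x \<in> branch E u v" by simp
qed

section \<open>Occupation times\<close>

text \<open>
  The time at which \<open>v\<close> becomes occupied when only the branch of \<open>v\<close> away from \<open>u\<close> is
  present, cut off at depth \<open>n\<close>. The value \<open>2\<close>, later than all arrivals, stands for never. A child \<open>w\<close> does not
  see its parent \<open>v\<close>: it matters only if it is occupied before \<open>v\<close> arrives, and until then \<open>v\<close> is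
  vacant.
\<close>

fun occ_time :: "'a rel \<Rightarrow> nat \<Rightarrow> 'a \<Rightarrow> 'a \<Rightarrow> ('a \<Rightarrow> real) \<Rightarrow> real" where
  "occ_time E 0 u v x = 2"
| "occ_time E (Suc n) u v x = (if \<forall>w\<in>E `` {v} - {u}. x v \<le> occ_time E n v w x then x v else 2)"

text \<open>
  Meaningful where the approximations are eventually constant in the depth, which is the predicate
  \<open>stabilises\<close>.
\<close>

definition branch_time :: "'a rel \<Rightarrow> 'a \<Rightarrow> 'a \<Rightarrow> ('a \<Rightarrow> real) \<Rightarrow> real" where
  "branch_time E u v x = lim (\<lambda>n. occ_time E n u v x)"

definition stabilises :: "'a rel \<Rightarrow> 'a \<Rightarrow> 'a \<Rightarrow> ('a \<Rightarrow> real) \<Rightarrow> bool" where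
  "stabilises E u v x \<longleftrightarrow> (\<forall>\<^sub>F n in sequentially. occ_time E n u v x = branch_time E u v x)"

lemma occ_time_cases: "occ_time E n u v x = x v \<or> occ_time E n u v x = 2"
  by (cases n) auto

lemma stabilisesI:
  assumes "\<And>n. n \<ge> N \<Longrightarrow> occ_time E n u v x = c"
  shows "stabilises E u v x"
proof -
  have ev: "\<forall>\<^sub>F n in sequentially. occ_time E n u v x = c"
    using assms by (auto simp: eventually_sequentially)
  then have "(\<lambda>n. occ_time E n u v x) \<longlonglongrightarrow> c"
    by (simp add: tendsto_eventually)
  then have "branch_time E u v x = c" by (simp add: branch_time_def limI)
  with ev show ?thesis by (simp add: stabilises_def)
qed

lemma branch_time_rec:
  assumes "finite (E `` {v})" "stabilises E u v x" "\<And>w. w \<in> E `` {v} - {u} \<Longrightarrow> stabilises E v w x"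
  shows "branch_time E u v x = (if \<forall>w\<in>E `` {v} - {u}. x v \<le> branch_time E v w x then x v else 2)"
proof -
  have "\<forall>\<^sub>F n in sequentially. \<forall>w\<in>E `` {v} - {u}. occ_time E n v w x = branch_time E v w x"
    using assms by (intro eventually_ball_finite) (auto simp: stabilises_def)
  moreover have "\<forall>\<^sub>F n in sequentially. occ_time E (Suc n) u v x = branch_time E u v x"
    using assms(2) eventually_sequentially_Suc[of "\<lambda>n. occ_time E n u v x = branch_time E u v x"]
    by (simp add: stabilises_def del: occ_time.simps)
  ultimately obtain n where n: "\<forall>w\<in>E `` {v} - {u}. occ_time E n v w x = branch_time E v w x"
      "occ_time E (Suc n) u v x = branch_time E u v x"
    using eventually_happens'[OF sequentially_bot eventually_conj] by blast
  have "(\<forall>w\<in>E `` {v} - {u}. x v \<le> occ_time E n v w x) \<longleftrightarrow>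
      (\<forall>w\<in>E `` {v} - {u}. x v \<le> branch_time E v w x)"
    using n(1) by (intro ball_cong) auto
  with n(2) show ?thesis by simp
qed

text \<open>
  The recursion reverses the order: later occupation of the children means earlier occupation of the
  parent. Started from the largest value, its iterates therefore alternate around their limit
  with shrinking distance.
\<close>

lemma occ_time_nested:
  assumes "E \<subseteq> V \<times> V" "\<And>z. z \<in> V \<Longrightarrow> x z \<le> 2" "v \<in> V" "j \<le> n"
  shows "(even j \<longrightarrow> occ_time E n u v x \<le> occ_time E j u v x) \<and>
    (odd j \<longrightarrow> occ_time E j u v x \<le> occ_time E n u v x)"
  using assms(3,4)
proof (induction j arbitrary: n u v)
  case 0
  then show ?case using occ_time_cases[of E n u v x] assms(2) by auto
next
  case (Suc j)
  then obtain n' where n: "n = Suc n'" "j \<le> n'" by (cases n) auto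
  have child: "w \<in> V" if "w \<in> E `` {v} - {u}" for w
    using that assms(1) by auto
  have le: "x v \<le> 2" by (rule assms(2)[OF Suc.prems(1)])
  have mono: "(if \<forall>w\<in>E `` {v} - {u}. x v \<le> f w then x v else 2)
      \<le> (if \<forall>w\<in>E `` {v} - {u}. x v \<le> g w then x v else 2)"
    if "\<And>w. w \<in> E `` {v} - {u} \<Longrightarrow> g w \<le> f w" for f g :: "'a \<Rightarrow> real"
    using that le by (auto intro: order.trans)
  show ?case
    unfolding n(1) occ_time.simps using Suc.IH[OF child n(2)]
    by (intro conjI impI mono) auto
qed

lemma stabilises_if_consecutive:
  assumes "E \<subseteq> V \<times> V" "\<And>z. z \<in> V \<Longrightarrow> x z \<le> 2" "v \<in> V"
    and "occ_time E (2 * j) u v x = occ_time E (2 * j + 1) u v x"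
  shows "stabilises E u v x"
proof (rule stabilisesI)
  fix n assume n: "n \<ge> 2 * j + 1"
  show "occ_time E n u v x = occ_time E (2 * j) u v x"
    using occ_time_nested[of E V x v "2 * j" n u] occ_time_nested[of E V x v "2 * j + 1" n u]
      assms n by (auto simp del: occ_time.simps)
qed

fun graph_ball :: "'a rel \<Rightarrow> nat \<Rightarrow> 'a \<Rightarrow> 'a set" where
  "graph_ball E 0 v = {v}"
| "graph_ball E (Suc n) v = insert v (\<Union>w\<in>E `` {v}. graph_ball E n w)"

lemma graph_ball_self: "v \<in> graph_ball E n v"
  by (cases n) auto

lemma graph_ball_subset:
  assumes "E \<subseteq> V \<times> V"
  shows "v \<in> V \<Longrightarrow> graph_ball E n v \<subseteq> V"
  by (induction n arbitrary: v) (use assms in auto)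

lemma finite_graph_ball:
  assumes "E \<subseteq> V \<times> V" "\<And>v. v \<in> V \<Longrightarrow> finite (E `` {v})"
  shows "v \<in> V \<Longrightarrow> finite (graph_ball E n v)"
  by (induction n arbitrary: v) (use assms in auto)

lemma graph_ball_mono: "graph_ball E n v \<subseteq> graph_ball E (Suc n) v"
  by (induction n arbitrary: v) auto

text \<open>
  Blocking in a finite graph passes only along decreasing arrival times, so a vertex reached
  from \<open>u\<close> never looks back at \<open>u\<close>, and the graph may be replaced by the branch. Whatever happens beyond
  depth \<open>n\<close> can only move the truth from the truncated value in the direction given by the
  parity of \<open>n\<close>.
\<close>

lemma occupied_sandwich:
  assumes "finite W" "graph_ball E n v \<subseteq> W" "u = v \<or> x v < x u" "t < 2"
  shows "(even n \<longrightarrow> occ_time E n u v x \<le> t \<longrightarrow> occupied E W x t v) \<and>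
    (odd n \<longrightarrow> occupied E W x t v \<longrightarrow> occ_time E n u v x \<le> t)"
  using assms(2-4)
proof (induction n arbitrary: u v t)
  case 0
  then show ?case by simp
next
  case (Suc n)
  have v: "v \<in> W" using Suc.prems graph_ball_self[of v E "Suc n"] by auto
  have IH: "(even n \<longrightarrow> occ_time E n v w x \<le> x v \<longrightarrow> occupied E W x (x v) w) \<and>
    (odd n \<longrightarrow> occupied E W x (x v) w \<longrightarrow> occ_time E n v w x \<le> x v)"
    if "w \<in> E `` {v}" "x w < x v" "x v < 2" for w
    using Suc.IH[of w v "x v"] that Suc.prems(1) by auto
  show ?case
  proof (intro conjI impI)
    assume "even (Suc n)" and le: "occ_time E (Suc n) u v x \<le> t"
    then have "odd n" by simp
    from le Suc.prems(3) have t: "x v \<le> t" and ch: "\<And>w. w \<in> E `` {v} - {u} \<Longrightarrow> x v \<le> occ_time E n v w x"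
      by (auto split: if_splits)
    have "\<not> occupied E W x (x v) w" if w: "(v, w) \<in> E" "x w < x v" for w
    proof
      assume "occupied E W x (x v) w"
      with IH[of w] w t Suc.prems(3) \<open>odd n\<close> have "occ_time E n v w x \<le> x v" by auto
      moreover have "w \<noteq> u" using w(2) Suc.prems(2) by auto
      with ch[of w] w have "x v \<le> occ_time E n v w x" by auto
      ultimately show False using occ_time_cases[of E n v w x] w(2) t Suc.prems(3) by auto
    qed
    then show "occupied E W x t v"
      using assms(1) v t by (subst occupied.simps) auto
  next
    assume "odd (Suc n)" and occ: "occupied E W x t v"
    then have "even n" by simp
    from occ have t: "x v \<le> t"
      and free: "\<And>w. w \<in> W \<Longrightarrow> (v, w) \<in> E \<Longrightarrow> x w < x v \<Longrightarrow> \<not> occupied E W x (x v) w"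
      by (subst (asm) occupied.simps; auto)+
    have "x v \<le> occ_time E n v w x" if w: "w \<in> E `` {v} - {u}" for w
    proof (rule ccontr)
      assume "\<not> ?thesis"
      then have lt: "occ_time E n v w x < x v" by simp
      then have "x w < x v" using occ_time_cases[of E n v w x] t Suc.prems(3) by auto
      moreover have "w \<in> W" using w graph_ball_self[of w E n] Suc.prems(1) by auto
      ultimately show False using IH[of w] free[of w] w lt \<open>even n\<close> t Suc.prems(3) by auto
    qed
    then show "occ_time E (Suc n) u v x \<le> t" using t by auto
  qed
qed

section \<open>The infinite-volume process\<close>

text \<open>
  The property holds for all sufficiently large finite sets of sites. This replaces the quantifier over
  exhausting sequences by quantifiers over countably many finite sets, which makes
  measurability accessible.
\<close>

definition settled :: "'a set \<Rightarrow> ('a set \<Rightarrow> bool) \<Rightarrow> bool" where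
  "settled V P \<longleftrightarrow> (\<exists>F. finite F \<and> F \<subseteq> V \<and> (\<forall>W. finite W \<longrightarrow> F \<subseteq> W \<longrightarrow> W \<subseteq> V \<longrightarrow> P W))"

lemma exhausting_absorbs:
  assumes "exhausting V W" "finite F" "F \<subseteq> V"
  shows "\<forall>\<^sub>F n in sequentially. F \<subseteq> W n"
proof -
  have "\<forall>\<^sub>F n in sequentially. a \<in> W n" if "a \<in> V" for a
    using assms(1) that unfolding exhausting_def eventually_sequentially by blast
  then have "\<forall>\<^sub>F n in sequentially. \<forall>a\<in>F. a \<in> W n"
    using assms(2,3) by (intro eventually_ball_finite) auto
  then show ?thesis by (simp add: subset_eq)
qed

text \<open>
  Enlarging the members of one increasing exhaustion arbitrarily gives an exhausting sequence again; this
  is how a sequence with the wrong limit is built when a state is not settled.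
\<close>

lemma exhausting_supersets:
  assumes "countable V"
  obtains F where "exhausting V F" "\<And>W. (\<And>n. finite (W n) \<and> F n \<subseteq> W n \<and> W n \<subseteq> V) \<Longrightarrow> exhausting V W"
proof
  define F where "F n = {a \<in> V. to_nat_on V a \<le> n}" for n
  have fin: "finite (F n)" for n
  proof (rule finite_imageD)
    show "finite (to_nat_on V ` F n)" by (rule finite_subset[of _ "{..n}"]) (auto simp: F_def)
    show "inj_on (to_nat_on V) (F n)"
      by (rule inj_on_subset[OF inj_on_to_nat_on[OF assms]]) (auto simp: F_def)
  qed
  show gen: "exhausting V W" if "\<And>n. finite (W n) \<and> F n \<subseteq> W n \<and> W n \<subseteq> V" for W
    unfolding exhausting_def
  proof (intro conjI allI equalityI subsetI)
    fix a assume "a \<in> V"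
    then have "a \<in> (\<Inter>m\<in>{to_nat_on V a..}. F m)" by (auto simp: F_def)
    also have "\<dots> \<subseteq> (\<Inter>m\<in>{to_nat_on V a..}. W m)" using that by blast
    finally show "a \<in> (\<Union>n. \<Inter>m\<in>{n..}. W m)" by blast
  next
    fix a assume "a \<in> (\<Union>n. \<Inter>m\<in>{n..}. W m)"
    then obtain n where "a \<in> W n" by auto
    then show "a \<in> V" using that[of n] by blast
  qed (use that in auto)
  show "exhausting V F"
    using fin by (intro gen) (auto simp: F_def)
qed

text \<open>
  If neither value is settled, then for either value some exhausting sequence avoids it throughout,
  so no limit is common to all sequences. The state then has one fixed unspecified value,
  the same for all configurations, and the process stays measurable.
\<close>

lemma rsa_settled:
  assumes "countable V"
  shows "rsa V E x t v = (if settled V (\<lambda>W. occupied E W x t v) then 1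
    else if settled V (\<lambda>W. \<not> occupied E W x t v) then 0 else (THE y. False))"
proof -
  obtain F where F: "exhausting V F"
    "\<And>W. (\<And>n. finite (W n) \<and> F n \<subseteq> W n \<and> W n \<subseteq> V) \<Longrightarrow> exhausting V W"
    using exhausting_supersets[OF assms] by blast
  have finF: "finite (F n)" "F n \<subseteq> V" for n using F(1) by (auto simp: exhausting_def)
  let ?lim = "\<lambda>y. \<forall>W. exhausting V W \<longrightarrow> (\<lambda>n. rsa_finite E (W n) x t v) \<longlonglongrightarrow> y"
  have 1: "?lim (of_bool b)" if "settled V (\<lambda>W. occupied E W x t v = b)" for b
  proof (intro allI impI)
    fix W assume W: "exhausting V W"
    from that obtain A where A: "finite A" "A \<subseteq> V"
      "\<And>W. finite W \<Longrightarrow> A \<subseteq> W \<Longrightarrow> W \<subseteq> V \<Longrightarrow> occupied E W x t v = b"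
      unfolding settled_def by blast
    have "\<forall>\<^sub>F n in sequentially. rsa_finite E (W n) x t v = of_bool b"
      using exhausting_absorbs[OF W A(1,2)]
      by eventually_elim (use A(3) W in \<open>auto simp: rsa_finite_def exhausting_def\<close>)
    then show "(\<lambda>n. rsa_finite E (W n) x t v) \<longlonglongrightarrow> of_bool b"
      by (rule tendsto_eventually)
  qed
  have 2: "\<exists>b. settled V (\<lambda>W. occupied E W x t v = b) \<and> y = of_bool b" if y: "?lim y" for y
  proof -
    have "(\<lambda>n. rsa_finite E (F n) x t v) \<longlonglongrightarrow> y" using y F(1) by blast
    moreover have "closed {0, 1 :: real}" by (simp add: finite_imp_closed)
    ultimately have "y \<in> {0, 1}"
      by (rule_tac Lim_in_closed_set[of "{0, 1}" _ sequentially]) (auto simp: rsa_finite_def)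
    then obtain b where b: "y = of_bool b" by (metis insertE empty_iff of_bool_eq(1,2))
    have "settled V (\<lambda>W. occupied E W x t v = b)"
    proof (rule ccontr)
      assume n: "\<not> ?thesis"
      have "\<exists>W. finite W \<and> F n \<subseteq> W \<and> W \<subseteq> V \<and> occupied E W x t v \<noteq> b" for n
        using n finF[of n] unfolding settled_def by blast
      then obtain W where W: "\<And>n. finite (W n) \<and> F n \<subseteq> W n \<and> W n \<subseteq> V \<and> occupied E (W n) x t v \<noteq> b"
        by metis
      have "exhausting V W" using W by (intro F(2)) blast
      then have "(\<lambda>n. rsa_finite E (W n) x t v) \<longlonglongrightarrow> y" using y by blast
      moreover have "rsa_finite E (W n) x t v = of_bool (\<not> b)" for n
        using W[of n] by (auto simp: rsa_finite_def)
      ultimately show False using b by (auto dest!: LIMSEQ_unique[OF _ tendsto_const] simp: of_bool_def split: if_splits)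
    qed
    with b show ?thesis by blast
  qed
  have uniq: "rsa V E x t v = of_bool b" if "settled V (\<lambda>W. occupied E W x t v = b)" for b
    unfolding rsa_def
  proof (rule the_equality)
    show "?lim (of_bool b)" using 1[OF that] .
    fix y assume "?lim y"
    then show "y = of_bool b" using 1[OF that] F(1) LIMSEQ_unique by blast
  qed
  show ?thesis
  proof (cases "\<exists>b. settled V (\<lambda>W. occupied E W x t v = b)")
    case True
    then obtain b where b: "settled V (\<lambda>W. occupied E W x t v = b)" by blast
    have False if "settled V (\<lambda>W. occupied E W x t v = True)" "settled V (\<lambda>W. occupied E W x t v = False)"
      using uniq[OF that(1)] uniq[OF that(2)] by simp
    then show ?thesis using uniq[OF b] b by (cases b) auto
  next
    case False
    then have "?lim = (\<lambda>_. False)" using 2 by (intro ext) blast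
    then have "rsa V E x t v = (THE y. False)" unfolding rsa_def by simp
    moreover have "\<not> settled V (\<lambda>W. occupied E W x t v)" "\<not> settled V (\<lambda>W. \<not> occupied E W x t v)"
      using False by (auto dest: spec[of _ True] spec[of _ False])
    ultimately show ?thesis by simp
  qed
qed

lemma rsa_branch_time:
  assumes "countable V" "E \<subseteq> V \<times> V" "\<And>v. v \<in> V \<Longrightarrow> finite (E `` {v})"
    and "v \<in> V" "stabilises E v v x" "t < 2"
  shows "rsa V E x t v = of_bool (branch_time E v v x \<le> t)"
proof -
  obtain N where N: "\<And>n. n \<ge> N \<Longrightarrow> occ_time E n v v x = branch_time E v v x"
    using assms(5) by (auto simp: stabilises_def eventually_sequentially)
  \<comment> \<open>Large enough for the sandwich at the two depths \<open>2 * N\<close> and \<open>2 * N + 1\<close>, which bound from either side.\<close>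
  define F where "F = graph_ball E (Suc (2 * N)) v"
  have F: "finite F" "F \<subseteq> V"
    unfolding F_def using finite_graph_ball[OF assms(2,3) assms(4)] graph_ball_subset[OF assms(2,4)] by blast+
  have occ: "occupied E W x t v \<longleftrightarrow> branch_time E v v x \<le> t" if W: "finite W" "F \<subseteq> W" for W
    using occupied_sandwich[of W E "2 * N" v v x t] occupied_sandwich[of W E "Suc (2 * N)" v v x t]
      N[of "2 * N"] N[of "Suc (2 * N)"] W assms(6) graph_ball_mono[of E "2 * N" v]
    unfolding F_def by auto
  have "settled V (\<lambda>W. occupied E W x t v = b)" if "b = (branch_time E v v x \<le> t)" for b
    unfolding settled_def using F occ that by blast
  moreover have "\<not> (settled V (\<lambda>W. occupied E W x t v) \<and> settled V (\<lambda>W. \<not> occupied E W x t v))"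
  proof
    assume "settled V (\<lambda>W. occupied E W x t v) \<and> settled V (\<lambda>W. \<not> occupied E W x t v)"
    then obtain A B where "finite A" "A \<subseteq> V" "\<And>W. finite W \<Longrightarrow> A \<subseteq> W \<Longrightarrow> W \<subseteq> V \<Longrightarrow> occupied E W x t v"
      "finite B" "B \<subseteq> V" "\<And>W. finite W \<Longrightarrow> B \<subseteq> W \<Longrightarrow> W \<subseteq> V \<Longrightarrow> \<not> occupied E W x t v"
      unfolding settled_def by blast
    then have "occupied E (A \<union> B) x t v" "\<not> occupied E (A \<union> B) x t v"
      by (meson finite_UnI Un_upper1 Un_upper2 Un_least)+
    then show False by simp
  qed
  ultimately show ?thesis
    unfolding rsa_settled[OF assms(1)] by (cases "branch_time E v v x \<le> t") auto
qed

lemma sets_settled: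
  assumes "countable V" "\<And>W. finite W \<Longrightarrow> W \<subseteq> V \<Longrightarrow> {\<omega> \<in> space M. P W \<omega>} \<in> sets M"
  shows "{\<omega> \<in> space M. settled V (\<lambda>W. P W \<omega>)} \<in> sets M"
proof -
  let ?\<F> = "{F. finite F \<and> F \<subseteq> V}"
  have "countable ?\<F>" using countable_Collect_finite_subset[OF assms(1)] by simp
  have "settled V Q \<longleftrightarrow> (\<exists>F\<in>?\<F>. \<forall>W\<in>{W \<in> ?\<F>. F \<subseteq> W}. Q W)" for Q
    unfolding settled_def Bex_def Ball_def mem_Collect_eq by meson
  then have "{\<omega> \<in> space M. settled V (\<lambda>W. P W \<omega>)} =
     {\<omega> \<in> space M. \<exists>F\<in>?\<F>. \<forall>W\<in>{W \<in> ?\<F>. F \<subseteq> W}. P W \<omega>}"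
    by (simp only:)
  also have "\<dots> \<in> sets M"
  proof (rule sets.sets_Collect_countable_Ex'[OF _ \<open>countable ?\<F>\<close>])
    fix F assume "F \<in> ?\<F>"
    have "countable {W \<in> ?\<F>. F \<subseteq> W}"
      by (rule countable_subset[OF _ \<open>countable ?\<F>\<close>]) auto
    then show "{\<omega> \<in> space M. \<forall>W\<in>{W \<in> ?\<F>. F \<subseteq> W}. P W \<omega>} \<in> sets M"
      using assms(2) by (intro sets.sets_Collect_countable_All') auto
  qed
  finally show ?thesis .
qed

text \<open>
  The blocking rule unrolled \<open>n\<close> times. The recursion for \<open>occupied\<close> ends at a depth that
  depends on the arrival times; unrolling to a fixed depth exhibits it as a finite
  combination of comparisons of arrival times.
\<close>

fun blocked_within :: "'a rel \<Rightarrow> 'a set \<Rightarrow> nat \<Rightarrow> ('a \<Rightarrow> real) \<Rightarrow> 'a \<Rightarrow> bool" where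
  "blocked_within E W 0 x v \<longleftrightarrow> False"
| "blocked_within E W (Suc n) x v \<longleftrightarrow>
     (\<exists>w\<in>W \<inter> E `` {v}. x w < x v \<and> \<not> blocked_within E W n x w)"

lemma occupied_blocked_within:
  assumes "finite W" "card {u \<in> W. x u < x v} < n"
  shows "occupied E W x t v \<longleftrightarrow> v \<in> W \<and> x v \<le> t \<and> \<not> blocked_within E W n x v"
  using assms(2)
proof (induction n arbitrary: v t)
  case 0
  then show ?case by simp
next
  case (Suc n)
  have "occupied E W x (x v) w \<longleftrightarrow> w \<in> W \<and> \<not> blocked_within E W n x w" if "w \<in> W" "x w < x v" for w
  proof -
    have "{u \<in> W. x u < x w} \<subset> {u \<in> W. x u < x v}" using that by auto
    then have "card {u \<in> W. x u < x w} < card {u \<in> W. x u < x v}"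
      using assms(1) by (intro psubset_card_mono) auto
    then show ?thesis using Suc that by auto
  qed
  then show ?case using assms(1) by (subst occupied.simps) auto
qed

lemma sets_occupied:
  assumes "finite W" "\<And>w. w \<in> W \<Longrightarrow> \<tau> w \<in> borel_measurable M"
  shows "{\<omega> \<in> space M. occupied E W (\<lambda>u. \<tau> u \<omega>) t v} \<in> sets M"
proof (cases "v \<in> W")
  case False
  then show ?thesis by (subst occupied.simps) simp
next
  case True
  have blocked: "{\<omega> \<in> space M. blocked_within E W n (\<lambda>u. \<tau> u \<omega>) v} \<in> sets M" if "v \<in> W" for n v
    using that
  proof (induction n arbitrary: v)
    case (Suc n)
    have "{\<omega> \<in> space M. \<tau> w \<omega> < \<tau> v \<omega>} \<in> sets M" if "w \<in> W" for w
      using assms(2) that Suc.prems by measurable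
    then show ?case
      using Suc assms(1)
      by (auto intro!: sets.sets_Collect_finite_Ex sets.sets_Collect_conj sets.sets_Collect_neg)
  qed simp
  have "occupied E W (\<lambda>u. \<tau> u \<omega>) t v \<longleftrightarrow>
     \<tau> v \<omega> \<le> t \<and> \<not> blocked_within E W (Suc (card W)) (\<lambda>u. \<tau> u \<omega>) v" for \<omega>
    using True assms(1) by (subst occupied_blocked_within[of _ _ _ "Suc (card W)"])
      (auto intro!: le_imp_less_Suc card_mono)
  moreover have "{\<omega> \<in> space M. \<tau> v \<omega> \<le> t} \<in> sets M"
    using assms(2)[OF True] by measurable
  ultimately show ?thesis
    using blocked[OF True]
    by (auto intro!: sets.sets_Collect_conj sets.sets_Collect_neg simp del: blocked_within.simps)
qed

lemma borel_measurable_rsa: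
  assumes "countable V" "\<And>w. w \<in> V \<Longrightarrow> \<tau> w \<in> borel_measurable M"
  shows "(\<lambda>\<omega>. rsa V E (\<lambda>u. \<tau> u \<omega>) t v) \<in> borel_measurable M"
  unfolding rsa_settled[OF assms(1)]
  by (intro measurable_If measurable_const sets_settled assms(1) sets_occupied
       sets.sets_Collect_neg) (use assms(2) in auto)

section \<open>Independence and conditioning\<close>

text \<open>
  A functional of configurations that depends measurably on the coordinates in \<open>A\<close> alone. Functionals that
  are local on disjoint sets turn independent arrival times into independent variables.
\<close>

definition local_on :: "'i set \<Rightarrow> (('i \<Rightarrow> real) \<Rightarrow> real) \<Rightarrow> bool" where
  "local_on A F \<longleftrightarrow> F \<in> borel_measurable (PiM A (\<lambda>_. borel)) \<and> (\<forall>z. F (restrict z A) = F z)"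

lemma local_on_mono:
  assumes "local_on A F" "A \<subseteq> B"
  shows "local_on B F"
proof -
  have "(\<lambda>z. F (restrict z A)) \<in> borel_measurable (PiM B (\<lambda>_. borel))"
    using assms by (intro measurable_compose[OF measurable_restrict_subset]) (auto simp: local_on_def)
  moreover have "F (restrict z B) = F z" for z
  proof -
    have "F (restrict z B) = F (restrict (restrict z B) A)"
      using assms(1) unfolding local_on_def by metis
    also have "restrict (restrict z B) A = restrict z A" using assms by (auto simp: restrict_def fun_eq_iff)
    also have "F (restrict z A) = F z" using assms by (simp add: local_on_def)
    finally show ?thesis .
  qed
  ultimately show ?thesis using assms by (simp add: local_on_def)
qed

lemma local_on_component: "a \<in> A \<Longrightarrow> local_on A (\<lambda>z. z a)"
  by (simp add: local_on_def)

lemma local_on_first_arrival: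
  assumes "finite C" "local_on A F" "\<And>w. w \<in> C \<Longrightarrow> local_on A (G w)"
  shows "local_on A (\<lambda>z. if \<forall>w\<in>C. F z \<le> G w z then F z else 2)"
  unfolding local_on_def
proof (intro conjI allI)
  have [measurable]: "F \<in> borel_measurable (PiM A (\<lambda>_. borel))"
    using assms by (simp add: local_on_def)
  have "{z \<in> space (PiM A (\<lambda>_. borel)). F z \<le> G w z} \<in> sets (PiM A (\<lambda>_. borel))" if "w \<in> C" for w
  proof -
    have [measurable]: "G w \<in> borel_measurable (PiM A (\<lambda>_. borel))"
      using assms(3)[OF that] by (simp add: local_on_def)
    show ?thesis by measurable
  qed
  then show "(\<lambda>z. if \<forall>w\<in>C. F z \<le> G w z then F z else 2) \<in> borel_measurable (PiM A (\<lambda>_. borel))"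
    using assms(1) by (intro measurable_If sets.sets_Collect_finite_All) auto
  fix z
  show "(if \<forall>w\<in>C. F (restrict z A) \<le> G w (restrict z A) then F (restrict z A) else 2)
      = (if \<forall>w\<in>C. F z \<le> G w z then F z else 2)"
    using assms(2,3) by (auto simp: local_on_def)
qed

context prob_space
begin

lemma indep_vars_local:
  assumes "indep_vars (\<lambda>_. borel) Y I" "\<And>j. j \<in> L \<Longrightarrow> K j \<subseteq> I" "disjoint_family_on K L"
    and "\<And>j. j \<in> L \<Longrightarrow> local_on (K j) (F j)"
  shows "indep_vars (\<lambda>_. borel) (\<lambda>j \<omega>. F j (\<lambda>i. Y i \<omega>)) L"
proof -
  have "indep_vars (\<lambda>_. borel) (\<lambda>j \<omega>. F j (restrict (\<lambda>i. Y i \<omega>) (K j))) L"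
    using assms(4) by (intro indep_vars_compose2[OF indep_vars_restrict[OF assms(1-3)]])
      (auto simp: local_on_def)
  then show ?thesis
    using assms(4) by (subst indep_vars_cong[OF refl _ refl, where Y = "\<lambda>j \<omega>. F j (restrict (\<lambda>i. Y i \<omega>) (K j))"])
      (auto simp: local_on_def)
qed

lemma random_variable_local:
  assumes "indep_vars (\<lambda>_. borel) Y I" "A \<subseteq> I" "local_on A F"
  shows "(\<lambda>\<omega>. F (\<lambda>i. Y i \<omega>)) \<in> borel_measurable M"
proof -
  have "(\<lambda>\<omega>. F (restrict (\<lambda>i. Y i \<omega>) A)) \<in> borel_measurable M"
    using assms by (intro measurable_compose[OF measurable_restrict])
      (auto simp: local_on_def indep_vars_def)
  then show ?thesis using assms by (simp add: local_on_def)
qed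

lemma expectation_mult_local:
  assumes "indep_vars (\<lambda>_. borel) Y I" "A \<subseteq> I" "B \<subseteq> I" "A \<inter> B = {}"
    and F: "local_on A F" "\<And>z. \<bar>F z\<bar> \<le> 1" and G: "local_on B G" "\<And>z. \<bar>G z\<bar> \<le> 1"
  shows "expectation (\<lambda>\<omega>. F (\<lambda>i. Y i \<omega>) * G (\<lambda>i. Y i \<omega>)) =
    expectation (\<lambda>\<omega>. F (\<lambda>i. Y i \<omega>)) * expectation (\<lambda>\<omega>. G (\<lambda>i. Y i \<omega>))"
proof (rule indep_var_lebesgue_integral)
  have "indep_var borel (F \<circ> (\<lambda>\<omega>. restrict (\<lambda>i. Y i \<omega>) A)) borel (G \<circ> (\<lambda>\<omega>. restrict (\<lambda>i. Y i \<omega>) B))"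
    using F G by (intro indep_var_compose[OF indep_var_restrict[OF assms(1,4,2,3)]])
      (auto simp: local_on_def)
  then show "indep_var borel (\<lambda>\<omega>. F (\<lambda>i. Y i \<omega>)) borel (\<lambda>\<omega>. G (\<lambda>i. Y i \<omega>))"
    using F G by (simp add: local_on_def comp_def)
  show "integrable M (\<lambda>\<omega>. F (\<lambda>i. Y i \<omega>))"
    using F by (intro integrable_const_bound[of _ 1] random_variable_local[OF assms(1,2)]) auto
  show "integrable M (\<lambda>\<omega>. G (\<lambda>i. Y i \<omega>))"
    using G by (intro integrable_const_bound[of _ 1] random_variable_local[OF assms(1,3)]) auto
qed

text \<open>
  Fubini for independent coordinates: the distinguished coordinate may be replaced by
  an independent copy.
\<close>

lemma expectation_decouple:
  fixes f :: "real \<Rightarrow> ('i \<Rightarrow> real) \<Rightarrow> real"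
  assumes ind: "indep_vars (\<lambda>_. borel) Y I" and a: "a \<in> I" and C: "C \<subseteq> I" "a \<notin> C"
    and f: "case_prod f \<in> borel_measurable (borel \<Otimes>\<^sub>M PiM C (\<lambda>_. borel))"
      "\<And>r z. f r (restrict z C) = f r z" "\<And>r z. \<bar>f r z\<bar> \<le> 1"
  shows "(\<lambda>r. expectation (\<lambda>\<omega>. f r (\<lambda>i. Y i \<omega>))) \<in> borel_measurable borel"
    and "expectation (\<lambda>\<omega>. f (Y a \<omega>) (\<lambda>i. Y i \<omega>)) =
     expectation (\<lambda>\<omega>'. expectation (\<lambda>\<omega>. f (Y a \<omega>') (\<lambda>i. Y i \<omega>)))"
proof -
  let ?P = "PiM C (\<lambda>_. borel) :: ('i \<Rightarrow> real) measure" and ?Z = "\<lambda>\<omega>. restrict (\<lambda>i. Y i \<omega>) C"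
  have Y: "Y i \<in> borel_measurable M" if "i \<in> I" for i
    using ind that by (auto simp: indep_vars_def)
  have Z[measurable]: "?Z \<in> measurable M ?P" using C Y by (intro measurable_restrict) auto
  have Ya[measurable]: "Y a \<in> borel_measurable M" using Y a by auto
  note f(1)[measurable]
  let ?Q = "PiM {a} (\<lambda>_. borel) :: ('i \<Rightarrow> real) measure" and ?X = "\<lambda>\<omega>. restrict (\<lambda>i. Y i \<omega>) {a}"
  have X[measurable]: "?X \<in> measurable M ?Q" using a Y by (intro measurable_restrict) auto
  have iv: "indep_var ?Q ?X ?P ?Z"
    using a C by (intro indep_var_restrict[OF ind]) auto
  interpret Z: prob_space "distr M ?P ?Z" by (rule prob_space_distr) measurable
  interpret X: prob_space "distr M ?Q ?X" by (rule prob_space_distr) measurable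
  interpret XZ: pair_prob_space "distr M ?Q ?X" "distr M ?P ?Z" ..
  have inner: "expectation (\<lambda>\<omega>. f r (\<lambda>i. Y i \<omega>)) = (\<integral>z. f r z \<partial>distr M ?P ?Z)" for r
  proof -
    have "(\<lambda>z. f r z) \<in> borel_measurable ?P"
      using measurable_compose[OF measurable_Pair1' f(1), of r] by simp
    then show ?thesis by (subst integral_distr) (auto simp: f(2))
  qed
  have "(\<lambda>r. \<integral>z. f r z \<partial>distr M ?P ?Z) \<in> borel_measurable borel"
    by (intro Z.borel_measurable_lebesgue_integral) simp
  then show meas: "(\<lambda>r. expectation (\<lambda>\<omega>. f r (\<lambda>i. Y i \<omega>))) \<in> borel_measurable borel"
    unfolding inner .
  let ?g = "\<lambda>p. f (fst p a) (snd p)"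
  have g[measurable]: "?g \<in> borel_measurable (?Q \<Otimes>\<^sub>M ?P)"
  proof -
    have "(\<lambda>p. (fst p a, snd p)) \<in> measurable (?Q \<Otimes>\<^sub>M ?P) (borel \<Otimes>\<^sub>M ?P)"
      by measurable
    from measurable_compose[OF this f(1)] show ?thesis by simp
  qed
  have "expectation (\<lambda>\<omega>. f (Y a \<omega>) (\<lambda>i. Y i \<omega>)) = expectation (\<lambda>\<omega>. ?g (?X \<omega>, ?Z \<omega>))"
    by (simp add: f(2))
  also have "\<dots> = (\<integral>p. ?g p \<partial>distr M (?Q \<Otimes>\<^sub>M ?P) (\<lambda>\<omega>. (?X \<omega>, ?Z \<omega>)))"
    using X Z g by (intro integral_distr[symmetric]) measurable
  also have "distr M (?Q \<Otimes>\<^sub>M ?P) (\<lambda>\<omega>. (?X \<omega>, ?Z \<omega>)) = distr M ?Q ?X \<Otimes>\<^sub>M distr M ?P ?Z"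
    using iv by (simp add: indep_var_distribution_eq)
  also have "(\<integral>p. ?g p \<partial>(distr M ?Q ?X \<Otimes>\<^sub>M distr M ?P ?Z)) =
     (\<integral>x. \<integral>z. f (x a) z \<partial>distr M ?P ?Z \<partial>distr M ?Q ?X)"
  proof -
    have "integrable (distr M ?Q ?X \<Otimes>\<^sub>M distr M ?P ?Z) ?g"
      using f(3) by (intro XZ.P.integrable_const_bound[of _ 1]) auto
    from XZ.integral_fst'[OF this] show ?thesis by simp
  qed
  also have "\<dots> = expectation (\<lambda>\<omega>'. \<integral>z. f (Y a \<omega>') z \<partial>distr M ?P ?Z)"
  proof (subst integral_distr[OF X])
    have "(\<lambda>x :: 'i \<Rightarrow> real. x a) \<in> measurable ?Q borel" by measurable
    from measurable_compose[OF this meas]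
    show "(\<lambda>x. \<integral>z. f (x a) z \<partial>distr M ?P ?Z) \<in> borel_measurable ?Q"
      unfolding inner .
  qed simp
  finally show "expectation (\<lambda>\<omega>. f (Y a \<omega>) (\<lambda>i. Y i \<omega>)) =
     expectation (\<lambda>\<omega>'. expectation (\<lambda>\<omega>. f (Y a \<omega>') (\<lambda>i. Y i \<omega>)))"
    unfolding inner .
qed

lemma expectation_uniform:
  fixes X :: "'a \<Rightarrow> real" and h :: "real \<Rightarrow> real"
  assumes X: "X \<in> borel_measurable M" "distr M borel X = uniform_measure lborel {0<..<1}"
    and h: "h \<in> borel_measurable borel"
  shows "expectation (\<lambda>\<omega>. h (X \<omega>)) = (\<integral>r. h r * indicator {0..1} r \<partial>lborel)"
proof -
  have "expectation (\<lambda>\<omega>. h (X \<omega>)) = (\<integral>r. h r \<partial>uniform_measure lborel {0<..<1})"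
    using integral_distr[OF X(1) h] by (simp add: X(2))
  also have "uniform_measure lborel {0<..<1::real} = density lborel (\<lambda>r. ennreal (indicator {0<..<1} r))"
    by (simp add: uniform_measure_def ennreal_indicator divide_ennreal_def)
  also have "(\<integral>r. h r \<partial>\<dots>) = (\<integral>r. indicator {0<..<1} r *\<^sub>R h r \<partial>lborel)"
    using h by (intro integral_density) auto
  also have "\<dots> = (\<integral>r. h r * indicator {0..1} r \<partial>lborel)"
  proof (rule integral_cong_AE)
    show "AE r in lborel. indicator {0<..<1} r *\<^sub>R h r = h r * indicator {0..1} r"
      using AE_lborel_singleton[of 0] AE_lborel_singleton[of 1]
      by eventually_elim (auto simp: indicator_def)
  qed (use h in auto)
  finally show ?thesis .
qed

lemma borel_measurable_prob_ge:
  assumes "X \<in> borel_measurable M"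
  shows "(\<lambda>r. prob {\<omega> \<in> space M. r \<le> X \<omega>}) \<in> borel_measurable (borel :: real measure)"
proof -
  have "mono (\<lambda>r. - prob {\<omega> \<in> space M. r \<le> X \<omega>})"
    using assms by (intro monoI) (auto intro!: finite_measure_mono)
  then have "(\<lambda>r. - (- prob {\<omega> \<in> space M. r \<le> X \<omega>})) \<in> borel_measurable borel"
    by (intro borel_measurable_uminus borel_measurable_mono)
  then show ?thesis by simp
qed

text \<open>
  Conditioning on the arrival time \<open>r\<close> of the distinguished coordinate, each of the others exceeds \<open>r\<close>
  independently.
\<close>

lemma expectation_first_arrival:
  fixes Y :: "'i \<Rightarrow> 'a \<Rightarrow> real"
  assumes ind: "indep_vars (\<lambda>_. borel) Y (insert a C)" and "a \<notin> C" "finite C"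
    and "distr M borel (Y a) = uniform_measure lborel {0<..<1}"
    and h: "h \<in> borel_measurable borel" "\<And>r. \<bar>h r\<bar> \<le> 1"
  shows "expectation (\<lambda>\<omega>. h (Y a \<omega>) * of_bool (\<forall>w\<in>C. Y a \<omega> \<le> Y w \<omega>)) =
    (\<integral>r. (h r * (\<Prod>w\<in>C. prob {\<omega> \<in> space M. r \<le> Y w \<omega>})) * indicator {0..1} r \<partial>lborel)"
proof -
  have Y[measurable]: "Y i \<in> borel_measurable M" if "i \<in> insert a C" for i
    using ind that by (auto simp: indep_vars_def)
  note h(1)[measurable]
  let ?f = "\<lambda>r (z :: 'i \<Rightarrow> real). h r * of_bool (\<forall>w\<in>C. r \<le> z w)"
  have meas: "case_prod ?f \<in> borel_measurable (borel \<Otimes>\<^sub>M PiM C (\<lambda>_. borel))"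
  proof -
    have "Measurable.pred (borel \<Otimes>\<^sub>M PiM C (\<lambda>_. borel)) (\<lambda>p. \<forall>w\<in>C. fst p \<le> (snd p w :: real))"
      using assms(3) by (intro pred_intros_finite) measurable
    then show ?thesis by (simp add: case_prod_beta)
  qed
  have all: "prob {\<omega> \<in> space M. \<forall>w\<in>C. r \<le> Y w \<omega>} = (\<Prod>w\<in>C. prob {\<omega> \<in> space M. r \<le> Y w \<omega>})" for r
  proof (cases "C = {}")
    case True
    then show ?thesis by (simp add: prob_space)
  next
    case False
    have "{\<omega> \<in> space M. \<forall>w\<in>C. r \<le> Y w \<omega>} = (\<Inter>w\<in>C. Y w -` {r..} \<inter> space M)"
      using False by auto
    moreover have "Y w -` {r..} \<inter> space M = {\<omega> \<in> space M. r \<le> Y w \<omega>}" for w by auto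
    moreover have "prob (\<Inter>w\<in>C. Y w -` {r..} \<inter> space M) = (\<Prod>w\<in>C. prob (Y w -` {r..} \<inter> space M))"
      using False assms(3) by (intro indep_varsD[OF ind]) auto
    ultimately show ?thesis by simp
  qed
  have inner: "expectation (\<lambda>\<omega>. ?f r (\<lambda>i. Y i \<omega>)) = h r * (\<Prod>w\<in>C. prob {\<omega> \<in> space M. r \<le> Y w \<omega>})" for r
  proof -
    have "expectation (\<lambda>\<omega>. of_bool (\<forall>w\<in>C. r \<le> Y w \<omega>) :: real)
       = expectation (indicator {\<omega> \<in> space M. \<forall>w\<in>C. r \<le> Y w \<omega>})"
      by (intro Bochner_Integration.integral_cong) (auto simp: indicator_def)
    also have "\<dots> = prob {\<omega> \<in> space M. \<forall>w\<in>C. r \<le> Y w \<omega>}" by (simp add: Int_def conj_commute)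
    finally show ?thesis by (simp add: all)
  qed
  have "expectation (\<lambda>\<omega>. ?f (Y a \<omega>) (\<lambda>i. Y i \<omega>)) =
      expectation (\<lambda>\<omega>'. expectation (\<lambda>\<omega>. ?f (Y a \<omega>') (\<lambda>i. Y i \<omega>)))"
    using h(2) assms(2) by (intro expectation_decouple(2)[OF ind _ _ _ meas]) (auto simp: abs_mult)
  also have "\<dots> = expectation (\<lambda>\<omega>'. h (Y a \<omega>') * (\<Prod>w\<in>C. prob {\<omega> \<in> space M. Y a \<omega>' \<le> Y w \<omega>}))"
    unfolding inner ..
  also have "\<dots> = (\<integral>r. (h r * (\<Prod>w\<in>C. prob {\<omega> \<in> space M. r \<le> Y w \<omega>})) * indicator {0..1} r \<partial>lborel)"
    using assms(4) Y by (intro expectation_uniform borel_measurable_times h borel_measurable_prod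
        borel_measurable_prob_ge) auto
  finally show ?thesis .
qed

end

section \<open>The law of the occupation time of a branch\<close>

lemma (in prob_space) expectation_of_bool:
  "expectation (\<lambda>\<omega>. of_bool (P \<omega>)) = prob {\<omega> \<in> space M. P \<omega>}"
proof -
  have "expectation (\<lambda>\<omega>. of_bool (P \<omega>)) = expectation (indicator {\<omega> \<in> space M. P \<omega>})"
    by (intro Bochner_Integration.integral_cong) (auto simp: indicator_def)
  also have "\<dots> = prob {\<omega> \<in> space M. P \<omega>}" by (simp add: Int_def conj_commute cong: conj_cong)
  finally show ?thesis .
qed

text \<open>
  Common setting for \<open>T\<^sub>k\<close> and \<open>T\<^sub>k\<^sup>*\<close>. The set \<open>S\<close> collects directed edges \<open>(u, v)\<close> whose branch is
  a copy of \<open>T\<^sub>k\<^sup>*\<close> rooted at \<open>v\<close>. In \<open>T\<^sub>k\<close> these are all edges, in \<open>T\<^sub>k\<^sup>*\<close> those that point away from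
  the root. The laws below are computed from the number of children along such edges, which
  avoids isomorphisms between branches.
\<close>

locale rsa_tree = prob_space M for M :: "'w measure" +
  fixes k :: nat and V :: "'a set" and E :: "'a rel" and \<tau> :: "'a \<Rightarrow> 'w \<Rightarrow> real" and S :: "'a rel"
  assumes k: "k \<ge> 1"
    and graph: "simple_graph V E" "\<nexists>xs. graph_cycle E xs" "countable V"
    and locally_finite: "v \<in> V \<Longrightarrow> finite (E `` {v})"
    and indep: "indep_vars (\<lambda>_. borel) \<tau> V"
    and uniform: "v \<in> V \<Longrightarrow> distr M borel (\<tau> v) = uniform_measure lborel {0<..<1}"
    and S_edges: "S \<subseteq> E"
    and S_card: "(u, v) \<in> S \<Longrightarrow> card (E `` {v} - {u}) = k"
    and S_closed: "(u, v) \<in> S \<Longrightarrow> w \<in> E `` {v} - {u} \<Longrightarrow> (v, w) \<in> S"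
begin

abbreviation arrivals :: "'w \<Rightarrow> 'a \<Rightarrow> real" where
  "arrivals \<omega> \<equiv> \<lambda>u. \<tau> u \<omega>"

text \<open>
  All branches below \<open>v\<close> are copies of \<open>T\<^sub>k\<^sup>*\<close>; at \<open>v\<close> itself, which may be a root (\<open>u = v\<close>), the number of
  children is left open.
\<close>

definition oriented :: "'a \<Rightarrow> 'a \<Rightarrow> bool" where
  "oriented u v \<longleftrightarrow> v \<in> V \<and> (u = v \<or> (v, u) \<in> E) \<and> (\<forall>w\<in>E `` {v} - {u}. (v, w) \<in> S)"

lemma edges: "E \<subseteq> V \<times> V" and symE: "(a, b) \<in> E \<Longrightarrow> (b, a) \<in> E" and irreflE: "(a, a) \<notin> E"
  using graph(1) by (auto simp: simple_graph_def sym_def irrefl_def)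

lemma S_oriented: "(u, v) \<in> S \<Longrightarrow> oriented u v"
  unfolding oriented_def using S_edges edges symE S_closed by blast

lemma measurable_arrival: "v \<in> V \<Longrightarrow> \<tau> v \<in> borel_measurable M"
  using indep by (auto simp: indep_vars_def)

lemma branch_in_V: "v \<in> V \<Longrightarrow> branch E u v \<subseteq> V"
  by (rule branch_subset_vertices[OF edges])

lemma local_occ_time:
  "v \<in> V \<Longrightarrow> u = v \<or> (v, u) \<in> E \<Longrightarrow> local_on (branch E u v) (occ_time E n u v)"
proof (induction n arbitrary: u v)
  case 0
  have "occ_time E 0 u v = (\<lambda>_. 2)" by (rule ext) simp
  then show ?case by (simp add: local_on_def)
next
  case (Suc n)
  have "local_on (branch E u v) (\<lambda>x. if \<forall>w\<in>E `` {v} - {u}. x v \<le> occ_time E n v w x then x v else 2)"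
  proof (rule local_on_first_arrival)
    show "finite (E `` {v} - {u})" using locally_finite[OF Suc.prems(1)] by simp
    show "local_on (branch E u v) (\<lambda>x. x v)" by (rule local_on_component[OF branch_self])
    fix w assume w: "w \<in> E `` {v} - {u}"
    then have "local_on (branch E v w) (occ_time E n v w)"
      using edges symE by (intro Suc.IH) auto
    moreover have "branch E v w \<subseteq> branch E u v"
      using w Suc.prems by (intro branch_child_subset[OF graph(1,2)]) auto
    ultimately show "local_on (branch E u v) (occ_time E n v w)"
      by (rule local_on_mono)
  qed
  moreover have "occ_time E (Suc n) u v = (\<lambda>x. if \<forall>w\<in>E `` {v} - {u}. x v \<le> occ_time E n v w x then x v else 2)"
    by (rule ext) simp
  ultimately show ?case by simp
qed

lemma local_branch_time:
  assumes "v \<in> V" "u = v \<or> (v, u) \<in> E"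
  shows "local_on (branch E u v) (branch_time E u v)"
proof -
  note loc = local_occ_time[OF assms]
  have "(\<lambda>x. lim (\<lambda>n. occ_time E n u v x)) \<in> borel_measurable (PiM (branch E u v) (\<lambda>_. borel))"
    using loc by (intro borel_measurable_lim_metric) (simp add: local_on_def)
  then show ?thesis
    using loc by (simp add: local_on_def branch_time_def[abs_def])
qed

lemma measurable_occ_time:
  "v \<in> V \<Longrightarrow> u = v \<or> (v, u) \<in> E \<Longrightarrow> (\<lambda>\<omega>. occ_time E n u v (arrivals \<omega>)) \<in> borel_measurable M"
  by (rule random_variable_local[OF indep branch_in_V local_occ_time])

lemma measurable_branch_time:
  "v \<in> V \<Longrightarrow> u = v \<or> (v, u) \<in> E \<Longrightarrow> (\<lambda>\<omega>. branch_time E u v (arrivals \<omega>)) \<in> borel_measurable M"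
  by (rule random_variable_local[OF indep branch_in_V local_branch_time])

text \<open>
  The branches at the neighbours of \<open>v\<close> are disjoint from each other and from \<open>v\<close>, so this is the
  situation of \<open>expectation_first_arrival\<close>.
\<close>

lemma expectation_vertex_first:
  fixes F :: "'a \<Rightarrow> ('a \<Rightarrow> real) \<Rightarrow> real"
  assumes v: "v \<in> V" and C: "C \<subseteq> E `` {v}" and F: "\<And>w. w \<in> C \<Longrightarrow> local_on (branch E v w) (F w)"
    and h: "h \<in> borel_measurable borel" "\<And>r. \<bar>h r\<bar> \<le> 1"
  shows "expectation (\<lambda>\<omega>. h (\<tau> v \<omega>) * of_bool (\<forall>w\<in>C. \<tau> v \<omega> \<le> F w (arrivals \<omega>))) =
    (\<integral>r. (h r * (\<Prod>w\<in>C. prob {\<omega> \<in> space M. r \<le> F w (arrivals \<omega>)})) * indicator {0..1} r \<partial>lborel)"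
proof -
  \<comment> \<open>The index \<open>v\<close> stands for the site itself, an index \<open>w\<close> in \<open>C\<close> for the branch of \<open>w\<close>.\<close>
  let ?K = "\<lambda>i. if i = v then {v} else branch E v i"
  let ?F = "\<lambda>i. if i = v then (\<lambda>x. x v) else F i"
  have vC: "v \<notin> C" using C irreflE by auto
  have "indep_vars (\<lambda>_. borel) (\<lambda>i \<omega>. ?F i (arrivals \<omega>)) (insert v C)"
  proof (rule indep_vars_local[OF indep])
    show "disjoint_family_on ?K (insert v C)"
      unfolding disjoint_family_on_def
    proof (intro ballI impI)
      fix i j assume ij: "i \<in> insert v C" "j \<in> insert v C" "i \<noteq> j"
      have "v \<notin> branch E v w" if "w \<in> C" for w
        using that vC by (intro branch_avoids) auto
      moreover have "branch E v i \<inter> branch E v j = {}" if "i \<in> C" "j \<in> C"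
        using ij that C by (intro branch_disjoint[OF graph(1,2)]) auto
      ultimately show "?K i \<inter> ?K j = {}" using ij by auto
    qed
    show "?K j \<subseteq> V" if "j \<in> insert v C" for j
      using that v C edges branch_in_V[of j v] by auto
    show "local_on (?K j) (?F j)" if "j \<in> insert v C" for j
      using that F[of j] local_on_component[of v "{v}"] by auto
  qed
  from expectation_first_arrival[OF this vC _ _ h]
  have "expectation (\<lambda>\<omega>. h (?F v (arrivals \<omega>)) * of_bool (\<forall>w\<in>C. ?F v (arrivals \<omega>) \<le> ?F w (arrivals \<omega>))) =
    (\<integral>r. (h r * (\<Prod>w\<in>C. prob {\<omega> \<in> space M. r \<le> ?F w (arrivals \<omega>)})) * indicator {0..1} r \<partial>lborel)"
    using finite_subset[OF C locally_finite[OF v]] uniform[OF v] by simp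
  moreover have "(\<forall>w\<in>C. \<tau> v \<omega> \<le> ?F w (arrivals \<omega>)) \<longleftrightarrow> (\<forall>w\<in>C. \<tau> v \<omega> \<le> F w (arrivals \<omega>))" for \<omega>
    using vC by (intro ball_cong) auto
  moreover have "(\<Prod>w\<in>C. prob {\<omega> \<in> space M. r \<le> ?F w (arrivals \<omega>)}) =
      (\<Prod>w\<in>C. prob {\<omega> \<in> space M. r \<le> F w (arrivals \<omega>)})" for r
    using vC by (intro prod.cong) auto
  ultimately show ?thesis by simp
qed

lemma prob_occ_time_Suc:
  assumes v: "v \<in> V" "u = v \<or> (v, u) \<in> E" and s: "0 \<le> s" "s \<le> 1"
  shows "prob {\<omega> \<in> space M. occ_time E (Suc n) u v (arrivals \<omega>) < s} =
    (\<integral>r. (\<Prod>w\<in>E `` {v} - {u}. prob {\<omega> \<in> space M. r \<le> occ_time E n v w (arrivals \<omega>)}) * indicator {0..s} r \<partial>lborel)"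
proof -
  let ?C = "E `` {v} - {u}"
  let ?P = "\<lambda>r. \<Prod>w\<in>?C. prob {\<omega> \<in> space M. r \<le> occ_time E n v w (arrivals \<omega>)}"
  have loc: "local_on (branch E v w) (occ_time E n v w)" if "w \<in> ?C" for w
    using that edges symE by (intro local_occ_time) auto
  have meas: "?P \<in> borel_measurable borel"
    using edges symE
    by (intro borel_measurable_prod borel_measurable_prob_ge measurable_occ_time) auto
  have "prob {\<omega> \<in> space M. occ_time E (Suc n) u v (arrivals \<omega>) < s} =
     expectation (\<lambda>\<omega>. of_bool (occ_time E (Suc n) u v (arrivals \<omega>) < s))"
    by (simp only: expectation_of_bool)
  also have "\<dots> = expectation (\<lambda>\<omega>. of_bool (\<tau> v \<omega> < s) *
      of_bool (\<forall>w\<in>?C. \<tau> v \<omega> \<le> occ_time E n v w (arrivals \<omega>)))"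
    using s by (intro Bochner_Integration.integral_cong) auto
  also have "\<dots> = (\<integral>r. (of_bool (r < s) * ?P r) * indicator {0..1} r \<partial>lborel)"
    using v by (intro expectation_vertex_first loc) auto
  also have "\<dots> = (\<integral>r. ?P r * indicator {0..s} r \<partial>lborel)"
  proof (rule integral_cong_AE)
    show "AE r in lborel. (of_bool (r < s) * ?P r) * indicator {0..1} r = ?P r * indicator {0..s} r"
      using AE_lborel_singleton[of s] by eventually_elim (use s in \<open>auto simp: indicator_def\<close>)
  qed (use meas in auto)
  finally show ?thesis .
qed

lemma prob_less_ge:
  assumes "X \<in> borel_measurable M"
  shows "prob {\<omega> \<in> space M. X \<omega> < (s :: real)} = 1 - prob {\<omega> \<in> space M. s \<le> X \<omega>}"
proof -
  have "{\<omega> \<in> space M. X \<omega> < s} = space M - {\<omega> \<in> space M. s \<le> X \<omega>}" by auto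
  moreover have "{\<omega> \<in> space M. s \<le> X \<omega>} \<in> events" using assms by measurable
  ultimately show ?thesis by (simp add: prob_compl)
qed

text \<open>
  One step of Picard iteration for \<open>b = 1 - (\<integral> b ^ k)\<close>: a product of numbers in \<open>[0, 1]\<close> is a Lipschitz
  function of its factors, and integrating \<open>r ^ n\<close> produces the next factorial.
\<close>

lemma occ_time_step_bound:
  fixes s :: real
  assumes v: "v \<in> V" "u = v \<or> (v, u) \<in> E" and s: "0 \<le> s" "s \<le> 1"
    and IH: "\<And>w (r :: real). w \<in> E `` {v} - {u} \<Longrightarrow> 0 \<le> r \<Longrightarrow> r \<le> 1 \<Longrightarrow>
      \<bar>prob {\<omega> \<in> space M. r \<le> occ_time E n v w (arrivals \<omega>)} - vacancy k r\<bar> \<le> (k * r) ^ n / fact n"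
  shows "\<bar>prob {\<omega> \<in> space M. occ_time E (Suc n) u v (arrivals \<omega>) < s} -
      (\<integral>r. vacancy k r ^ card (E `` {v} - {u}) * indicator {0..s} r \<partial>lborel)\<bar>
    \<le> card (E `` {v} - {u}) * k ^ n * s ^ Suc n / fact (Suc n)"
proof -
  let ?C = "E `` {v} - {u}"
  let ?c = "card ?C"
  let ?P = "\<lambda>r. \<Prod>w\<in>?C. prob {\<omega> \<in> space M. r \<le> occ_time E n v w (arrivals \<omega>)}"
  have meas: "?P \<in> borel_measurable borel"
    using edges symE
    by (intro borel_measurable_prod borel_measurable_prob_ge measurable_occ_time) auto
  have P: "0 \<le> ?P r" "?P r \<le> 1" for r
    by (auto intro!: prod_nonneg prod_le_1)
  have intP: "integrable lborel (\<lambda>r. ?P r * indicator {0..s} r)"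
  proof (rule Bochner_Integration.integrable_bound[of _ "indicator {0..s} :: real \<Rightarrow> real"])
    show "(\<lambda>r. ?P r * indicator {0..s} r) \<in> borel_measurable lborel" using meas by simp
    show "AE r in lborel. norm (?P r * indicator {0..s} r) \<le> norm (indicator {0..s} r :: real)"
      using P by (intro AE_I2) (auto simp: indicator_def)
  qed (use s in \<open>simp add: integrable_indicator_iff\<close>)
  have intb: "integrable lborel (\<lambda>r. vacancy k r ^ ?c * indicator {0..s} r)"
    using k by (intro borel_integrable_atLeastAtMost isCont_power isCont_vacancy) auto
  have intq: "integrable lborel (\<lambda>r. (?c * k ^ n / fact n) * (r ^ n * indicator {0..s} r))"
    by (intro integrable_mult_right borel_integrable_atLeastAtMost continuous_intros)
  have "\<bar>prob {\<omega> \<in> space M. occ_time E (Suc n) u v (arrivals \<omega>) < s} -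
      (\<integral>r. vacancy k r ^ ?c * indicator {0..s} r \<partial>lborel)\<bar>
     = \<bar>\<integral>r. ?P r * indicator {0..s} r - vacancy k r ^ ?c * indicator {0..s} r \<partial>lborel\<bar>"
    unfolding prob_occ_time_Suc[OF v s] using intP intb by simp
  also have "\<dots> \<le> (\<integral>r. \<bar>?P r * indicator {0..s} r - vacancy k r ^ ?c * indicator {0..s} r\<bar> \<partial>lborel)"
    by (rule integral_abs_bound)
  also have "\<dots> \<le> (\<integral>r. (?c * k ^ n / fact n) * (r ^ n * indicator {0..s} r) \<partial>lborel)"
  proof (rule integral_mono[OF _ intq])
    show "integrable lborel (\<lambda>r. \<bar>?P r * indicator {0..s} r - vacancy k r ^ ?c * indicator {0..s} r\<bar>)"
      using intP intb by (intro integrable_abs Bochner_Integration.integrable_diff)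
    fix r
    show "\<bar>?P r * indicator {0..s} r - vacancy k r ^ ?c * indicator {0..s} r\<bar>
      \<le> (?c * k ^ n / fact n) * (r ^ n * indicator {0..s} r)"
    proof (cases "r \<in> {0..s}")
      case True
      then have r: "0 \<le> r" "r \<le> 1" using s by auto
      have "\<bar>?P r - vacancy k r ^ ?c\<bar> = norm (?P r - (\<Prod>w\<in>?C. vacancy k r))"
        by simp
      also have "\<dots> \<le> (\<Sum>w\<in>?C. norm (prob {\<omega> \<in> space M. r \<le> occ_time E n v w (arrivals \<omega>)} - vacancy k r))"
        using vacancy_le_1[OF k r(1)] by (intro norm_prod_diff) (auto simp: less_imp_le)
      also have "\<dots> \<le> (\<Sum>w\<in>?C. (k * r) ^ n / fact n)"
        using IH r by (intro sum_mono) auto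
      finally show ?thesis using True by (simp add: power_mult_distrib)
    qed auto
  qed
  also have "\<dots> = (?c * k ^ n / fact n) * (s ^ Suc n / Suc n)"
    using s(1) by (simp add: integral_power del: of_nat_Suc power_Suc)
  also have "\<dots> = ?c * k ^ n * s ^ Suc n / fact (Suc n)"
    by (simp add: field_simps del: of_nat_Suc)
  finally show ?thesis .
qed

lemma occ_time_vacancy_bound:
  fixes s :: real
  shows "(u, v) \<in> S \<Longrightarrow> 0 \<le> s \<Longrightarrow> s \<le> 1 \<Longrightarrow>
    \<bar>prob {\<omega> \<in> space M. s \<le> occ_time E n u v (arrivals \<omega>)} - vacancy k s\<bar> \<le> (k * s) ^ n / fact n"
proof (induction n arbitrary: u v s)
  case 0
  have "{\<omega> \<in> space M. s \<le> occ_time E 0 u v (arrivals \<omega>)} = space M" using 0 by auto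
  then show ?case
    using vacancy_le_1[OF k 0(2)] less_imp_le[OF vacancy_pos[of k s]] by (simp add: prob_space)
next
  case (Suc n)
  have v: "v \<in> V" "u = v \<or> (v, u) \<in> E"
    using S_oriented[OF Suc.prems(1)] by (auto simp: oriented_def)
  have "\<bar>prob {\<omega> \<in> space M. occ_time E (Suc n) u v (arrivals \<omega>) < s} -
      (\<integral>r. vacancy k r ^ card (E `` {v} - {u}) * indicator {0..s} r \<partial>lborel)\<bar>
    \<le> card (E `` {v} - {u}) * k ^ n * s ^ Suc n / fact (Suc n)"
    using Suc S_closed v by (intro occ_time_step_bound) auto
  then show ?case
    unfolding S_card[OF Suc.prems(1)] integral_vacancy_power[OF k Suc.prems(2)]
      prob_less_ge[OF measurable_occ_time[OF v]]
    by (simp add: power_mult_distrib algebra_simps abs_minus_commute)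
qed

lemma occ_time_law_limit:
  assumes "oriented u v" "0 \<le> s" "s \<le> 1"
  shows "(\<lambda>n. prob {\<omega> \<in> space M. occ_time E n u v (arrivals \<omega>) < s}) \<longlonglongrightarrow>
      (\<integral>r. vacancy k r ^ card (E `` {v} - {u}) * indicator {0..s} r \<partial>lborel)"
proof (rule LIMSEQ_imp_Suc, rule LIM_zero_cancel, rule Lim_null_comparison)
  let ?c = "card (E `` {v} - {u})"
  have v: "v \<in> V" "u = v \<or> (v, u) \<in> E" "\<And>w. w \<in> E `` {v} - {u} \<Longrightarrow> (v, w) \<in> S"
    using assms by (auto simp: oriented_def)
  show "\<forall>\<^sub>F n in sequentially. norm (prob {\<omega> \<in> space M. occ_time E (Suc n) u v (arrivals \<omega>) < s} -
      (\<integral>r. vacancy k r ^ ?c * indicator {0..s} r \<partial>lborel)) \<le> ?c * k ^ n * s ^ Suc n / fact (Suc n)"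
    unfolding real_norm_def
    using v assms by (intro always_eventually allI occ_time_step_bound occ_time_vacancy_bound) auto
  show "(\<lambda>n. ?c * k ^ n * s ^ Suc n / fact (Suc n)) \<longlonglongrightarrow> 0"
  proof -
    have "(\<lambda>n. (k * s) ^ n / fact n) \<longlonglongrightarrow> 0"
      using summable_LIMSEQ_zero[OF summable_exp[of "k * s"]] by (simp add: divide_inverse mult.commute)
    then have "(\<lambda>n. (?c / k) * ((k * s) ^ Suc n / fact (Suc n))) \<longlonglongrightarrow> (?c / k) * 0"
      by (intro tendsto_mult tendsto_const LIMSEQ_Suc)
    moreover have "(?c / k) * ((k * s) ^ Suc n / fact (Suc n)) = ?c * k ^ n * s ^ Suc n / fact (Suc n)" for n
      using k by (simp add: power_mult_distrib)
    ultimately show ?thesis by simp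
  qed
qed

lemma AE_arrival_range: "AE \<omega> in M. \<forall>v\<in>V. 0 < \<tau> v \<omega> \<and> \<tau> v \<omega> < 1"
proof (rule AE_ball_countable[OF graph(3), THEN iffD2], rule ballI)
  fix v assume v: "v \<in> V"
  have "AE r in uniform_measure lborel {0<..<1}. 0 < r \<and> r < (1 :: real)"
    by (subst AE_uniform_measure) auto
  then have "AE r in distr M borel (\<tau> v). 0 < r \<and> r < 1"
    unfolding uniform[OF v] .
  then show "AE \<omega> in M. 0 < \<tau> v \<omega> \<and> \<tau> v \<omega> < 1"
    using measurable_arrival[OF v] by (subst (asm) AE_distr_iff) auto
qed

lemma AE_arrival_neq:
  assumes v: "v \<in> V"
  shows "AE \<omega> in M. \<tau> v \<omega> \<noteq> t"
proof -
  have "AE r in uniform_measure lborel {0<..<1}. r \<noteq> (t :: real)"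
    using AE_lborel_singleton[of t] by (subst AE_uniform_measure) auto
  then have "AE r in distr M borel (\<tau> v). r \<noteq> t"
    unfolding uniform[OF v] .
  then show ?thesis
    using measurable_arrival[OF v] by (subst (asm) AE_distr_iff) auto
qed

text \<open>
  By nestedness the even and odd approximations differ with probability equal to the
  difference of their probabilities of occupation, which have a common limit.
\<close>

lemma AE_stabilises:
  assumes "oriented u v"
  shows "AE \<omega> in M. stabilises E u v (arrivals \<omega>)"
proof -
  have v: "v \<in> V" "u = v \<or> (v, u) \<in> E"
    using assms by (auto simp: oriented_def)
  note [measurable] = measurable_occ_time[OF v]
  define D where "D j = {\<omega> \<in> space M. occ_time E (2 * j) u v (arrivals \<omega>) \<noteq> occ_time E (2 * j + 1) u v (arrivals \<omega>)}" for j
  define p where "p n = prob {\<omega> \<in> space M. occ_time E n u v (arrivals \<omega>) < 1}" for n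
  have D[measurable]: "D j \<in> events" for j
    unfolding D_def by measurable
  have pD: "prob (D j) = p (2 * j + 1) - p (2 * j)" for j
  proof -
    have "prob (D j) = expectation (\<lambda>\<omega>. of_bool (\<omega> \<in> D j))"
      unfolding expectation_of_bool using D[of j] sets.sets_into_space[OF D[of j]]
      by (intro arg_cong[of _ _ prob]) auto
    also have "\<dots> = expectation (\<lambda>\<omega>. of_bool (occ_time E (2 * j + 1) u v (arrivals \<omega>) < 1)
         - of_bool (occ_time E (2 * j) u v (arrivals \<omega>) < 1))"
    proof (rule integral_cong_AE)
      show "AE \<omega> in M. (of_bool (\<omega> \<in> D j) :: real) = of_bool (occ_time E (2 * j + 1) u v (arrivals \<omega>) < 1)
         - of_bool (occ_time E (2 * j) u v (arrivals \<omega>) < 1)"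
        using AE_arrival_range AE_space
      proof eventually_elim
        fix \<omega> assume \<omega>: "\<forall>v\<in>V. 0 < \<tau> v \<omega> \<and> \<tau> v \<omega> < 1" "\<omega> \<in> space M"
        then have le2: "\<And>z. z \<in> V \<Longrightarrow> \<tau> z \<omega> \<le> 2" by force
        have "occ_time E (2 * j + 1) u v (arrivals \<omega>) \<le> occ_time E (2 * j) u v (arrivals \<omega>)"
          using occ_time_nested[of E V "arrivals \<omega>" v "2 * j" "2 * j + 1" u] edges le2 v(1)
          by (auto simp del: occ_time.simps)
        then show "(of_bool (\<omega> \<in> D j) :: real) = of_bool (occ_time E (2 * j + 1) u v (arrivals \<omega>) < 1)
          - of_bool (occ_time E (2 * j) u v (arrivals \<omega>) < 1)"
          using occ_time_cases[of E "2 * j" u v "arrivals \<omega>"] occ_time_cases[of E "2 * j + 1" u v "arrivals \<omega>"]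
            \<omega> v(1) unfolding D_def by (auto simp del: occ_time.simps)
      qed
    qed measurable
    also have "\<dots> = p (2 * j + 1) - p (2 * j)"
      unfolding p_def expectation_of_bool[symmetric]
      by (intro Bochner_Integration.integral_diff integrable_const_bound[of _ 1]) (auto simp del: occ_time.simps)
    finally show ?thesis .
  qed
  have lim: "p \<longlonglongrightarrow> (\<integral>r. vacancy k r ^ card (E `` {v} - {u}) * indicator {0..1} r \<partial>lborel)" (is "_ \<longlonglongrightarrow> ?l")
    unfolding p_def by (rule occ_time_law_limit[OF assms]) auto
  have "(\<lambda>j. p (2 * j + 1) - p (2 * j)) \<longlonglongrightarrow> ?l - ?l"
    by (intro tendsto_diff LIMSEQ_subseq_LIMSEQ[OF lim, unfolded comp_def])
      (auto simp: strict_mono_def)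
  then have "(\<lambda>j. prob (D j)) \<longlonglongrightarrow> 0" by (simp add: pD)
  moreover have "prob (\<Inter>j. D j) \<le> prob (D i)" for i
    by (intro finite_measure_mono) auto
  ultimately have "prob (\<Inter>j. D j) \<le> 0"
    by (intro LIMSEQ_le_const) auto
  then have "(\<Inter>j. D j) \<in> null_sets M"
    by (intro null_setsI) (auto simp: emeasure_eq_measure measure_le_0_iff)
  then have "AE \<omega> in M. \<omega> \<notin> (\<Inter>j. D j)" by (rule AE_not_in)
  with AE_arrival_range AE_space show ?thesis
  proof eventually_elim
    fix \<omega> assume \<omega>: "\<forall>v\<in>V. 0 < \<tau> v \<omega> \<and> \<tau> v \<omega> < 1" "\<omega> \<in> space M" "\<omega> \<notin> (\<Inter>j. D j)"
    then have le2: "\<And>z. z \<in> V \<Longrightarrow> \<tau> z \<omega> \<le> 2" by force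
    from \<omega> obtain j where "occ_time E (2 * j) u v (arrivals \<omega>) = occ_time E (2 * j + 1) u v (arrivals \<omega>)"
      unfolding D_def by blast
    then show "stabilises E u v (arrivals \<omega>)"
      using edges le2 v(1) by (intro stabilises_if_consecutive[of E V "arrivals \<omega>" v j u]) auto
  qed
qed

text \<open>
  The approximations are almost surely eventually constant, so their laws converge to that of the limit.
\<close>

lemma prob_branch_time:
  assumes "oriented u v" "0 \<le> s" "s \<le> 1"
  shows "prob {\<omega> \<in> space M. branch_time E u v (arrivals \<omega>) < s} =
      (\<integral>r. vacancy k r ^ card (E `` {v} - {u}) * indicator {0..s} r \<partial>lborel)"
proof -
  have v: "v \<in> V" "u = v \<or> (v, u) \<in> E"
    using assms by (auto simp: oriented_def)
  note [measurable] = measurable_occ_time[OF v] measurable_branch_time[OF v]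
  have "(\<lambda>n. expectation (\<lambda>\<omega>. of_bool (occ_time E n u v (arrivals \<omega>) < s)))
      \<longlonglongrightarrow> expectation (\<lambda>\<omega>. of_bool (branch_time E u v (arrivals \<omega>) < s) :: real)"
  proof (rule integral_dominated_convergence[where w = "\<lambda>_. 1"])
    show "AE \<omega> in M. (\<lambda>n. of_bool (occ_time E n u v (arrivals \<omega>) < s)) \<longlonglongrightarrow>
       (of_bool (branch_time E u v (arrivals \<omega>) < s) :: real)"
      using AE_stabilises[OF assms(1)]
    proof eventually_elim
      case (elim \<omega>)
      then show ?case
        unfolding stabilises_def by (intro tendsto_eventually) (auto elim: eventually_mono)
    qed
  qed auto
  then show ?thesis
    unfolding expectation_of_bool by (rule LIMSEQ_unique[OF _ occ_time_law_limit[OF assms]])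
qed

lemma prob_branch_time_S:
  assumes "(u, v) \<in> S" "0 \<le> s" "s \<le> 1"
  shows "prob {\<omega> \<in> space M. s \<le> branch_time E u v (arrivals \<omega>)} = vacancy k s"
proof -
  have v: "v \<in> V" "u = v \<or> (v, u) \<in> E"
    using S_oriented[OF assms(1)] by (auto simp: oriented_def)
  show ?thesis
    using prob_branch_time[OF S_oriented[OF assms(1)] assms(2,3)]
    unfolding S_card[OF assms(1)] integral_vacancy_power[OF k assms(2)]
      prob_less_ge[OF measurable_branch_time[OF v]]
    by simp
qed

lemma AE_branch_time_rec:
  assumes "oriented u v"
  shows "AE \<omega> in M. branch_time E u v (arrivals \<omega>) =
    (if \<forall>w\<in>E `` {v} - {u}. \<tau> v \<omega> \<le> branch_time E v w (arrivals \<omega>) then \<tau> v \<omega> else 2)"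
proof -
  have v: "v \<in> V" and S: "\<And>w. w \<in> E `` {v} - {u} \<Longrightarrow> (v, w) \<in> S"
    using assms by (auto simp: oriented_def)
  have "AE \<omega> in M. \<forall>w\<in>E `` {v} - {u}. stabilises E v w (arrivals \<omega>)"
    using locally_finite[OF v] S
    by (intro AE_finite_allI) (auto intro: AE_stabilises S_oriented)
  with AE_stabilises[OF assms] show ?thesis
    by eventually_elim (intro branch_time_rec locally_finite v, auto)
qed

lemma AE_rsa:
  assumes "oriented v v" "t \<le> 1"
  shows "AE \<omega> in M. rsa V E (arrivals \<omega>) t v = of_bool (branch_time E v v (arrivals \<omega>) < t)"
proof -
  have v: "v \<in> V" using assms by (auto simp: oriented_def)
  show ?thesis
    using AE_stabilises[OF assms(1)] AE_branch_time_rec[OF assms(1)] AE_arrival_neq[OF v, of t]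
  proof eventually_elim
    fix \<omega>
    assume st: "stabilises E v v (arrivals \<omega>)" and rec: "branch_time E v v (arrivals \<omega>) =
      (if \<forall>w\<in>E `` {v} - {v}. \<tau> v \<omega> \<le> branch_time E v w (arrivals \<omega>) then \<tau> v \<omega> else 2)"
      and neq: "\<tau> v \<omega> \<noteq> t"
    have "rsa V E (arrivals \<omega>) t v = of_bool (branch_time E v v (arrivals \<omega>) \<le> t)"
      using assms(2) by (intro rsa_branch_time[OF graph(3) edges locally_finite v st]) auto
    moreover have "branch_time E v v (arrivals \<omega>) \<noteq> t"
      using rec neq assms(2) by (auto split: if_splits)
    ultimately show "rsa V E (arrivals \<omega>) t v = of_bool (branch_time E v v (arrivals \<omega>) < t)"
      by auto
  qed
qed

lemma measurable_rsa: "(\<lambda>\<omega>. rsa V E (arrivals \<omega>) t v) \<in> borel_measurable M"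
  by (rule borel_measurable_rsa[OF graph(3) measurable_arrival])

lemma prob_rsa_vacant:
  assumes "oriented v v" "0 \<le> t" "t \<le> 1"
  shows "prob {\<omega> \<in> space M. rsa V E (arrivals \<omega>) t v = 0} =
    1 - (\<integral>r. vacancy k r ^ card (E `` {v}) * indicator {0..t} r \<partial>lborel)"
proof -
  have v: "v \<in> V" using assms by (auto simp: oriented_def)
  note [measurable] = measurable_branch_time[OF v, of v] measurable_rsa[of t v]
  have "prob {\<omega> \<in> space M. rsa V E (arrivals \<omega>) t v = 0} =
     prob {\<omega> \<in> space M. t \<le> branch_time E v v (arrivals \<omega>)}"
    using AE_rsa[OF assms(1,3)]
    by (intro prob_eq_AE) (auto simp: not_less elim: eventually_mono)
  moreover have "E `` {v} - {v} = E `` {v}" using irreflE by auto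
  ultimately show ?thesis
    using prob_branch_time[OF assms] prob_less_ge[OF measurable_branch_time[OF v, of v], of t] by simp
qed

end

section \<open>Descending chains\<close>

text \<open>
  The inequalities \<open>t > y 0 > y 1 > \<dots> > y (i - 1) > r\<close>. The recursion removes the last member, which is
  the order in which the free times are integrated out.
\<close>

fun descending :: "real \<Rightarrow> (nat \<Rightarrow> real) \<Rightarrow> nat \<Rightarrow> real \<Rightarrow> bool" where
  "descending t y 0 r \<longleftrightarrow> r < t"
| "descending t y (Suc i) r \<longleftrightarrow> r < y i \<and> descending t y i (y i)"

lemma descending_less: "descending t y i r \<Longrightarrow> r < t"
  by (induction i arbitrary: r) force+

lemma descending_last: "descending t y a (y a) \<Longrightarrow> l < a \<Longrightarrow> y (Suc l) < y l"
  by (induction a) (auto simp: less_Suc_eq)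

lemma descending_cong: "(\<And>l. l < i \<Longrightarrow> y l = z l) \<Longrightarrow> descending t y i r = descending t z i r"
  by (induction i arbitrary: r) auto

lemma measurable_descending:
  "(\<And>l. l < i \<Longrightarrow> Y l \<in> borel_measurable N) \<Longrightarrow> R \<in> borel_measurable N \<Longrightarrow>
    Measurable.pred N (\<lambda>x. descending t (\<lambda>l. Y l x) i (R x))"
proof (induction i arbitrary: R)
  case 0
  note 0(2)[measurable]
  show ?case by simp
next
  case (Suc i)
  note Suc.prems(2)[measurable] Suc.prems(1)[of i, simplified, measurable]
  have [measurable]: "Measurable.pred N (\<lambda>x. descending t (\<lambda>l. Y l x) i (Y i x))"
    using Suc.prems(1) by (intro Suc.IH) auto
  show ?case by simp
qed

text \<open>
  Among the sites from \<open>l\<close> on, site \<open>l\<close> is occupied before a given time iff it is free before that time and site \<open>l + 1\<close> is not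
  occupied before site \<open>l\<close> is free. Each unfolding of the second condition subtracts
  the event for a chain with one member more.
\<close>

lemma alternating_chain_expansion:
  assumes "t < 2" and R: "\<And>l. l < m \<Longrightarrow> R l = (if y l \<le> R (Suc l) then y l else 2)" "R m = y m"
  shows "(of_bool (R 0 < t) :: real) = (\<Sum>a\<le>m. (-1) ^ a * of_bool (descending t y a (y a)))"
proof -
  have "(of_bool (R 0 < t) :: real) =
     (\<Sum>a<l. (-1) ^ a * of_bool (descending t y a (y a))) + (-1) ^ l * of_bool (descending t y l (R l))"
    if "l \<le> m" for l
    using that
  proof (induction l)
    case (Suc l)
    have "(of_bool (descending t y l (R l)) :: real) =
       of_bool (descending t y l (y l)) - of_bool (descending t y (Suc l) (R (Suc l)))"
      using R(1)[of l] Suc.prems descending_less[of t y l 2] assms(1) by auto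
    with Suc show ?case by (simp add: algebra_simps del: descending.simps)
  qed simp
  from this[of m] show ?thesis
    by (simp add: R(2) lessThan_Suc_atMost[symmetric])
qed

context prob_space
begin

text \<open>
  The variable has density \<open>\<gamma>\<close> on \<open>[0, 1)\<close>. For free times the remaining mass sits at \<open>2\<close>, where
  the test functions vanish.
\<close>

definition has_rate :: "('a \<Rightarrow> real) \<Rightarrow> (real \<Rightarrow> real) \<Rightarrow> bool" where
  "has_rate X \<gamma> \<longleftrightarrow> (\<forall>h\<in>borel_measurable borel. (\<forall>r. \<bar>h r\<bar> \<le> 1) \<longrightarrow> (\<forall>r\<ge>1. h r = 0) \<longrightarrow>
     expectation (\<lambda>\<omega>. h (X \<omega>)) = (\<integral>r. (h r * \<gamma> r) * indicator {0..1} r \<partial>lborel))"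

lemma has_rateD:
  assumes "has_rate X \<gamma>" "h \<in> borel_measurable borel" "\<And>r. \<bar>h r\<bar> \<le> 1" "\<And>r. 1 \<le> r \<Longrightarrow> h r = 0"
  shows "expectation (\<lambda>\<omega>. h (X \<omega>)) = (\<integral>r. (h r * \<gamma> r) * indicator {0..1} r \<partial>lborel)"
  using assms unfolding has_rate_def by blast

lemma has_rate_AE_pos:
  assumes "has_rate X \<gamma>" "X \<in> borel_measurable M"
  shows "AE \<omega> in M. 0 < X \<omega>"
proof -
  note assms(2)[measurable]
  have "prob {\<omega> \<in> space M. X \<omega> \<le> 0} = expectation (\<lambda>\<omega>. of_bool (X \<omega> \<le> 0))"
    by (simp only: expectation_of_bool)
  also have "\<dots> = (\<integral>r. (of_bool (r \<le> 0) * \<gamma> r) * indicator {0..1} r \<partial>lborel)"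
    by (rule has_rateD[OF assms(1)]) auto
  also have "\<dots> = 0"
    using AE_lborel_singleton[of "0 :: real"] 
    by (intro integral_eq_zero_AE) (auto simp: indicator_def elim: eventually_mono)
  finally have "prob {\<omega> \<in> space M. X \<omega> \<le> 0} = 0" .
  then have "AE \<omega> in M. \<not> X \<omega> \<le> 0"
    by (subst (asm) prob_eq_0) auto
  then show ?thesis by eventually_elim auto
qed

text \<open>
  Conditioning on the variable \<open>Y a\<close> given by its rate. The test function vanishes after
  time \<open>t\<close>, as all events about chains below \<open>t\<close> do.
\<close>

lemma expectation_at_vertex:
  fixes Y :: "'i \<Rightarrow> 'a \<Rightarrow> real" and f :: "real \<Rightarrow> ('i \<Rightarrow> real) \<Rightarrow> real"
  assumes ind: "indep_vars (\<lambda>_. borel) Y I" and a: "a \<in> I" and C: "C \<subseteq> I" "a \<notin> C"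
    and f: "case_prod f \<in> borel_measurable (borel \<Otimes>\<^sub>M PiM C (\<lambda>_. borel))"
      "\<And>r z. f r (restrict z C) = f r z" "\<And>r z. \<bar>f r z\<bar> \<le> 1" "\<And>r z. 1 \<le> r \<Longrightarrow> f r z = 0"
    and rate: "has_rate (Y a) \<gamma>"
    and F: "\<And>r. 0 \<le> r \<Longrightarrow> r < t \<Longrightarrow> expectation (\<lambda>\<omega>. f r (\<lambda>i. Y i \<omega>)) * \<gamma> r = F r"
      "\<And>r z. t \<le> r \<Longrightarrow> f r z = 0"
    and t: "t \<le> 1" and meas: "F \<in> borel_measurable borel"
  shows "expectation (\<lambda>\<omega>. f (Y a \<omega>) (\<lambda>i. Y i \<omega>)) = (\<integral>r. F r * indicator {0..t} r \<partial>lborel)"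
proof -
  define H where "H r = expectation (\<lambda>\<omega>. f r (\<lambda>i. Y i \<omega>))" for r
  have H: "H \<in> borel_measurable borel"
    "expectation (\<lambda>\<omega>. f (Y a \<omega>) (\<lambda>i. Y i \<omega>)) = expectation (\<lambda>\<omega>. H (Y a \<omega>))"
    unfolding H_def[abs_def] by (rule expectation_decouple[OF ind a C f(1-3)])+
  have H_le: "\<bar>H r\<bar> \<le> 1" for r
  proof -
    have "\<bar>H r\<bar> \<le> expectation (\<lambda>\<omega>. \<bar>f r (\<lambda>i. Y i \<omega>)\<bar>)"
      unfolding H_def by (rule integral_abs_bound)
    also have "\<dots> \<le> expectation (\<lambda>_. 1)"
      using f(3) by (intro integral_mono') auto
    finally show ?thesis by (simp add: prob_space)
  qed
  have H_0: "H r = 0" if "t \<le> r" for r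
    using F(2)[OF that] by (simp add: H_def)
  have "expectation (\<lambda>\<omega>. H (Y a \<omega>)) = (\<integral>r. (H r * \<gamma> r) * indicator {0..1} r \<partial>lborel)"
    using H_0 t by (intro has_rateD[OF rate] H H_le) auto
  also have "\<dots> = (\<integral>r. F r * indicator {0..<t} r \<partial>lborel)"
    using F(1) H_0 t by (intro Bochner_Integration.integral_cong) (auto simp: indicator_def not_less simp flip: H_def)
  also have "\<dots> = (\<integral>r. F r * indicator {0..t} r \<partial>lborel)"
  proof (rule integral_cong_AE)
    show "AE r in lborel. F r * indicator {0..<t} r = F r * indicator {0..t} r"
      using AE_lborel_singleton[of t] by eventually_elim (auto simp: indicator_def)
  qed (use meas in auto)
  finally show ?thesis using H(2) by simp
qed

lemma local_descending:
  assumes "\<iota> ` {..<i} \<subseteq> C"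
  shows "(\<lambda>(r, z). of_bool (descending t (\<lambda>l. z (\<iota> l)) i r) :: real) \<in> borel_measurable (borel \<Otimes>\<^sub>M PiM C (\<lambda>_. borel))"
    and "descending t (\<lambda>l. restrict z C (\<iota> l)) i r = descending t (\<lambda>l. z (\<iota> l)) i r"
    and "local_on C (\<lambda>z. of_bool (descending t (\<lambda>l. z (\<iota> l)) i r))"
proof -
  show restr: "descending t (\<lambda>l. restrict z C (\<iota> l)) i r = descending t (\<lambda>l. z (\<iota> l)) i r" for z r
    using assms by (intro descending_cong) auto
  have "Measurable.pred (borel \<Otimes>\<^sub>M PiM C (\<lambda>_. borel)) (\<lambda>p. descending t (\<lambda>l. snd p (\<iota> l)) i (fst p))"
    using assms by (intro measurable_descending) (auto intro!: measurable_compose[OF measurable_snd])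
  then show "(\<lambda>(r, z). of_bool (descending t (\<lambda>l. z (\<iota> l)) i r) :: real) \<in> borel_measurable (borel \<Otimes>\<^sub>M PiM C (\<lambda>_. borel))"
    by (simp add: case_prod_beta)
  have "Measurable.pred (PiM C (\<lambda>_. borel)) (\<lambda>z. descending t (\<lambda>l. z (\<iota> l)) i r)"
    using assms by (intro measurable_descending) auto
  then show "local_on C (\<lambda>z. of_bool (descending t (\<lambda>l. z (\<iota> l)) i r))"
    by (simp add: local_on_def restr del: restrict_apply)
qed

lemma measurable_rates [measurable]:
  "arrival_rate k \<in> borel_measurable borel" "chain_prob k t i \<in> borel_measurable borel"
proof -
  show "arrival_rate k \<in> borel_measurable borel"
    unfolding arrival_rate_def[abs_def] by measurable
  have [measurable]: "clock k \<in> borel_measurable borel"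
    unfolding clock_def[abs_def] by (cases "k = 1") simp_all
  show "chain_prob k t i \<in> borel_measurable borel"
    unfolding chain_prob_def[abs_def] vacancy_def by measurable
qed

lemma expectation_descending_step:
  fixes Y :: "'i \<Rightarrow> 'a \<Rightarrow> real"
  assumes k: "k \<ge> 1" and t: "t \<le> 1" and r: "0 \<le> r" "r \<le> t"
    and ind: "indep_vars (\<lambda>_. borel) Y I" "\<iota> ` {..<Suc i} \<subseteq> I" "inj_on \<iota> {..<Suc i}"
    and rate: "has_rate (Y (\<iota> i)) \<gamma>"
    and weight: "\<And>q. 0 \<le> q \<Longrightarrow> q < t \<Longrightarrow>
      expectation (\<lambda>\<omega>. of_bool (descending t (\<lambda>l. Y (\<iota> l) \<omega>) i q)) * \<gamma> q = arrival_rate k q * chain_prob k t i q"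
  shows "expectation (\<lambda>\<omega>. of_bool (descending t (\<lambda>l. Y (\<iota> l) \<omega>) (Suc i) r)) = chain_prob k t (Suc i) r"
proof -
  let ?C = "\<iota> ` {..<i}"
  let ?f = "\<lambda>q (z :: 'i \<Rightarrow> real). of_bool (r < q) * of_bool (descending t (\<lambda>l. z (\<iota> l)) i q) :: real"
  let ?F = "\<lambda>q. of_bool (r < q) * (arrival_rate k q * chain_prob k t i q)"
  have C: "?C \<subseteq> I" "\<iota> i \<notin> ?C" "\<iota> i \<in> I"
    using ind(2) inj_onD[OF ind(3), of i] by force+
  have meas: "case_prod ?f \<in> borel_measurable (borel \<Otimes>\<^sub>M PiM ?C (\<lambda>_. borel))"
  proof -
    note local_descending(1)[OF subset_refl, where \<iota> = \<iota> and i = i and t = t, measurable]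
    have "(\<lambda>p. of_bool (r < fst p) * (case p of (q, z) \<Rightarrow> of_bool (descending t (\<lambda>l. z (\<iota> l)) i q)) :: real)
        \<in> borel_measurable (borel \<Otimes>\<^sub>M PiM ?C (\<lambda>_. borel))"
      by measurable
    then show ?thesis by (simp add: case_prod_beta)
  qed
  have "expectation (\<lambda>\<omega>. of_bool (descending t (\<lambda>l. Y (\<iota> l) \<omega>) (Suc i) r)) =
    expectation (\<lambda>\<omega>. ?f (Y (\<iota> i) \<omega>) (\<lambda>i. Y i \<omega>))"
    by (simp add: of_bool_conj)
  also have "\<dots> = (\<integral>q. ?F q * indicator {0..t} q \<partial>lborel)"
  proof (rule expectation_at_vertex[OF ind(1) C(3,1,2) meas _ _ _ rate _ _ t])
    show "?f q (restrict z ?C) = ?f q z" for q z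
      using local_descending(2)[OF subset_refl, where \<iota> = \<iota> and i = i and t = t and z = z and r = q] by simp
    show "?f q z = 0" if "1 \<le> q" for q z
      using that descending_less[of t "\<lambda>l. z (\<iota> l)" i q] t by auto
    show "?f q z = 0" if "t \<le> q" for q z
      using that descending_less[of t "\<lambda>l. z (\<iota> l)" i q] by auto
    show "expectation (\<lambda>\<omega>. ?f q (\<lambda>i. Y i \<omega>)) * \<gamma> q = ?F q" if "0 \<le> q" "q < t" for q
      using weight[OF that] by simp
  qed auto
  also have "\<dots> = (\<integral>q. (arrival_rate k q * chain_prob k t i q) * indicator {r..t} q \<partial>lborel)"
  proof (rule integral_cong_AE)
    show "AE q in lborel. ?F q * indicator {0..t} q = (arrival_rate k q * chain_prob k t i q) * indicator {r..t} q"
      using AE_lborel_singleton[of r] by eventually_elim (use r in \<open>auto simp: indicator_def\<close>)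
  qed auto
  also have "\<dots> = chain_prob k t (Suc i) r"
    by (rule integral_chain_prob[OF k r])
  finally show ?thesis .
qed

text \<open>
  The chain runs along an injection \<open>\<iota>\<close> of sites, so the same statement serves both directions of the
  path.
\<close>

lemma expectation_descending:
  assumes k: "k \<ge> 1" and t: "t \<le> 1" and ind: "indep_vars (\<lambda>_. borel) Y I"
  shows "\<iota> ` {..<Suc i} \<subseteq> I \<Longrightarrow> inj_on \<iota> {..<Suc i} \<Longrightarrow> has_rate (Y (\<iota> 0)) (\<lambda>r. vacancy k r ^ k) \<Longrightarrow>
    (\<And>l. 0 < l \<Longrightarrow> l \<le> i \<Longrightarrow> has_rate (Y (\<iota> l)) (arrival_rate k)) \<Longrightarrow> 0 \<le> r \<Longrightarrow> r \<le> t \<Longrightarrow>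
    expectation (\<lambda>\<omega>. of_bool (descending t (\<lambda>l. Y (\<iota> l) \<omega>) (Suc i) r)) = chain_prob k t (Suc i) r"
proof (induction i arbitrary: r)
  case 0
  show ?case
    using 0 by (intro expectation_descending_step[OF k t _ _ ind, where \<gamma> = "\<lambda>r. vacancy k r ^ k"])
      (auto simp: vacancy_power_Suc[OF k] chain_prob_0 prob_space)
next
  case (Suc i)
  have "expectation (\<lambda>\<omega>. of_bool (descending t (\<lambda>l. Y (\<iota> l) \<omega>) (Suc i) q)) = chain_prob k t (Suc i) q"
    if "0 \<le> q" "q < t" for q
    using Suc.prems that by (intro Suc.IH) (auto simp: inj_on_def)
  then show ?case
    using Suc.prems by (intro expectation_descending_step[OF k t _ _ ind]) auto
qed

text \<open>
  Given the free time \<open>q\<close> of the common site \<open>a\<close>, the two chains are independent. If \<open>a\<close> is an end of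
  the path, one of them is empty, and the value of \<open>chain_prob\<close> for length \<open>0\<close> accounts for the rate of an end.
\<close>

lemma expectation_chains_meet:
  fixes Y :: "'i \<Rightarrow> 'a \<Rightarrow> real"
  assumes k: "k \<ge> 1" and t: "0 \<le> t" "t \<le> 1" and ind: "indep_vars (\<lambda>_. borel) Y I"
    and a: "a \<in> I" "a \<notin> A" "a \<notin> B" and AB: "A \<subseteq> I" "B \<subseteq> I" "A \<inter> B = {}"
    and sub: "\<iota> ` {..<i} \<subseteq> A" "\<kappa> ` {..<j} \<subseteq> B" and ij: "i > 0 \<or> j > 0"
    and rate: "has_rate (Y a) (if i = 0 \<or> j = 0 then \<lambda>r. vacancy k r ^ k else arrival_rate k)"
    and left: "\<And>q. 0 < i \<Longrightarrow> 0 \<le> q \<Longrightarrow> q \<le> t \<Longrightarrow>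
      expectation (\<lambda>\<omega>. of_bool (descending t (\<lambda>l. Y (\<iota> l) \<omega>) i q)) = chain_prob k t i q"
    and right: "\<And>q. 0 < j \<Longrightarrow> 0 \<le> q \<Longrightarrow> q \<le> t \<Longrightarrow>
      expectation (\<lambda>\<omega>. of_bool (descending t (\<lambda>l. Y (\<kappa> l) \<omega>) j q)) = chain_prob k t j q"
  shows "expectation (\<lambda>\<omega>. of_bool (descending t (\<lambda>l. Y (\<iota> l) \<omega>) i (Y a \<omega>)) *
      of_bool (descending t (\<lambda>l. Y (\<kappa> l) \<omega>) j (Y a \<omega>))) =
    (\<integral>q. (arrival_rate k q * (chain_prob k t i q * chain_prob k t j q)) * indicator {0..t} q \<partial>lborel)"
proof -
  let ?f1 = "\<lambda>q (z :: 'i \<Rightarrow> real). of_bool (descending t (\<lambda>l. z (\<iota> l)) i q) :: real"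
  let ?f2 = "\<lambda>q (z :: 'i \<Rightarrow> real). of_bool (descending t (\<lambda>l. z (\<kappa> l)) j q) :: real"
  let ?C = "A \<union> B"
  have subC: "\<iota> ` {..<i} \<subseteq> ?C" "\<kappa> ` {..<j} \<subseteq> ?C" using sub by auto
  show ?thesis
  proof (rule expectation_at_vertex[where f = "\<lambda>q z. ?f1 q z * ?f2 q z" and C = ?C, OF ind a(1) _ _ _ _ _ _ rate _ _ t(2)])
    show "(\<lambda>(q, z). ?f1 q z * ?f2 q z) \<in> borel_measurable (borel \<Otimes>\<^sub>M PiM ?C (\<lambda>_. borel))"
      using borel_measurable_times[OF local_descending(1)[OF subC(1)] local_descending(1)[OF subC(2)]]
      by (simp add: case_prod_beta)
    show "?f1 q (restrict z ?C) * ?f2 q (restrict z ?C) = ?f1 q z * ?f2 q z" for q z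
      unfolding local_descending(2)[OF subC(1)] local_descending(2)[OF subC(2)] ..
    show "?f1 q z * ?f2 q z = 0" if "1 \<le> q" for q z
      using that descending_less[of t "\<lambda>l. z (\<iota> l)" i q] t by auto
    show "?f1 q z * ?f2 q z = 0" if "t \<le> q" for q z
      using that descending_less[of t "\<lambda>l. z (\<iota> l)" i q] by auto
    show "expectation (\<lambda>\<omega>. ?f1 q (\<lambda>i. Y i \<omega>) * ?f2 q (\<lambda>i. Y i \<omega>)) *
      (if i = 0 \<or> j = 0 then \<lambda>r. vacancy k r ^ k else arrival_rate k) q =
      arrival_rate k q * (chain_prob k t i q * chain_prob k t j q)" if q: "0 \<le> q" "q < t" for q
    proof -
      have "expectation (\<lambda>\<omega>. ?f1 q (\<lambda>i. Y i \<omega>) * ?f2 q (\<lambda>i. Y i \<omega>)) =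
         expectation (\<lambda>\<omega>. ?f1 q (\<lambda>i. Y i \<omega>)) * expectation (\<lambda>\<omega>. ?f2 q (\<lambda>i. Y i \<omega>))"
        by (rule expectation_mult_local[OF ind AB local_descending(3)[OF sub(1)] _ local_descending(3)[OF sub(2)]]) auto
      then show ?thesis
        using q ij left[of q] right[of q]
        by (cases "i = 0"; cases "j = 0") (auto simp: vacancy_power_Suc[OF k] chain_prob_0 prob_space)
    qed
  qed (use a AB in \<open>auto simp: abs_mult\<close>)
qed

text \<open>
  The expected product of the two end states. Pairs of chains with \<open>a + c < m\<close> are
  disjoint, with \<open>a + c = m\<close> they share one site, and with \<open>a + c > m\<close> they traverse a common edge in
  opposite directions.
\<close>

theorem expectation_path_product:
  assumes k: "k \<ge> 1" and m: "m \<ge> 1" and t: "0 \<le> t" "t \<le> 1"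
    and ind: "indep_vars (\<lambda>_. borel) Y {..m}"
    and rate: "\<And>l. l \<le> m \<Longrightarrow> has_rate (Y l) (if l = 0 \<or> l = m then \<lambda>r. vacancy k r ^ k else arrival_rate k)"
  shows "expectation (\<lambda>\<omega>.
      (\<Sum>a\<le>m. (-1) ^ a * of_bool (descending t (\<lambda>l. Y l \<omega>) a (Y a \<omega>))) *
      (\<Sum>c\<le>m. (-1) ^ c * of_bool (descending t (\<lambda>l. Y (m - l) \<omega>) c (Y (m - c) \<omega>)))) =
    (\<Sum>n<m. (-1) ^ n * chain_pair k t n) + (-1) ^ m * chain_overlap k t m"
proof -
  define A where "A a \<omega> = (of_bool (descending t (\<lambda>l. Y l \<omega>) a (Y a \<omega>)) :: real)" for a \<omega>
  define B where "B c \<omega> = (of_bool (descending t (\<lambda>l. Y (m - l) \<omega>) c (Y (m - c) \<omega>)) :: real)" for c \<omega>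
  have Y: "Y l \<in> borel_measurable M" if "l \<le> m" for l
    using ind that by (auto simp: indep_vars_def)
  have A_meas: "A a \<in> borel_measurable M" if "a \<le> m" for a
  proof -
    have [measurable]: "Measurable.pred M (\<lambda>\<omega>. descending t (\<lambda>l. Y l \<omega>) a (Y a \<omega>))"
      using Y that by (intro measurable_descending) auto
    show ?thesis unfolding A_def by measurable
  qed
  have B_meas: "B c \<in> borel_measurable M" if "c \<le> m" for c
  proof -
    have [measurable]: "Measurable.pred M (\<lambda>\<omega>. descending t (\<lambda>l. Y (m - l) \<omega>) c (Y (m - c) \<omega>))"
      using Y that by (intro measurable_descending) auto
    show ?thesis unfolding B_def by measurable
  qed
  have left: "expectation (\<lambda>\<omega>. of_bool (descending t (\<lambda>l. Y l \<omega>) i q)) = chain_prob k t i q"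
    if "0 < i" "i \<le> m" "0 \<le> q" "q \<le> t" for i q
  proof -
    obtain i' where i: "i = Suc i'" using \<open>0 < i\<close> by (cases i) auto
    have "has_rate (Y l) (arrival_rate k)" if "0 < l" "l \<le> i'" for l
      using rate[of l] that \<open>i \<le> m\<close> i by auto
    then show ?thesis
      unfolding i using that i rate[of 0]
      by (intro expectation_descending[OF k t(2) ind, where \<iota> = "\<lambda>l. l"]) auto
  qed
  have right: "expectation (\<lambda>\<omega>. of_bool (descending t (\<lambda>l. Y (m - l) \<omega>) i q)) = chain_prob k t i q"
    if "0 < i" "i \<le> m" "0 \<le> q" "q \<le> t" for i q
  proof -
    obtain i' where i: "i = Suc i'" using \<open>0 < i\<close> by (cases i) auto
    have "has_rate (Y (m - l)) (arrival_rate k)" if "0 < l" "l \<le> i'" for l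
    proof -
      have "m - l \<noteq> 0" "m - l \<noteq> m" using that \<open>i \<le> m\<close> i by auto
      then show ?thesis using rate[of "m - l"] by simp
    qed
    then show ?thesis
      unfolding i using that i rate[of m]
      by (intro expectation_descending[OF k t(2) ind, where \<iota> = "\<lambda>l. m - l"]) (auto simp: inj_on_def)
  qed
  have AE_pos: "AE \<omega> in M. 0 < Y l \<omega>" if "l \<le> m" for l
    by (rule has_rate_AE_pos[OF rate[OF that] Y[OF that]])
  have EA: "expectation (A a) = chain_prob k t (Suc a) 0" if "a < m" for a
  proof -
    have "expectation (A a) = expectation (\<lambda>\<omega>. of_bool (descending t (\<lambda>l. Y l \<omega>) (Suc a) 0))"
    proof (rule integral_cong_AE)
      show "AE \<omega> in M. A a \<omega> = of_bool (descending t (\<lambda>l. Y l \<omega>) (Suc a) 0)"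
        using AE_pos[of a] that by (auto simp: A_def elim: eventually_mono)
      have [measurable]: "Measurable.pred M (\<lambda>\<omega>. descending t (\<lambda>l. Y l \<omega>) (Suc a) 0)"
        using Y that by (intro measurable_descending) auto
      show "(\<lambda>\<omega>. of_bool (descending t (\<lambda>l. Y l \<omega>) (Suc a) 0)) \<in> borel_measurable M"
        by measurable
    qed (use A_meas that in auto)
    also have "\<dots> = chain_prob k t (Suc a) 0" using that t by (intro left) auto
    finally show ?thesis .
  qed
  have EB: "expectation (B c) = chain_prob k t (Suc c) 0" if "c < m" for c
  proof -
    have "expectation (B c) = expectation (\<lambda>\<omega>. of_bool (descending t (\<lambda>l. Y (m - l) \<omega>) (Suc c) 0))"
    proof (rule integral_cong_AE)
      show "AE \<omega> in M. B c \<omega> = of_bool (descending t (\<lambda>l. Y (m - l) \<omega>) (Suc c) 0)"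
        using AE_pos[of "m - c"] by (auto simp: B_def elim: eventually_mono)
      have [measurable]: "Measurable.pred M (\<lambda>\<omega>. descending t (\<lambda>l. Y (m - l) \<omega>) (Suc c) 0)"
        using Y that by (intro measurable_descending) auto
      show "(\<lambda>\<omega>. of_bool (descending t (\<lambda>l. Y (m - l) \<omega>) (Suc c) 0)) \<in> borel_measurable M"
        by measurable
    qed (use B_meas that in auto)
    also have "\<dots> = chain_prob k t (Suc c) 0" using that t by (intro right) auto
    finally show ?thesis .
  qed
  have disjoint: "expectation (\<lambda>\<omega>. A a \<omega> * B c \<omega>) = chain_prob k t (Suc a) 0 * chain_prob k t (Suc c) 0"
    if "a + c < m" for a c
  proof -
    have "local_on {..a} (\<lambda>z. of_bool (descending t z a (z a)))"
    proof -
      have "Measurable.pred (PiM {..a} (\<lambda>_. borel)) (\<lambda>z. descending t (\<lambda>l. z l) a (z a))"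
        by (intro measurable_descending) auto
      moreover have "descending t (restrict z {..a}) a (restrict z {..a} a) = descending t z a (z a)" for z
        using descending_cong[of a "restrict z {..a}" z t "z a"] by simp
      ultimately show ?thesis by (simp add: local_on_def del: restrict_apply)
    qed
    moreover have "local_on {m - c..m} (\<lambda>z. of_bool (descending t (\<lambda>l. z (m - l)) c (z (m - c))))"
    proof -
      have "Measurable.pred (PiM {m - c..m} (\<lambda>_. borel)) (\<lambda>z. descending t (\<lambda>l. z (m - l)) c (z (m - c)))"
        by (intro measurable_descending) auto
      moreover have "descending t (\<lambda>l. restrict z {m - c..m} (m - l)) c (restrict z {m - c..m} (m - c)) =
          descending t (\<lambda>l. z (m - l)) c (z (m - c))" for z
        using descending_cong[of c "\<lambda>l. restrict z {m - c..m} (m - l)" "\<lambda>l. z (m - l)" t "z (m - c)"]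
        by (simp add: diff_le_mono2 less_imp_le)
      ultimately show ?thesis by (simp add: local_on_def del: restrict_apply)
    qed
    ultimately have "expectation (\<lambda>\<omega>. A a \<omega> * B c \<omega>) = expectation (A a) * expectation (B c)"
      unfolding A_def B_def using that
      by (intro expectation_mult_local[OF ind, where A = "{..a}" and B = "{m - c..m}"
            and F = "\<lambda>z. of_bool (descending t z a (z a))"
            and G = "\<lambda>z. of_bool (descending t (\<lambda>l. z (m - l)) c (z (m - c)))"]) auto
    then show ?thesis using that by (simp add: EA EB)
  qed
  have meet: "expectation (\<lambda>\<omega>. A a \<omega> * B (m - a) \<omega>) =
      (\<integral>q. (arrival_rate k q * (chain_prob k t a q * chain_prob k t (m - a) q)) * indicator {0..t} q \<partial>lborel)"
    if "a \<le> m" for a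
  proof -
    have "m - (m - a) = a" using that by simp
    then show ?thesis
      unfolding A_def B_def using that m t left[of a] right[of "m - a"] rate[of a]
      by (simp only:, intro expectation_chains_meet[OF k t ind, where \<iota> = "\<lambda>l. l" and \<kappa> = "\<lambda>l. m - l"
            and A = "{..<a}" and B = "{a<..m}"]) (auto split: if_splits)
  qed
  have cross: "A a \<omega> * B c \<omega> = 0" if "a \<le> m" "c \<le> m" "a + c > m" for a c \<omega>
  proof -
    have "Y (Suc (m - c)) \<omega> < Y (m - c) \<omega>" if "descending t (\<lambda>l. Y l \<omega>) a (Y a \<omega>)"
      using descending_last[of t "\<lambda>l. Y l \<omega>" a "m - c"] that \<open>a + c > m\<close> \<open>c \<le> m\<close> by auto
    moreover have "Y (m - c) \<omega> < Y (Suc (m - c)) \<omega>" if "descending t (\<lambda>l. Y (m - l) \<omega>) c (Y (m - c) \<omega>)"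
    proof -
      have "c > 0" using \<open>a + c > m\<close> \<open>a \<le> m\<close> by auto
      then have "m - (c - 1) = Suc (m - c)" "Suc (c - 1) = c" using \<open>c \<le> m\<close> by auto
      then show ?thesis
        using descending_last[of t "\<lambda>l. Y (m - l) \<omega>" c "c - 1"] that \<open>c > 0\<close> by auto
    qed
    ultimately show ?thesis by (auto simp: A_def B_def)
  qed
  have int: "integrable M (\<lambda>\<omega>. A a \<omega> * B c \<omega>)" if "a \<le> m" "c \<le> m" for a c
  proof (rule integrable_const_bound[of _ 1])
    show "AE \<omega> in M. norm (A a \<omega> * B c \<omega>) \<le> 1" by (auto simp: A_def B_def)
  qed (intro borel_measurable_times A_meas B_meas that)
  have overlap: "chain_overlap k t m = (\<Sum>a\<le>m. expectation (\<lambda>\<omega>. A a \<omega> * B (m - a) \<omega>))"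
  proof -
    have "chain_overlap k t m = (\<integral>q. (\<Sum>a\<le>m. (arrival_rate k q * (chain_prob k t a q * chain_prob k t (m - a) q)) * indicator {0..t} q) \<partial>lborel)"
      unfolding chain_overlap_def chain_convolution_def
      by (simp add: sum_distrib_left sum_distrib_right)
    also have "\<dots> = (\<Sum>a\<le>m. \<integral>q. (arrival_rate k q * (chain_prob k t a q * chain_prob k t (m - a) q)) * indicator {0..t} q \<partial>lborel)"
      using k by (intro Bochner_Integration.integral_sum borel_integrable_atLeastAtMost)
        (auto intro!: continuous_intros isCont_arrival_rate isCont_chain_prob)
    finally show ?thesis by (simp add: meet)
  qed
  have "expectation (\<lambda>\<omega>. (\<Sum>a\<le>m. (-1) ^ a * A a \<omega>) * (\<Sum>c\<le>m. (-1) ^ c * B c \<omega>)) =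
     expectation (\<lambda>\<omega>. \<Sum>(a, c)\<in>{..m} \<times> {..m}. (-1) ^ (a + c) * (A a \<omega> * B c \<omega>))"
    unfolding sum_product sum.cartesian_product
    by (simp add: power_add algebra_simps)
  also have "\<dots> = expectation (\<lambda>\<omega>. \<Sum>(a, c)\<in>{(a, c). a + c \<le> m}. (-1) ^ (a + c) * (A a \<omega> * B c \<omega>))"
  proof (intro Bochner_Integration.integral_cong refl sum.mono_neutral_right ballI)
    fix \<omega> p assume "p \<in> {..m} \<times> {..m} - {(a, c). a + c \<le> m}"
    then show "(case p of (a, c) \<Rightarrow> (-1) ^ (a + c) * (A a \<omega> * B c \<omega>)) = 0"
      using cross[of "fst p" "snd p" \<omega>] by (cases p) auto
  qed auto
  also have "\<dots> = (\<Sum>(a, c)\<in>{(a, c). a + c \<le> m}. (-1) ^ (a + c) * expectation (\<lambda>\<omega>. A a \<omega> * B c \<omega>))"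
    unfolding case_prod_beta
    by (subst Bochner_Integration.integral_sum) (auto intro!: integrable_mult_right int)
  also have "\<dots> = (\<Sum>n\<le>m. \<Sum>a\<le>n. (-1) ^ (a + (n - a)) * expectation (\<lambda>\<omega>. A a \<omega> * B (n - a) \<omega>))"
    by (rule sum.triangle_reindex_eq)
  also have "\<dots> = (\<Sum>n\<le>m. (-1) ^ n * (\<Sum>a\<le>n. expectation (\<lambda>\<omega>. A a \<omega> * B (n - a) \<omega>)))"
    by (simp add: sum_distrib_left)
  also have "\<dots> = (\<Sum>n<m. (-1) ^ n * (\<Sum>a\<le>n. expectation (\<lambda>\<omega>. A a \<omega> * B (n - a) \<omega>))) + (-1) ^ m * chain_overlap k t m"
    unfolding overlap by (simp add: lessThan_Suc_atMost[symmetric])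
  also have "(\<Sum>n<m. (-1) ^ n * (\<Sum>a\<le>n. expectation (\<lambda>\<omega>. A a \<omega> * B (n - a) \<omega>))) = (\<Sum>n<m. (-1) ^ n * chain_pair k t n)"
    unfolding chain_pair_def by (intro sum.cong refl arg_cong2[of _ _ _ _ "(*)"]) (auto simp: disjoint)
  finally show ?thesis unfolding A_def B_def .
qed

end

section \<open>Reduction to a path\<close>

text \<open>
  In a tree the walks without immediate reversal are the simple paths; the local form of the
  condition is convenient for the nesting of branches along the path.
\<close>

definition nonbacktracking :: "'a rel \<Rightarrow> (nat \<Rightarrow> 'a) \<Rightarrow> nat \<Rightarrow> bool" where
  "nonbacktracking E u m \<longleftrightarrow> (\<forall>i<m. (u i, u (Suc i)) \<in> E) \<and>
     (\<forall>i. Suc (Suc i) \<le> m \<longrightarrow> u i \<noteq> u (Suc (Suc i)))"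

definition off_path :: "'a rel \<Rightarrow> (nat \<Rightarrow> 'a) \<Rightarrow> nat \<Rightarrow> nat \<Rightarrow> 'a set" where
  "off_path E u m l =
     E `` {u l} - ((if l = 0 then {} else {u (l - 1)}) \<union> (if l = m then {} else {u (Suc l)}))"

definition path_region :: "'a rel \<Rightarrow> (nat \<Rightarrow> 'a) \<Rightarrow> nat \<Rightarrow> nat \<Rightarrow> 'a set" where
  "path_region E u m l = insert (u l) (\<Union>w\<in>off_path E u m l. branch E (u l) w)"

definition free_time :: "'a rel \<Rightarrow> (nat \<Rightarrow> 'a) \<Rightarrow> nat \<Rightarrow> nat \<Rightarrow> ('a \<Rightarrow> real) \<Rightarrow> real" where
  "free_time E u m l x =
     (if \<forall>w\<in>off_path E u m l. x (u l) \<le> branch_time E (u l) w x then x (u l) else 2)"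

lemma off_path_reverse:
  "l \<le> m \<Longrightarrow> off_path E (\<lambda>i. u (m - i)) m l = off_path E u m (m - l)"
  unfolding off_path_def by (cases "l = 0"; cases "l = m") (auto simp: Suc_diff_Suc Suc_diff_le diff_Suc split: nat.splits)

lemma free_time_reverse:
  "l \<le> m \<Longrightarrow> free_time E (\<lambda>i. u (m - i)) m l x = free_time E u m (m - l) x"
  unfolding free_time_def by (simp add: off_path_reverse)

lemma nonbacktracking_reverse:
  assumes "nonbacktracking E u m" "sym E"
  shows "nonbacktracking E (\<lambda>i. u (m - i)) m"
  unfolding nonbacktracking_def
proof (intro conjI allI impI)
  fix i assume "i < m"
  then have "(u (m - Suc i), u (Suc (m - Suc i))) \<in> E"
    using assms(1) by (simp add: nonbacktracking_def)
  with \<open>i < m\<close> show "(u (m - i), u (m - Suc i)) \<in> E"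
    using assms(2) by (simp add: Suc_diff_Suc symD)
next
  fix i assume "Suc (Suc i) \<le> m"
  moreover from this have "Suc (Suc (m - Suc (Suc i))) = m - i" by simp
  ultimately show "u (m - i) \<noteq> u (m - Suc (Suc i))"
    using assms(1) unfolding nonbacktracking_def by (metis diff_le_self)
qed

text \<open>
  An immediate reversal could be cut out, contradicting minimality of the distance.
\<close>

lemma geodesic_nonbacktracking:
  assumes "(v, w) \<in> E\<^sup>*"
  obtains u where "nonbacktracking E u (graph_dist E v w)" "u 0 = v" "u (graph_dist E v w) = w"
proof -
  define m where "m = graph_dist E v w"
  have "\<exists>n. (v, w) \<in> E ^^ n" using assms by (simp add: rtrancl_power)
  then have "(v, w) \<in> E ^^ m" unfolding m_def graph_dist_def by (rule LeastI_ex)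
  then obtain u where u: "u 0 = v" "u m = w" "\<And>i. i < m \<Longrightarrow> (u i, u (Suc i)) \<in> E"
    by (auto simp: relpow_fun_conv)
  have "u i \<noteq> u (Suc (Suc i))" if i: "Suc (Suc i) \<le> m" for i
  proof
    assume eq: "u i = u (Suc (Suc i))"
    have "(v, u i) \<in> E ^^ i"
      using u i by (auto simp: relpow_fun_conv intro!: exI[of _ u])
    moreover obtain d where d: "m = Suc (Suc i) + d" using i le_Suc_ex by blast
    have "(u i, w) \<in> E ^^ d"
      unfolding relpow_fun_conv using u eq d
      by (intro exI[of _ "\<lambda>j. u (Suc (Suc i) + j)"]) auto
    ultimately have "(v, w) \<in> E ^^ (i + d)"
      by (auto simp: relpow_add)
    then have "m \<le> i + d"
      unfolding m_def graph_dist_def by (rule Least_le)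
    with d show False by simp
  qed
  then have "nonbacktracking E u m" using u(3) by (simp add: nonbacktracking_def)
  with u show ?thesis using that unfolding m_def by blast
qed

context rsa_tree
begin

lemma path_vertex:
  assumes "nonbacktracking E u m" "m \<ge> 1" "l \<le> m"
  shows "u l \<in> V"
proof (cases "l = m")
  case True
  from assms(2) obtain m' where "m = Suc m'" by (cases m) auto
  with assms(1) have "(u m', u m) \<in> E" unfolding nonbacktracking_def by auto
  then show ?thesis using True edges by auto
next
  case False
  with assms have "(u l, u (Suc l)) \<in> E" unfolding nonbacktracking_def by auto
  then show ?thesis using edges by auto
qed

lemma path_branch_nested:
  assumes "nonbacktracking E u m" "i \<le> j" "j < m"
  shows "branch E (u j) (u (Suc j)) \<subseteq> branch E (u i) (u (Suc i))"
  using assms(2,3)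
proof (induction j rule: dec_induct)
  case (step j)
  have "u (Suc (Suc j)) \<noteq> u j"
    using assms(1) step.prems unfolding nonbacktracking_def by (metis Suc_leI)
  then have "branch E (u (Suc j)) (u (Suc (Suc j))) \<subseteq> branch E (u j) (u (Suc j))"
    using assms(1) step.prems symE
    by (intro branch_child_subset[OF graph(1,2)]) (auto simp: nonbacktracking_def)
  with step show ?case by auto
qed simp

lemma path_region_in_branch:
  assumes "nonbacktracking E u m" "l < m"
  shows "path_region E u m (Suc l) \<subseteq> branch E (u l) (u (Suc l))"
proof -
  have "branch E (u (Suc l)) w \<subseteq> branch E (u l) (u (Suc l))" if "w \<in> off_path E u m (Suc l)" for w
    using that assms symE
    by (intro branch_child_subset[OF graph(1,2)]) (auto simp: off_path_def nonbacktracking_def)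
  then show ?thesis unfolding path_region_def using branch_self by fastforce
qed

lemma path_region_outside_branch:
  assumes "nonbacktracking E u m" "l < m"
  shows "path_region E u m l \<inter> branch E (u l) (u (Suc l)) = {}"
proof -
  have e: "(u l, u (Suc l)) \<in> E" using assms by (simp add: nonbacktracking_def)
  then have "u l \<noteq> u (Suc l)" using irreflE[of "u l"] by auto
  then have "u l \<notin> branch E (u l) (u (Suc l))" by (rule branch_avoids)
  moreover have "branch E (u l) w \<inter> branch E (u l) (u (Suc l)) = {}" if "w \<in> off_path E u m l" for w
    using that assms(2) e by (intro branch_disjoint[OF graph(1,2)]) (auto simp: off_path_def)
  ultimately show ?thesis unfolding path_region_def by blast
qed

text \<open>
  For \<open>i < j\<close> the region of \<open>u j\<close> lies in the branch that leaves \<open>u i\<close> along the path, and the region of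
  \<open>u i\<close> avoids this branch.
\<close>

lemma path_regions_disjoint:
  assumes "nonbacktracking E u m"
  shows "disjoint_family_on (path_region E u m) {..m}"
proof -
  have less: "path_region E u m i \<inter> path_region E u m j = {}" if "i < j" "j \<le> m" for i j
  proof -
    have "j \<noteq> 0" using that by simp
    then obtain j' where j: "j = Suc j'" by (cases j) auto
    have "path_region E u m j \<subseteq> branch E (u i) (u (Suc i))"
      using path_region_in_branch[OF assms, of j'] path_branch_nested[OF assms, of i j'] that j by auto
    then show ?thesis using path_region_outside_branch[OF assms, of i] that by auto
  qed
  show ?thesis
    unfolding disjoint_family_on_def
  proof (intro ballI impI)
    fix i j assume "i \<in> {..m}" "j \<in> {..m}" "i \<noteq> j"
    then show "path_region E u m i \<inter> path_region E u m j = {}"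
      using less[of i j] less[of j i] by (cases "i < j") auto
  qed
qed

lemma local_free_time:
  assumes "nonbacktracking E u m" "m \<ge> 1" "l \<le> m"
  shows "local_on (path_region E u m l) (free_time E u m l)"
proof -
  have "local_on (path_region E u m l)
      (\<lambda>x. if \<forall>w\<in>off_path E u m l. x (u l) \<le> branch_time E (u l) w x then x (u l) else 2)"
  proof (rule local_on_first_arrival)
    show "finite (off_path E u m l)"
      using locally_finite[OF path_vertex[OF assms]] by (simp add: off_path_def)
    show "local_on (path_region E u m l) (\<lambda>x. x (u l))"
      by (rule local_on_component) (simp add: path_region_def)
    fix w assume w: "w \<in> off_path E u m l"
    then have "local_on (branch E (u l) w) (branch_time E (u l) w)"
      using edges symE by (intro local_branch_time) (auto simp: off_path_def)
    moreover have "branch E (u l) w \<subseteq> path_region E u m l" using w by (auto simp: path_region_def)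
    ultimately show "local_on (path_region E u m l) (branch_time E (u l) w)" by (rule local_on_mono)
  qed
  then show ?thesis by (simp add: free_time_def[abs_def])
qed

lemma path_region_in_V:
  assumes "nonbacktracking E u m" "m \<ge> 1" "l \<le> m"
  shows "path_region E u m l \<subseteq> V"
  using path_vertex[OF assms] branch_in_V edges by (fastforce simp: path_region_def off_path_def)

lemma indep_free_times:
  assumes "nonbacktracking E u m" "m \<ge> 1"
  shows "indep_vars (\<lambda>_. borel) (\<lambda>l \<omega>. free_time E u m l (arrivals \<omega>)) {..m}"
  using path_regions_disjoint[OF assms(1)] local_free_time[OF assms] path_region_in_V[OF assms]
  by (intro indep_vars_local[OF indep, where K = "path_region E u m"]) auto

text \<open>
  Off the path an end has \<open>k\<close> neighbours and an interior site \<open>k - 1\<close>; each of their branches is a copy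
  of \<open>T\<^sub>k\<^sup>*\<close>, vacant at its root at time \<open>r\<close> with probability \<open>b r\<close>.
\<close>

lemma free_time_rate:
  assumes "S = E" and path: "nonbacktracking E u m" "m \<ge> 1" "l \<le> m"
  shows "has_rate (\<lambda>\<omega>. free_time E u m l (arrivals \<omega>))
    (if l = 0 \<or> l = m then \<lambda>r. vacancy k r ^ k else arrival_rate k)"
proof -
  let ?O = "off_path E u m l"
  have v: "u l \<in> V" by (rule path_vertex[OF path])
  have prev: "(u (l - 1), u l) \<in> E" if "l \<noteq> 0"
    using path that unfolding nonbacktracking_def by (auto dest: spec[of _ "l - 1"])
  have succ: "(u (Suc l), u l) \<in> E" if "l \<noteq> m"
    using path that unfolding nonbacktracking_def by (auto intro: symE)
  have card: "card ?O = (if l = 0 \<or> l = m then k else k - 1)"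
  proof -
    consider "l = 0" | "l = m" "l \<noteq> 0" | "l \<noteq> 0" "l \<noteq> m" by blast
    then show ?thesis
    proof cases
      case 1
      then show ?thesis
        using path(2) S_card[of "u (Suc l)" "u l"] succ assms(1) by (auto simp: off_path_def)
    next
      case 2
      then show ?thesis using S_card[of "u (l - 1)" "u l"] prev assms(1) by (auto simp: off_path_def)
    next
      case 3
      then have "u (l - 1) \<noteq> u (Suc l)"
        using path unfolding nonbacktracking_def by (auto dest: spec[of _ "l - 1"])
      then have "card (E `` {u l} - {u (l - 1)} - {u (Suc l)}) = k - 1"
        using S_card[of "u (l - 1)" "u l"] prev succ assms(1) 3 locally_finite[OF v]
        by (subst card_Diff_singleton) (auto intro: symE)
      moreover have "?O = E `` {u l} - {u (l - 1)} - {u (Suc l)}" using 3 by (auto simp: off_path_def)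
      ultimately show ?thesis using 3 by simp
    qed
  qed
  show ?thesis
    unfolding has_rate_def
  proof (intro ballI impI)
    fix h :: "real \<Rightarrow> real"
    assume h: "h \<in> borel_measurable borel" "\<forall>r. \<bar>h r\<bar> \<le> 1" "\<forall>r\<ge>1. h r = 0"
    have loc: "local_on (branch E (u l) w) (branch_time E (u l) w)" if "w \<in> ?O" for w
      using that edges symE by (intro local_branch_time) (auto simp: off_path_def)
    have "expectation (\<lambda>\<omega>. h (free_time E u m l (arrivals \<omega>))) =
       expectation (\<lambda>\<omega>. h (\<tau> (u l) \<omega>) * of_bool (\<forall>w\<in>?O. \<tau> (u l) \<omega> \<le> branch_time E (u l) w (arrivals \<omega>)))"
      using h(3) by (intro Bochner_Integration.integral_cong) (auto simp: free_time_def)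
    also have "\<dots> = (\<integral>r. (h r * (\<Prod>w\<in>?O. prob {\<omega> \<in> space M. r \<le> branch_time E (u l) w (arrivals \<omega>)})) * indicator {0..1} r \<partial>lborel)"
      using h by (intro expectation_vertex_first v loc) (auto simp: off_path_def)
    also have "\<dots> = (\<integral>r. (h r * (if l = 0 \<or> l = m then \<lambda>r. vacancy k r ^ k else arrival_rate k) r) * indicator {0..1} r \<partial>lborel)"
    proof (intro Bochner_Integration.integral_cong refl)
      fix r :: real
      show "(h r * (\<Prod>w\<in>?O. prob {\<omega> \<in> space M. r \<le> branch_time E (u l) w (arrivals \<omega>)})) * indicator {0..1} r =
        (h r * (if l = 0 \<or> l = m then \<lambda>r. vacancy k r ^ k else arrival_rate k) r) * indicator {0..1} r"
      proof (cases "r \<in> {0..1}")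
        case True
        have "(\<Prod>w\<in>?O. prob {\<omega> \<in> space M. r \<le> branch_time E (u l) w (arrivals \<omega>)}) = (\<Prod>w\<in>?O. vacancy k r)"
          using True assms(1) by (intro prod.cong refl prob_branch_time_S) (auto simp: off_path_def)
        also have "\<dots> = (if l = 0 \<or> l = m then \<lambda>r. vacancy k r ^ k else arrival_rate k) r"
          using True vacancy_power[OF k, of r] by (simp add: card)
        finally show ?thesis by simp
      qed simp
    qed
    finally show "expectation (\<lambda>\<omega>. h (free_time E u m l (arrivals \<omega>))) =
      (\<integral>r. (h r * (if l = 0 \<or> l = m then \<lambda>r. vacancy k r ^ k else arrival_rate k) r) * indicator {0..1} r \<partial>lborel)" .
  qed
qed

text \<open>
  Along the path, the occupation time of \<open>u l\<close> in the branch away from \<open>u (l - 1)\<close> satisfies the blocking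
  recursion with the free times in place of the arrival times.
\<close>

lemma AE_path_expansion:
  assumes "S = E" and path: "nonbacktracking E u m" "m \<ge> 1" and t: "t \<le> 1"
  shows "AE \<omega> in M. (of_bool (branch_time E (u 0) (u 0) (arrivals \<omega>) < t) :: real) =
    (\<Sum>a\<le>m. (-1) ^ a * of_bool (descending t (\<lambda>l. free_time E u m l (arrivals \<omega>)) a (free_time E u m a (arrivals \<omega>))))"
proof -
  \<comment> \<open>The vertex that \<open>u l\<close> looks away from; the first site of the path is treated as a root.\<close>
  define p where "p l = (if l = 0 then u 0 else u (l - 1))" for l
  have orient: "oriented (p l) (u l)" if "l \<le> m" for l
  proof (cases "l = 0")
    case True
    then show ?thesis
      unfolding oriented_def p_def using path_vertex[OF path, of 0] assms(1) by auto
  next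
    case False
    then have "(u (l - 1), u l) \<in> E"
      using path that unfolding nonbacktracking_def by (auto dest: spec[of _ "l - 1"])
    then show ?thesis using False assms(1) S_oriented[of "u (l - 1)" "u l"] by (simp add: p_def)
  qed
  have "AE \<omega> in M. \<forall>l\<in>{..m}. branch_time E (p l) (u l) (arrivals \<omega>) =
    (if \<forall>w\<in>E `` {u l} - {p l}. \<tau> (u l) \<omega> \<le> branch_time E (u l) w (arrivals \<omega>) then \<tau> (u l) \<omega> else 2)"
    by (intro AE_finite_allI AE_branch_time_rec orient) auto
  then show ?thesis
  proof eventually_elim
    fix \<omega>
    assume rec: "\<forall>l\<in>{..m}. branch_time E (p l) (u l) (arrivals \<omega>) =
      (if \<forall>w\<in>E `` {u l} - {p l}. \<tau> (u l) \<omega> \<le> branch_time E (u l) w (arrivals \<omega>) then \<tau> (u l) \<omega> else 2)"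
    let ?R = "\<lambda>l. branch_time E (p l) (u l) (arrivals \<omega>)" and ?y = "\<lambda>l. free_time E u m l (arrivals \<omega>)"
    have "?R l = (if ?y l \<le> ?R (Suc l) then ?y l else 2)" if l: "l < m" for l
    proof -
      have "E `` {u l} - {p l} = insert (u (Suc l)) (off_path E u m l)"
      proof -
        have e: "(u l, u (Suc l)) \<in> E" using path(1) l by (simp add: nonbacktracking_def)
        moreover have "u (Suc l) \<noteq> p l"
        proof (cases l)
          case 0
          then show ?thesis using e irreflE by (auto simp: p_def)
        next
          case (Suc j)
          then have "u j \<noteq> u (Suc (Suc j))" using path(1) l by (simp add: nonbacktracking_def)
          then show ?thesis using Suc by (simp add: p_def)
        qed
        ultimately show ?thesis
          using l irreflE[of "u 0"] by (auto simp: off_path_def p_def split: if_splits)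
      qed
      then have "?R l = (if (\<forall>w\<in>off_path E u m l. \<tau> (u l) \<omega> \<le> branch_time E (u l) w (arrivals \<omega>)) \<and>
          \<tau> (u l) \<omega> \<le> ?R (Suc l) then \<tau> (u l) \<omega> else 2)"
        using rec l by (simp add: p_def)
      then show ?thesis by (auto simp: free_time_def)
    qed
    moreover have "?R m = ?y m"
    proof -
      have "E `` {u m} - {p m} = off_path E u m m"
        using path(2) by (auto simp: off_path_def p_def)
      then show ?thesis using rec by (simp add: free_time_def)
    qed
    ultimately have "(of_bool (?R 0 < t) :: real) = (\<Sum>a\<le>m. (-1) ^ a * of_bool (descending t ?y a (?y a)))"
      using t by (intro alternating_chain_expansion) auto
    then show "(of_bool (branch_time E (u 0) (u 0) (arrivals \<omega>) < t) :: real) =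
      (\<Sum>a\<le>m. (-1) ^ a * of_bool (descending t ?y a (?y a)))"
      by (simp add: p_def)
  qed
qed

text \<open>
  The two expansions of the end states come from the path and from its reversal, which have the same
  free times.
\<close>

lemma covariance_path:
  assumes "S = E" and path: "nonbacktracking E u m" "m \<ge> 1" and t: "0 \<le> t" "t \<le> 1"
  shows "covariance M (\<lambda>\<omega>. rsa V E (arrivals \<omega>) t (u 0)) (\<lambda>\<omega>. rsa V E (arrivals \<omega>) t (u m)) =
    - ((vacancy k t)\<^sup>2 / 2) * parity_tail (2 * ln (vacancy k t)) (m + 1)"
proof -
  define X where "X l \<omega> = rsa V E (arrivals \<omega>) t (u l)" for l \<omega>
  define Z where "Z l \<omega> = (of_bool (branch_time E (u l) (u l) (arrivals \<omega>) < t) :: real)" for l \<omega>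
  have V: "u l \<in> V" if "l \<le> m" for l using path_vertex[OF path that] .
  have orient: "oriented (u l) (u l)" if "l \<le> m" for l
    unfolding oriented_def using V[OF that] assms(1) by auto
  have X_meas[measurable]: "X l \<in> borel_measurable M" for l
    unfolding X_def by (rule measurable_rsa)
  have Z_meas: "Z l \<in> borel_measurable M" if "l \<le> m" for l
  proof -
    note [measurable] = measurable_branch_time[OF V[OF that], of "u l"]
    show ?thesis unfolding Z_def by measurable
  qed
  have XZ: "AE \<omega> in M. X l \<omega> = Z l \<omega>" if "l \<le> m" for l
    using AE_rsa[OF orient[OF that] t(2)] by (simp add: X_def Z_def)
  have EX: "expectation (X l) = (1 - (vacancy k t)\<^sup>2) / 2" if l: "l \<le> m" for l
  proof -
    have "expectation (X l) = expectation (Z l)"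
      using XZ[OF l] Z_meas[OF l] by (intro integral_cong_AE) auto
    also have "\<dots> = (\<integral>r. vacancy k r ^ card (E `` {u l} - {u l}) * indicator {0..t} r \<partial>lborel)"
      unfolding Z_def expectation_of_bool by (rule prob_branch_time[OF orient[OF l] t])
    also have "card (E `` {u l} - {u l}) = k + 1"
    proof -
      obtain w where w: "(w, u l) \<in> E"
      proof (cases l)
        case 0
        have "(u 0, u (Suc 0)) \<in> E" using path by (auto simp: nonbacktracking_def)
        then show ?thesis using that symE 0 by blast
      next
        case (Suc l')
        then have "(u l', u l) \<in> E" using path(1) l by (simp add: nonbacktracking_def)
        then show ?thesis by (rule that)
      qed
      have "E `` {u l} = insert w (E `` {u l} - {w})" using symE[OF w] by auto
      then have "card (E `` {u l}) = Suc (card (E `` {u l} - {w}))"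
        using locally_finite[OF V[OF l]] by (metis card_insert_disjoint Diff_iff finite_Diff insertI1)
      moreover have "E `` {u l} - {u l} = E `` {u l}" using irreflE by auto
      ultimately show ?thesis using S_card[of w "u l"] w assms(1) by simp
    qed
    also have "(\<integral>r. vacancy k r ^ (k + 1) * indicator {0..t} r \<partial>lborel) = (1 - (vacancy k t)\<^sup>2) / 2"
      by (rule integral_vacancy_power_Suc[OF k t(1)])
    finally show ?thesis .
  qed
  have rev: "nonbacktracking E (\<lambda>i. u (m - i)) m"
    using path(1) graph(1) by (intro nonbacktracking_reverse) (auto simp: simple_graph_def)
  let ?Y = "\<lambda>l \<omega>. free_time E u m l (arrivals \<omega>)"
  let ?L = "\<lambda>\<omega>. \<Sum>a\<le>m. (-1) ^ a * of_bool (descending t (\<lambda>l. ?Y l \<omega>) a (?Y a \<omega>)) :: real"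
  let ?R = "\<lambda>\<omega>. \<Sum>c\<le>m. (-1) ^ c * of_bool (descending t (\<lambda>l. ?Y (m - l) \<omega>) c (?Y (m - c) \<omega>)) :: real"
  have L: "AE \<omega> in M. Z 0 \<omega> = ?L \<omega>"
    using AE_path_expansion[OF assms(1) path t(2)] by (simp add: Z_def)
  have R: "AE \<omega> in M. Z m \<omega> = ?R \<omega>"
  proof -
    have "descending t (\<lambda>l. free_time E (\<lambda>i. u (m - i)) m l x) c (free_time E (\<lambda>i. u (m - i)) m c x) =
        descending t (\<lambda>l. free_time E u m (m - l) x) c (free_time E u m (m - c) x)" if "c \<le> m" for c x
      using that by (subst descending_cong) (auto simp: free_time_reverse)
    then show ?thesis
      using AE_path_expansion[OF assms(1) rev path(2) t(2)] by (simp add: Z_def)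
  qed
  have Y_meas: "?Y l \<in> borel_measurable M" if "l \<le> m" for l
    using indep_free_times[OF path] that by (auto simp: indep_vars_def)
  have "expectation (\<lambda>\<omega>. X 0 \<omega> * X m \<omega>) = expectation (\<lambda>\<omega>. ?L \<omega> * ?R \<omega>)"
  proof (rule integral_cong_AE)
    show "AE \<omega> in M. X 0 \<omega> * X m \<omega> = ?L \<omega> * ?R \<omega>"
      using XZ[OF le0] XZ[OF order_refl] L R by eventually_elim simp
    have [measurable]: "Measurable.pred M (\<lambda>\<omega>. descending t (\<lambda>l. ?Y l \<omega>) a (?Y a \<omega>))" if "a \<le> m" for a
      using that by (intro measurable_descending Y_meas) auto
    have [measurable]: "Measurable.pred M (\<lambda>\<omega>. descending t (\<lambda>l. ?Y (m - l) \<omega>) c (?Y (m - c) \<omega>))" if "c \<le> m" for c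
      by (intro measurable_descending Y_meas) auto
    show "(\<lambda>\<omega>. ?L \<omega> * ?R \<omega>) \<in> borel_measurable M" by measurable
  qed measurable
  also have "\<dots> = (\<Sum>n<m. (-1) ^ n * chain_pair k t n) + (-1) ^ m * chain_overlap k t m"
    by (rule expectation_path_product[OF k path(2) t indep_free_times[OF path] free_time_rate[OF assms(1) path]])
  finally have EXX: "expectation (\<lambda>\<omega>. X 0 \<omega> * X m \<omega>) = \<dots>" .
  have bound: "AE \<omega> in M. \<bar>X l \<omega>\<bar> \<le> 1" if "l \<le> m" for l
    using XZ[OF that] by eventually_elim (simp add: Z_def)
  have int: "integrable M (X l)" if "l \<le> m" for l
    using bound[OF that] by (intro integrable_const_bound[of _ 1]) auto
  have int2: "integrable M (\<lambda>\<omega>. X 0 \<omega> * X m \<omega>)"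
  proof (rule integrable_const_bound[of _ 1])
    show "AE \<omega> in M. norm (X 0 \<omega> * X m \<omega>) \<le> 1"
      using bound[OF le0] bound[OF order_refl]
      by eventually_elim (simp add: abs_mult mult_le_one)
  qed measurable
  define p where "p = (1 - (vacancy k t)\<^sup>2) / 2"
  have EXp: "expectation (X l) = p" if "l \<le> m" for l
    using EX[OF that] by (simp only: p_def)
  have "covariance M (X 0) (X m) = expectation (\<lambda>\<omega>. X 0 \<omega> * X m \<omega> - p * X m \<omega> - p * X 0 \<omega> + p * p)"
    unfolding covariance_def EXp[OF le0] EXp[OF order_refl]
    by (intro Bochner_Integration.integral_cong) (auto simp: algebra_simps)
  also have "\<dots> = expectation (\<lambda>\<omega>. X 0 \<omega> * X m \<omega>) - p * p - p * p + p * p"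
    using int[of 0] int[of m] int2 EXp[of 0] EXp[of m] by (simp add: prob_space)
  also have "\<dots> = (\<Sum>n<m. (-1) ^ n * chain_pair k t n) + (-1) ^ m * chain_overlap k t m - p\<^sup>2"
    unfolding EXX by (simp add: power2_eq_square)
  also have "\<dots> = - ((vacancy k t)\<^sup>2 / 2) * parity_tail (2 * ln (vacancy k t)) (m + 1)"
    unfolding p_def by (rule chain_sum_closed_form[OF k t(1)])
  finally show ?thesis unfolding X_def .
qed

end

section \<open>The covariance formula\<close>

lemma countable_connected:
  assumes "simple_graph V E" "connected_graph V E" "\<And>v. v \<in> V \<Longrightarrow> finite (E `` {v})"
  shows "countable V"
proof -
  obtain v where v: "v \<in> V" using assms(2) by (auto simp: connected_graph_def)
  have E: "E \<subseteq> V \<times> V" using assms(1) by (simp add: simple_graph_def)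
  have "countable ((E ^^ n) `` {v}) \<and> (E ^^ n) `` {v} \<subseteq> V" for n
  proof (induction n)
    case (Suc n)
    have "(E ^^ Suc n) `` {v} = (\<Union>x\<in>(E ^^ n) `` {v}. E `` {x})" by auto
    moreover have "countable (\<Union>x\<in>(E ^^ n) `` {v}. E `` {x})"
      using Suc assms(3) by (intro countable_UN) (auto intro: countable_finite)
    ultimately show ?case using E by auto
  qed (use v in auto)
  then have "countable (\<Union>n. (E ^^ n) `` {v})" by blast
  moreover have "V \<subseteq> (\<Union>n. (E ^^ n) `` {v})"
    using assms(2) v by (auto simp: connected_graph_def rtrancl_power)
  ultimately show ?thesis by (rule countable_subset[rotated])
qed

text \<open>
  The edges directed away from \<open>v0\<close> are recognised by their branch not containing \<open>v0\<close>.
\<close>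

lemma rooted_vacancy:
  assumes k: "k \<ge> 1" and tree: "rooted_regular_tree k V E v0" and iid: "iid_uniform M V \<tau>"
    and t: "0 \<le> t" "t \<le> 1"
  shows "measure M {\<omega> \<in> space M. rsa V E (\<lambda>u. \<tau> u \<omega>) t v0 = 0} = vacancy k t"
proof -
  let ?S = "{(u, v) \<in> E. v0 \<notin> branch E u v}"
  have g: "simple_graph V E" "connected_graph V E" "\<nexists>xs. graph_cycle E xs"
    and v0: "v0 \<in> V" and deg: "card (E `` {v0}) = k" "\<And>v. v \<in> V \<Longrightarrow> v \<noteq> v0 \<Longrightarrow> card (E `` {v}) = k + 1"
    using tree by (auto simp: rooted_regular_tree_def is_tree_def graph_degree_def)
  have E: "E \<subseteq> V \<times> V" and symE: "\<And>a b. (a, b) \<in> E \<Longrightarrow> (b, a) \<in> E" and irr: "\<And>a. (a, a) \<notin> E"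
    using g(1) by (auto simp: simple_graph_def sym_def irrefl_def)
  have fin: "finite (E `` {v})" if "v \<in> V" for v
    using deg k that by (intro card_ge_0_finite) (cases "v = v0"; simp)
  interpret prob_space M using iid by (simp add: iid_uniform_def)
  interpret rsa_tree M k V E \<tau> ?S
  proof
    show "countable V" using countable_connected[OF g(1,2) fin] .
    show "card (E `` {v} - {u}) = k" if "(u, v) \<in> ?S" for u v
    proof -
      have "v \<noteq> v0" using that branch_self by fastforce
      moreover have "v \<in> V" "u \<in> E `` {v}" using that E symE by auto
      ultimately show ?thesis using deg(2)[of v] by simp
    qed
    show "(v, w) \<in> ?S" if "(u, v) \<in> ?S" "w \<in> E `` {v} - {u}" for u v w
      using that branch_child_subset[OF g(1,3), of v w u] symE by auto
  qed (use k g fin iid in \<open>auto simp: iid_uniform_def\<close>)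
  have "oriented v0 v0"
    unfolding oriented_def using v0 irr branch_avoids[of v0 _ E] by fastforce
  from prob_rsa_vacant[OF this t] show ?thesis
    by (simp add: deg(1) integral_vacancy_power[OF k t(1)])
qed

theorem theorem13:
  fixes k m :: nat and t :: real and \<beta> :: "real \<Rightarrow> real"
    and V :: "'a set" and E :: "'a rel" and v w :: 'a
    and M :: "'w measure" and \<tau> :: "'a \<Rightarrow> 'w \<Rightarrow> real"
    and V' :: "'b set" and E' :: "'b rel" and v0 :: 'b
    and M' :: "'x measure" and \<tau>' :: "'b \<Rightarrow> 'x \<Rightarrow> real"
  assumes "k \<ge> 1"
    and "regular_tree k V E" and "iid_uniform M V \<tau>"
    and "rooted_regular_tree k V' E' v0" and "iid_uniform M' V' \<tau>'"
    and "\<And>s. \<beta> s = measure M' {\<omega> \<in> space M'. rsa V' E' (\<lambda>u. \<tau>' u \<omega>) s v0 = 0}"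
    and "0 \<le> t" and "t \<le> 1" and "m \<ge> 1"
    and "v \<in> V" and "w \<in> V" and "graph_dist E v w = m"
  shows "covariance M (\<lambda>\<omega>. rsa V E (\<lambda>u. \<tau> u \<omega>) t v) (\<lambda>\<omega>. rsa V E (\<lambda>u. \<tau> u \<omega>) t w)
    = - ((\<beta> t)\<^sup>2 / 2) *
      (\<Sum>n. (2 * ln (\<beta> t)) ^ (m + 1 + 2 * n) / fact (m + 1 + 2 * n))"
proof -
  have \<beta>: "\<beta> t = vacancy k t"
    using rooted_vacancy[OF assms(1,4,5,7,8)] assms(6) by simp
  have g: "simple_graph V E" "connected_graph V E" "\<nexists>xs. graph_cycle E xs"
    and deg: "\<And>v. v \<in> V \<Longrightarrow> card (E `` {v}) = k + 1"
    using assms(2) by (auto simp: regular_tree_def is_tree_def graph_degree_def)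
  have E: "E \<subseteq> V \<times> V" and symE: "\<And>a b. (a, b) \<in> E \<Longrightarrow> (b, a) \<in> E"
    using g(1) by (auto simp: simple_graph_def sym_def)
  have fin: "finite (E `` {v})" if "v \<in> V" for v
    using deg[OF that] by (intro card_ge_0_finite) simp
  interpret prob_space M using assms(3) by (simp add: iid_uniform_def)
  interpret rsa_tree M k V E \<tau> E
  proof
    show "countable V" using countable_connected[OF g(1,2) fin] .
    show "card (E `` {v} - {u}) = k" if "(u, v) \<in> E" for u v
    proof -
      have "v \<in> V" "u \<in> E `` {v}" using that E symE by auto
      then show ?thesis using deg[of v] by simp
    qed
  qed (use assms(1,3) g fin in \<open>auto simp: iid_uniform_def\<close>)
  have "(v, w) \<in> E\<^sup>*" using g(2) assms(10,11) by (auto simp: connected_graph_def)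
  then obtain u where "nonbacktracking E u m" "u 0 = v" "u m = w"
    using geodesic_nonbacktracking[of v w E] unfolding assms(12) by blast
  then show ?thesis
    using covariance_path[OF refl _ assms(9,7,8), of u]
    unfolding \<beta> parity_tail_def by simp
qed



end
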